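(* Let $p$ be a prime number. Let $G$ be a $p$-adic analytic Lie group with Lie algebra $\mathfrak{g}$. Let $(M,\omega)$ be a paracompact $p$-adic analytic symplectic manifold and let $\psi:G\times M\to M$ be a $p$-adic analytic symplectic Lie group action on $(M,\omega)$. Then $\psi$ is weakly Hamiltonian, that is, there exists a $p$-adic analytic momentum map $\mu:M\to\mathfrak{g}^*$ for $\psi$.
   Context: A function between open subsets of $(\mathbb{Q}_p)^{d_1}$ and $(\mathbb{Q}_p)^{d_2}$ is $p$-adic analytic if its domain is a union of open sets on each of which it is given by a convergent power series; $p$-adic analytic manifolds (in the sense of Schneider's book; not assumed paracompact in general), analytic maps, vector fields, forms, the differential $\mathrm{d}$, pullback and push-forward are defined via charts as in the real case. A $p$-adic analytic symplectic manifold is a pair $(M,\omega)$ with $M$ a $2n$-dimensional $p$-adic analytic manifold and $\omega$ a closed non-degenerate $p$-adic analytic $2$-form. A $p$-adic analytic Lie group is a $p$-adic analytic manifold $G$ with a group structure such that multiplication and inversion are analytic; its Lie algebra $\mathfrak{g}$ is identified as a vector space with the tangent space $\mathrm{T}_{\mathbf 1}G$ at the identity $\mathbf 1$. A $p$-adic analytic Lie group action is a group action $\psi:G\times M\to M$ which is a $p$-adic analytic map. It is symplectic if $\psi(g,\cdot)^*\omega=\omega$ for every $g\in G$. For $\xi\in\mathfrak{g}$, the vector field generated by the action in the direction of $\xi$ is $\mathrm{X}_\psi(\xi)(m)=\psi(\cdot,m)_*(\xi)$ (push-forward of $\xi\in \mathrm{T}_{\mathbf 1}G$ by $g\mapsto\psi(g,m)$).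 A $p$-adic analytic momentum map for a symplectic action $\psi$ is a $p$-adic analytic map $\mu:M\to\mathfrak{g}^*$ such that $\omega(\mathrm{X}_\psi(\xi),\cdot)=\mathrm{d}\mu_\xi$ for each $\xi\in\mathfrak{g}$, where $\mu_\xi:M\to\mathbb{Q}_p$ is $\mu_\xi(m)=\langle\mu(m),\xi\rangle$. The action is weakly Hamiltonian if such a $\mu$ exists. *)

theory Defs
  imports "HOL-Analysis.Analysis" "HOL-Algebra.Group_Action" "Berlekamp_Zassenhaus.Finite_Field"
begin

section \<open>The field of p-adic numbers\<close>

subsection \<open>The p-adic absolute value on the rationals\<close>

definition padic_abs :: "nat \<Rightarrow> rat \<Rightarrow> real" where
  "padic_abs p x = (if x = 0 then 0 else
     real p powi (int (multiplicity (int p) (snd (quotient_of x)))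
                - int (multiplicity (int p) (fst (quotient_of x)))))"

lemma padic_abs_0 [simp]: "padic_abs p 0 = 0"
  by (simp add: padic_abs_def)

lemma padic_abs_eq:
  fixes a b :: int
  assumes p: "prime p" and ab: "a \<noteq> 0" "b \<noteq> 0"
  shows "padic_abs p (of_int a / of_int b) =
    real p powi (int (multiplicity (int p) b) - int (multiplicity (int p) a))"
proof -
  define x :: rat where "x = of_int a / of_int b"
  obtain n d where nd: "quotient_of x = (n, d)" by (cases "quotient_of x")
  have d: "d > 0" using quotient_of_denom_pos[OF nd] .
  have x: "x = of_int n / of_int d" using quotient_of_div[OF nd] .
  have x0: "x \<noteq> 0" using ab by (simp add: x_def)
  hence n: "n \<noteq> 0" using x by auto
  have "(of_int (n * b) :: rat) = of_int (a * d)"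
    using x d ab by (simp add: x_def field_simps)
  hence eq: "n * b = a * d" by (simp only: of_int_eq_iff)
  have pe: "prime_elem (int p)" using p by simp
  have "multiplicity (int p) (n * b) = multiplicity (int p) (a * d)" by (simp add: eq)
  hence "multiplicity (int p) n + multiplicity (int p) b = multiplicity (int p) a + multiplicity (int p) d"
    using n ab d by (simp add: prime_elem_multiplicity_mult_distrib[OF pe])
  hence "int (multiplicity (int p) d) - int (multiplicity (int p) n)
    = int (multiplicity (int p) b) - int (multiplicity (int p) a)" by linarith
  thus ?thesis using x0 nd by (simp add: padic_abs_def x_def)
qed

lemma rat_common_denom:
  obtains a b d :: int where "d \<noteq> 0" "(x::rat) = of_int a / of_int d" "(y::rat) = of_int b / of_int d"
proof -
  obtain a c where 1: "quotient_of x = (a, c)" by (cases "quotient_of x")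
  obtain b d where 2: "quotient_of y = (b, d)" by (cases "quotient_of y")
  have c: "c > 0" "d > 0" using quotient_of_denom_pos[OF 1] quotient_of_denom_pos[OF 2] .
  show thesis
    by (rule that[of "c * d" "a * d" "b * c"])
       (use c quotient_of_div[OF 1] quotient_of_div[OF 2] in auto)
qed

lemma padic_abs_1 [simp]: "prime p \<Longrightarrow> padic_abs p 1 = 1"
  using padic_abs_eq[of p 1 1] by simp

lemma padic_abs_pos: "prime p \<Longrightarrow> x \<noteq> 0 \<Longrightarrow> padic_abs p x > 0"
  by (simp add: padic_abs_def prime_gt_0_nat zero_less_power_int)

lemma padic_abs_nonneg: "prime p \<Longrightarrow> padic_abs p x \<ge> 0"
  by (cases "x = 0") (auto simp: padic_abs_pos less_imp_le)

lemma padic_abs_mult: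
  assumes p: "prime p" shows "padic_abs p (x * y) = padic_abs p x * padic_abs p y"
proof (cases "x = 0 \<or> y = 0")
  case False
  obtain a b d where d: "d \<noteq> 0" and x: "x = of_int a / of_int d" and y: "y = of_int b / of_int d"
    by (rule rat_common_denom)
  have ab: "a \<noteq> 0" "b \<noteq> 0" using False x y by auto
  have pe: "prime_elem (int p)" using p by simp
  have xy: "x * y = of_int (a * b) / of_int (d * d)" by (simp add: x y)
  have p0: "real p \<noteq> 0" using p by auto
  show ?thesis
    unfolding xy unfolding x y padic_abs_eq[OF p ab(1) d] padic_abs_eq[OF p ab(2) d]
    using padic_abs_eq[OF p, of "a * b" "d * d"] ab d p0
    by (simp add: prime_elem_multiplicity_mult_distrib[OF pe] flip: power_int_add)
       (simp add: algebra_simps)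
qed auto

lemma padic_abs_minus [simp]: "prime p \<Longrightarrow> padic_abs p (- x) = padic_abs p x"
proof -
  assume p: "prime p"
  have "padic_abs p (-1) = 1" using padic_abs_eq[OF p, of "-1" 1] not_is_unit_0 multiplicity_unit_right[of "-1" "int p"] by simp
  thus ?thesis using padic_abs_mult[OF p, of "-1" x] by simp
qed

lemma padic_abs_ultra:
  assumes p: "prime p" shows "padic_abs p (x + y) \<le> max (padic_abs p x) (padic_abs p y)"
proof (cases "x = 0 \<or> y = 0 \<or> x + y = 0")
  case True
  thus ?thesis using padic_abs_nonneg[OF p] by (auto simp: le_max_iff_disj)
next
  case False
  obtain a b d where d: "d \<noteq> 0" and x: "x = of_int a / of_int d" and y: "y = of_int b / of_int d"
    by (rule rat_common_denom)
  have xy: "x + y = of_int (a + b) / of_int d" by (simp add: x y add_divide_distrib)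
  have ab: "a \<noteq> 0" "b \<noteq> 0" "a + b \<noteq> 0" using False x y xy by auto
  let ?m = "\<lambda>z. multiplicity (int p) z"
  have "\<not> is_unit (int p)" using prime_gt_1_nat[OF p] by simp
  hence "?m (a + b) \<ge> min (?m a) (?m b)"
    using ab by (intro multiplicity_geI dvd_add) (auto intro: multiplicity_dvd')
  moreover have "1 \<le> real p" using p prime_ge_1_nat by simp
  ultimately show ?thesis
    unfolding xy unfolding x y padic_abs_eq[OF p ab(1) d] padic_abs_eq[OF p ab(2) d]
      padic_abs_eq[OF p ab(3) d]
    by (auto simp: le_max_iff_disj min_le_iff_disj intro!: power_int_increasing)
qed

lemma padic_abs_triangle: "prime p \<Longrightarrow> padic_abs p (x + y) \<le> padic_abs p x + padic_abs p y"
  using padic_abs_ultra[of p x y] padic_abs_nonneg[of p x] padic_abs_nonneg[of p y] by linarith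

lemma padic_abs_inverse:
  assumes p: "prime p" shows "padic_abs p (inverse x) = inverse (padic_abs p x)"
proof (cases "x = 0")
  case False
  hence "padic_abs p x * padic_abs p (inverse x) = 1"
    using p by (simp flip: padic_abs_mult)
  thus ?thesis by (metis inverse_unique)
qed auto

lemma padic_abs_diff_le: 
  assumes p: "prime p" shows "\<bar>padic_abs p x - padic_abs p y\<bar> \<le> padic_abs p (x - y)"
  using padic_abs_triangle[OF p, of "x - y" y] padic_abs_triangle[OF p, of "y - x" x]
    padic_abs_minus[OF p, of "x - y"] by simp

subsection \<open>Completion\<close>

text \<open>
  The prime is carried by a type: \<open>'p padic\<close> is the field of \<open>p\<close>-adic numbers
  for \<open>p = CARD('p)\<close>, obtained as the completion of the rationals with respect to
  the \<open>p\<close>-adic absolute value.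
\<close>

definition padic_null :: "nat \<Rightarrow> (nat \<Rightarrow> rat) \<Rightarrow> bool" where
  "padic_null p X \<longleftrightarrow> (\<lambda>n. padic_abs p (X n)) \<longlonglongrightarrow> 0"

definition padic_Cauchy :: "nat \<Rightarrow> (nat \<Rightarrow> rat) \<Rightarrow> bool" where
  "padic_Cauchy p X \<longleftrightarrow> (\<forall>r>0. \<exists>k. \<forall>m\<ge>k. \<forall>n\<ge>k. padic_abs p (X m - X n) < r)"

lemma padic_CauchyD:
  "padic_Cauchy p X \<Longrightarrow> r > 0 \<Longrightarrow> \<exists>k. \<forall>m\<ge>k. \<forall>n\<ge>k. padic_abs p (X m - X n) < r"
  by (simp add: padic_Cauchy_def)

lemma padic_null_0 [simp]: "padic_null p (\<lambda>n. 0)"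
  by (simp add: padic_null_def)

lemma padic_null_bound:
  assumes "prime p" "\<And>n. padic_abs p (X n) \<le> f n" "f \<longlonglongrightarrow> 0"
  shows "padic_null p X"
  unfolding padic_null_def
  by (rule tendsto_sandwich[OF _ _ tendsto_const assms(3)]) (use assms padic_abs_nonneg in auto)

lemma padic_null_minus: "prime p \<Longrightarrow> padic_null p X \<Longrightarrow> padic_null p (\<lambda>n. - X n)"
  by (simp add: padic_null_def)

lemma padic_null_add:
  assumes "prime p" "padic_null p X" "padic_null p Y" shows "padic_null p (\<lambda>n. X n + Y n)"
  by (rule padic_null_bound[OF assms(1) padic_abs_triangle[OF assms(1)]])
     (use tendsto_add[OF assms(2,3)[unfolded padic_null_def]] in simp)

lemma padic_Cauchy_const [simp]: "padic_Cauchy p (\<lambda>n. x)"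
  by (simp add: padic_Cauchy_def)

lemma padic_Cauchy_minus:
  assumes p: "prime p" and "padic_Cauchy p X" shows "padic_Cauchy p (\<lambda>n. - X n)"
proof -
  have "padic_abs p (- X m - - X n) = padic_abs p (X m - X n)" for m n
    using padic_abs_minus[OF p, of "X m - X n"] by simp
  thus ?thesis using assms(2) by (simp only: padic_Cauchy_def)
qed

lemma padic_Cauchy_add:
  assumes p: "prime p" and X: "padic_Cauchy p X" and Y: "padic_Cauchy p Y"
  shows "padic_Cauchy p (\<lambda>n. X n + Y n)"
  unfolding padic_Cauchy_def
proof (intro allI impI)
  fix r :: real assume r: "r > 0"
  obtain k where k: "\<forall>m\<ge>k. \<forall>n\<ge>k. padic_abs p (X m - X n) < r"
    using X r by (auto simp: padic_Cauchy_def)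
  obtain l where l: "\<forall>m\<ge>l. \<forall>n\<ge>l. padic_abs p (Y m - Y n) < r"
    using Y r by (auto simp: padic_Cauchy_def)
  have "padic_abs p (X m + Y m - (X n + Y n)) < r" if "m \<ge> max k l" "n \<ge> max k l" for m n
  proof -
    have "padic_abs p (X m - X n) < r" "padic_abs p (Y m - Y n) < r" using k l that by auto
    thus ?thesis unfolding add_diff_add
      using padic_abs_ultra[OF p, of "X m - X n" "Y m - Y n"] by linarith
  qed
  thus "\<exists>k. \<forall>m\<ge>k. \<forall>n\<ge>k. padic_abs p (X m + Y m - (X n + Y n)) < r" by blast
qed

lemma padic_Cauchy_convergent:
  assumes p: "prime p" and X: "padic_Cauchy p X"
  shows "convergent (\<lambda>n. padic_abs p (X n))"
proof (rule Cauchy_convergent, rule metric_CauchyI)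
  fix e :: real assume "e > 0"
  then obtain k where "\<forall>m\<ge>k. \<forall>n\<ge>k. padic_abs p (X m - X n) < e"
    using X by (auto simp: padic_Cauchy_def)
  thus "\<exists>M. \<forall>m\<ge>M. \<forall>n\<ge>M. dist (padic_abs p (X m)) (padic_abs p (X n)) < e"
    unfolding dist_real_def by (meson padic_abs_diff_le[OF p] le_less_trans)
qed

lemma padic_Cauchy_bounded:
  assumes p: "prime p" and X: "padic_Cauchy p X"
  shows "\<exists>B>0. \<forall>n. padic_abs p (X n) \<le> B"
proof -
  have "Bseq (\<lambda>n. padic_abs p (X n))"
    using padic_Cauchy_convergent[OF assms] by (rule convergent_imp_Bseq)
  then obtain K where K: "K > 0" "\<forall>n. norm (padic_abs p (X n)) \<le> K"
    by (auto simp: Bseq_def)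
  have "padic_abs p (X n) \<le> K" for n
    using K(2)[rule_format, of n] by simp
  thus ?thesis using K(1) by blast
qed

lemma padic_null_mult:
  assumes p: "prime p" and X: "padic_Cauchy p X" and Y: "padic_null p Y"
  shows "padic_null p (\<lambda>n. X n * Y n)"
proof -
  obtain B where B: "B > 0" "\<And>n. padic_abs p (X n) \<le> B" using padic_Cauchy_bounded[OF p X] by blast
  have "(\<lambda>n. B * padic_abs p (Y n)) \<longlonglongrightarrow> B * 0"
    using Y unfolding padic_null_def by (rule tendsto_mult_left)
  hence "(\<lambda>n. B * padic_abs p (Y n)) \<longlonglongrightarrow> 0" by simp
  moreover have "padic_abs p (X n * Y n) \<le> B * padic_abs p (Y n)" for n
    unfolding padic_abs_mult[OF p] by (intro mult_right_mono B padic_abs_nonneg[OF p])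
  ultimately show ?thesis by (rule padic_null_bound[OF p, rotated])
qed

lemma padic_Cauchy_mult:
  assumes p: "prime p" and X: "padic_Cauchy p X" and Y: "padic_Cauchy p Y"
  shows "padic_Cauchy p (\<lambda>n. X n * Y n)"
  unfolding padic_Cauchy_def
proof (intro allI impI)
  fix r :: real assume r: "r > 0"
  obtain A where A: "A > 0" "\<And>n. padic_abs p (X n) \<le> A" using padic_Cauchy_bounded[OF p X] by blast
  obtain B where B: "B > 0" "\<And>n. padic_abs p (Y n) \<le> B" using padic_Cauchy_bounded[OF p Y] by blast
  obtain k where k: "\<forall>m\<ge>k. \<forall>n\<ge>k. padic_abs p (X m - X n) < r / B"
    using padic_CauchyD[OF X, of "r / B"] r B(1) by auto
  obtain l where l: "\<forall>m\<ge>l. \<forall>n\<ge>l. padic_abs p (Y m - Y n) < r / A"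
    using padic_CauchyD[OF Y, of "r / A"] r A(1) by auto
  have "padic_abs p (X m * Y m - X n * Y n) < r" if mn: "m \<ge> max k l" "n \<ge> max k l" for m n
  proof -
    have eq: "X m * Y m - X n * Y n = (X m - X n) * Y m + X n * (Y m - Y n)"
      by (simp add: algebra_simps)
    have "padic_abs p ((X m - X n) * Y m) \<le> padic_abs p (X m - X n) * B"
      by (simp add: padic_abs_mult[OF p] mult_left_mono B padic_abs_nonneg[OF p])
    also have "\<dots> < r" using k mn B by (simp add: pos_less_divide_eq)
    finally have 1: "padic_abs p ((X m - X n) * Y m) < r" .
    have "padic_abs p (X n * (Y m - Y n)) \<le> A * padic_abs p (Y m - Y n)"
      by (simp add: padic_abs_mult[OF p] mult_right_mono A padic_abs_nonneg[OF p])
    also have "\<dots> < r" using l mn A by (simp add: pos_less_divide_eq mult.commute)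
    finally have 2: "padic_abs p (X n * (Y m - Y n)) < r" .
    show ?thesis unfolding eq using padic_abs_ultra[OF p, of "(X m - X n) * Y m" "X n * (Y m - Y n)"] 1 2
      by linarith
  qed
  thus "\<exists>k. \<forall>m\<ge>k. \<forall>n\<ge>k. padic_abs p (X m * Y m - X n * Y n) < r" by blast
qed

lemma padic_Cauchy_not_null:
  assumes p: "prime p" and X: "padic_Cauchy p X" "\<not> padic_null p X"
  shows "\<exists>b>0. \<exists>k. \<forall>n\<ge>k. padic_abs p (X n) > b"
proof -
  obtain L where L: "(\<lambda>n. padic_abs p (X n)) \<longlonglongrightarrow> L"
    using padic_Cauchy_convergent[OF p X(1)] by (auto simp: convergent_def)
  have "L \<ge> 0" using L by (rule LIMSEQ_le_const) (use padic_abs_nonneg[OF p] in auto)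
  moreover have "L \<noteq> 0" using L X(2) by (auto simp: padic_null_def)
  ultimately have "L > 0" by simp
  hence "eventually (\<lambda>n. padic_abs p (X n) > L / 2) sequentially"
    by (intro order_tendstoD(1)[OF L]) simp
  hence "\<exists>k. \<forall>n\<ge>k. padic_abs p (X n) > L / 2"
    by (simp add: eventually_sequentially)
  thus ?thesis using \<open>L > 0\<close> by (intro exI[of _ "L / 2"]) simp
qed

lemma padic_inverse_bound:
  assumes p: "prime p" and b: "b > 0" "padic_abs p x > b" "padic_abs p y > b"
  shows "padic_abs p (inverse x - inverse y) \<le> padic_abs p (x - y) / (b * b)"
proof -
  have nz: "x \<noteq> 0" "y \<noteq> 0" using b by auto
  have "inverse x - inverse y = - ((x - y) * inverse (x * y))"
    using nz by (simp add: field_simps)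
  hence "padic_abs p (inverse x - inverse y) = padic_abs p (x - y) / (padic_abs p x * padic_abs p y)"
    using p by (simp add: padic_abs_mult padic_abs_inverse divide_inverse)
  also have "\<dots> \<le> padic_abs p (x - y) / (b * b)"
    using b by (intro divide_left_mono mult_mono padic_abs_nonneg[OF p] mult_pos_pos) auto
  finally show ?thesis .
qed

lemma padic_Cauchy_inverse:
  assumes p: "prime p" and X: "padic_Cauchy p X" "\<not> padic_null p X"
  shows "padic_Cauchy p (\<lambda>n. inverse (X n))"
  unfolding padic_Cauchy_def
proof (intro allI impI)
  fix r :: real assume r: "r > 0"
  obtain b k where b: "b > 0" and k: "\<And>n. n \<ge> k \<Longrightarrow> padic_abs p (X n) > b"
    using padic_Cauchy_not_null[OF p X] by blast
  obtain l where l: "\<forall>m\<ge>l. \<forall>n\<ge>l. padic_abs p (X m - X n) < r * (b * b)"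
    using padic_CauchyD[OF X(1), of "r * (b * b)"] r b by auto
  have "padic_abs p (inverse (X m) - inverse (X n)) < r" if "m \<ge> max k l" "n \<ge> max k l" for m n
  proof -
    have "padic_abs p (inverse (X m) - inverse (X n)) \<le> padic_abs p (X m - X n) / (b * b)"
      by (rule padic_inverse_bound[OF p b]) (use k that in auto)
    also have "\<dots> < r" using l that b by (simp add: pos_divide_less_eq)
    finally show ?thesis .
  qed
  thus "\<exists>k. \<forall>m\<ge>k. \<forall>n\<ge>k. padic_abs p (inverse (X m) - inverse (X n)) < r" by blast
qed

lemma padic_null_inverse_diff:
  assumes p: "prime p" and X: "padic_Cauchy p X" "\<not> padic_null p X"
    and Y: "padic_Cauchy p Y" "\<not> padic_null p Y" and XY: "padic_null p (\<lambda>n. X n - Y n)"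
  shows "padic_null p (\<lambda>n. inverse (X n) - inverse (Y n))"
proof -
  obtain b k where b: "b > 0" and k: "\<And>n. n \<ge> k \<Longrightarrow> padic_abs p (X n) > b"
    using padic_Cauchy_not_null[OF p X] by blast
  obtain c l where c: "c > 0" and l: "\<And>n. n \<ge> l \<Longrightarrow> padic_abs p (Y n) > c"
    using padic_Cauchy_not_null[OF p Y] by blast
  define d where "d = min b c"
  have d: "d > 0" using b c by (simp add: d_def)
  have "padic_abs p (inverse (X n) - inverse (Y n)) \<le> padic_abs p (X n - Y n) / (d * d)"
    if "n \<ge> max k l" for n
    by (rule padic_inverse_bound[OF p d]) (use k[of n] l[of n] that in \<open>auto simp: d_def\<close>)
  hence ev: "eventually (\<lambda>n. padic_abs p (inverse (X n) - inverse (Y n)) \<le> padic_abs p (X n - Y n) / (d * d)) sequentially"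
    unfolding eventually_sequentially by blast
  have "(\<lambda>n. padic_abs p (X n - Y n) / (d * d)) \<longlonglongrightarrow> 0 / (d * d)"
    using XY d unfolding padic_null_def by (intro tendsto_intros) auto
  thus ?thesis unfolding padic_null_def
    by (intro tendsto_sandwich[OF _ ev tendsto_const]) (auto simp: padic_abs_nonneg[OF p])
qed

typedef (overloaded) ('p::prime_card) padic_seq = "{X. padic_Cauchy CARD('p) X}"
  by (rule exI[of _ "\<lambda>n. 0"]) simp

setup_lifting type_definition_padic_seq

instantiation padic_seq :: (prime_card) comm_ring_1
begin

lift_definition zero_padic_seq :: "'a padic_seq" is "\<lambda>n. 0" by simp

lift_definition one_padic_seq :: "'a padic_seq" is "\<lambda>n. 1" by simp

lift_definition plus_padic_seq :: "'a padic_seq \<Rightarrow> 'a padic_seq \<Rightarrow> 'a padic_seq"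
  is "\<lambda>X Y n. X n + Y n" by (rule padic_Cauchy_add[OF prime_card])

lift_definition uminus_padic_seq :: "'a padic_seq \<Rightarrow> 'a padic_seq"
  is "\<lambda>X n. - X n" by (rule padic_Cauchy_minus[OF prime_card])

lift_definition minus_padic_seq :: "'a padic_seq \<Rightarrow> 'a padic_seq \<Rightarrow> 'a padic_seq"
  is "\<lambda>X Y n. X n - Y n"
  using padic_Cauchy_add[OF prime_card _ padic_Cauchy_minus[OF prime_card]] by fastforce

lift_definition times_padic_seq :: "'a padic_seq \<Rightarrow> 'a padic_seq \<Rightarrow> 'a padic_seq"
  is "\<lambda>X Y n. X n * Y n" by (rule padic_Cauchy_mult[OF prime_card])

instance
  by standard (transfer; auto simp: algebra_simps fun_eq_iff)+

end

lift_definition null_seq :: "'p::prime_card padic_seq \<Rightarrow> bool" is "padic_null CARD('p)" .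

lift_definition inverse_seq :: "'p::prime_card padic_seq \<Rightarrow> 'p padic_seq" is
  "\<lambda>X. if padic_null CARD('p) X then (\<lambda>n. 0) else (\<lambda>n. inverse (X n))"
  by (auto intro: padic_Cauchy_inverse[OF prime_card])

lift_definition lim_abs_seq :: "'p::prime_card padic_seq \<Rightarrow> real" is
  "\<lambda>X. lim (\<lambda>n. padic_abs CARD('p) (X n))" .

lemma null_seq_0 [simp]: "null_seq 0"
  by transfer simp

lemma null_seq_add: "null_seq X \<Longrightarrow> null_seq Y \<Longrightarrow> null_seq (X + Y)"
  by transfer (rule padic_null_add[OF prime_card])

lemma null_seq_minus: "null_seq X \<Longrightarrow> null_seq (- X)"
  by transfer (rule padic_null_minus[OF prime_card])

lemma null_seq_mult: "null_seq Y \<Longrightarrow> null_seq (X * Y)"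
  by transfer (rule padic_null_mult[OF prime_card])

lemma not_null_seq_1: "\<not> null_seq 1"
  by transfer (simp add: padic_null_def prime_card LIMSEQ_const_iff)

lemma null_seq_diff_cong: "null_seq (X - Y) \<Longrightarrow> null_seq X \<longleftrightarrow> null_seq Y"
  by (metis null_seq_add null_seq_minus diff_add_cancel minus_diff_eq)

lemma null_seq_inverse_diff:
  assumes "null_seq (X - Y)" shows "null_seq (inverse_seq X - inverse_seq Y)"
proof (cases "null_seq X")
  case True
  hence "null_seq Y" using null_seq_diff_cong[OF assms] by simp
  with True show ?thesis by transfer simp
next
  case False
  hence "\<not> null_seq Y" using null_seq_diff_cong[OF assms] by simp
  with False assms show ?thesis
    by transfer (simp add: padic_null_inverse_diff[OF prime_card])
qed

lemma null_seq_inverse_mult: "\<not> null_seq X \<Longrightarrow> null_seq (inverse_seq X * X - 1)"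
proof transfer
  fix X assume X: "padic_Cauchy CARD('a) X" "\<not> padic_null CARD('a) X"
  obtain b k where b: "b > 0" and k: "\<And>n. n \<ge> k \<Longrightarrow> padic_abs CARD('a) (X n) > b"
    using padic_Cauchy_not_null[OF prime_card X] by blast
  have "inverse (X n) * X n - 1 = 0" if "n \<ge> k" for n
    using k[OF that] b by (cases "X n = 0") auto
  hence "eventually (\<lambda>n. padic_abs CARD('a) (inverse (X n) * X n - 1) = 0) sequentially"
    by (auto simp: eventually_sequentially intro!: exI[of _ k])
  hence "padic_null CARD('a) (\<lambda>n. inverse (X n) * X n - 1)"
    unfolding padic_null_def by (rule tendsto_eventually)
  thus "padic_null CARD('a)
     (\<lambda>n. (if padic_null CARD('a) X then \<lambda>n. 0 else (\<lambda>n. inverse (X n))) n * X n - 1)"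
    using X by simp
qed

lemma padic_abs_LIMSEQ_lim:
  assumes "padic_Cauchy CARD('p::prime_card) X"
  shows "(\<lambda>n. padic_abs CARD('p) (X n)) \<longlonglongrightarrow> lim (\<lambda>n. padic_abs CARD('p) (X n))"
  using padic_Cauchy_convergent[OF prime_card assms] by (simp add: convergent_LIMSEQ_iff)

lemma lim_abs_seq_cong: "null_seq (X - Y) \<Longrightarrow> lim_abs_seq X = lim_abs_seq Y"
proof transfer
  fix X Y assume X: "padic_Cauchy CARD('a) X" and Y: "padic_Cauchy CARD('a) Y"
    and XY: "padic_null CARD('a) (\<lambda>n. X n - Y n)"
  have "(\<lambda>n. padic_abs CARD('a) (X n) - padic_abs CARD('a) (Y n)) \<longlonglongrightarrow> 0"
    by (rule Lim_null_comparison[where g = "\<lambda>n. padic_abs CARD('a) (X n - Y n)"])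
       (use XY in \<open>simp_all add: padic_null_def padic_abs_diff_le[OF prime_card]\<close>)
  hence "(\<lambda>n. padic_abs CARD('a) (Y n)) \<longlonglongrightarrow> lim (\<lambda>n. padic_abs CARD('a) (X n))"
    using tendsto_diff[OF padic_abs_LIMSEQ_lim[OF X]] by force
  thus "lim (\<lambda>n. padic_abs CARD('a) (X n)) = lim (\<lambda>n. padic_abs CARD('a) (Y n))"
    by (simp add: limI)
qed

lemma lim_abs_seq_mult: "lim_abs_seq (X * Y) = lim_abs_seq X * lim_abs_seq Y"
proof transfer
  fix X Y :: "nat \<Rightarrow> rat"
  assume "padic_Cauchy CARD('a) X" "padic_Cauchy CARD('a) Y"
  thus "lim (\<lambda>n. padic_abs CARD('a) (X n * Y n)) =
    lim (\<lambda>n. padic_abs CARD('a) (X n)) * lim (\<lambda>n. padic_abs CARD('a) (Y n))"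
    unfolding padic_abs_mult[OF prime_card] by (intro limI tendsto_mult padic_abs_LIMSEQ_lim)
qed

lemma lim_abs_seq_ultra: "lim_abs_seq (X + Y) \<le> max (lim_abs_seq X) (lim_abs_seq Y)"
proof transfer
  fix X Y :: "nat \<Rightarrow> rat"
  assume X: "padic_Cauchy CARD('a) X" and Y: "padic_Cauchy CARD('a) Y"
  from padic_abs_LIMSEQ_lim[OF padic_Cauchy_add[OF prime_card this]]
  show "lim (\<lambda>n. padic_abs CARD('a) (X n + Y n)) \<le>
    max (lim (\<lambda>n. padic_abs CARD('a) (X n))) (lim (\<lambda>n. padic_abs CARD('a) (Y n)))"
    by (rule LIMSEQ_le[OF _ tendsto_max[OF padic_abs_LIMSEQ_lim[OF X] padic_abs_LIMSEQ_lim[OF Y]]])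
       (simp add: padic_abs_ultra[OF prime_card])
qed

lemma lim_abs_seq_minus: "lim_abs_seq (- X) = lim_abs_seq X"
  by transfer (simp add: prime_card)

lemma lim_abs_seq_nonneg: "lim_abs_seq X \<ge> 0"
proof transfer
  fix X assume X: "padic_Cauchy CARD('a) X"
  show "0 \<le> lim (\<lambda>n. padic_abs CARD('a) (X n))"
    by (rule LIMSEQ_le_const[OF padic_abs_LIMSEQ_lim[OF X]]) (simp add: padic_abs_nonneg prime_card)
qed

lemma lim_abs_seq_eq_0: "lim_abs_seq X = 0 \<longleftrightarrow> null_seq X"
proof transfer
  fix X assume X: "padic_Cauchy CARD('a) X"
  show "lim (\<lambda>n. padic_abs CARD('a) (X n)) = 0 \<longleftrightarrow> padic_null CARD('a) X"
    unfolding padic_null_def using padic_abs_LIMSEQ_lim[OF X] limI by metis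
qed

quotient_type (overloaded) 'p padic = "'p::prime_card padic_seq" / "\<lambda>X Y. null_seq (X - Y)"
proof (rule equivpI)
  show "reflp (\<lambda>X Y :: 'p padic_seq. null_seq (X - Y))"
    by (rule reflpI) simp
  show "symp (\<lambda>X Y :: 'p padic_seq. null_seq (X - Y))"
    by (rule sympI) (metis null_seq_minus minus_diff_eq)
  show "transp (\<lambda>X Y :: 'p padic_seq. null_seq (X - Y))"
  proof (rule transpI)
    fix X Y Z :: "'p padic_seq" assume "null_seq (X - Y)" "null_seq (Y - Z)"
    from null_seq_add[OF this] show "null_seq (X - Z)" by simp
  qed
qed

instantiation padic :: (prime_card) field
begin

lift_definition zero_padic :: "'a padic" is 0 .

lift_definition one_padic :: "'a padic" is 1 .

lift_definition plus_padic :: "'a padic \<Rightarrow> 'a padic \<Rightarrow> 'a padic" is "(+)"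
  unfolding add_diff_add by (rule null_seq_add)

lift_definition uminus_padic :: "'a padic \<Rightarrow> 'a padic" is uminus
  unfolding minus_diff_minus by (rule null_seq_minus)

lift_definition minus_padic :: "'a padic \<Rightarrow> 'a padic \<Rightarrow> 'a padic" is "(-)"
proof -
  fix X X' Y Y' :: "'a padic_seq" assume "null_seq (X - X')" "null_seq (Y - Y')"
  from null_seq_add[OF this(1) null_seq_minus[OF this(2)]]
  show "null_seq (X - Y - (X' - Y'))" by (simp add: algebra_simps)
qed

lift_definition times_padic :: "'a padic \<Rightarrow> 'a padic \<Rightarrow> 'a padic" is "(*)"
proof -
  fix X X' Y Y' :: "'a padic_seq" assume "null_seq (X - X')" "null_seq (Y - Y')"
  from null_seq_add[OF null_seq_mult[OF this(1), of Y'] null_seq_mult[OF this(2), of X]]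
  show "null_seq (X * Y - X' * Y')" by (simp add: algebra_simps)
qed

lift_definition inverse_padic :: "'a padic \<Rightarrow> 'a padic" is inverse_seq
  by (rule null_seq_inverse_diff)

definition divide_padic :: "'a padic \<Rightarrow> 'a padic \<Rightarrow> 'a padic" where
  "divide_padic x y = x * inverse y"

instance
proof
  fix a b c :: "'a padic"
  show "a + b + c = a + (b + c)" by transfer (simp add: algebra_simps)
  show "a + b = b + a" by transfer (simp add: algebra_simps)
  show "0 + a = a" by transfer simp
  show "- a + a = 0" by transfer simp
  show "a - b = a + - b" by transfer simp
  show "a * b * c = a * (b * c)" by transfer (simp add: algebra_simps)
  show "a * b = b * a" by transfer (simp add: algebra_simps)
  show "1 * a = a" by transfer simp
  show "(a + b) * c = a * c + b * c" by transfer (simp add: algebra_simps)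
  show "0 \<noteq> (1 :: 'a padic)"
    by transfer (use not_null_seq_1 null_seq_minus[of "- 1"] in auto)
  show "inverse (0 :: 'a padic) = 0"
    by transfer (simp, transfer, simp)
  show "a div b = a * inverse b" by (rule divide_padic_def)
  show "a \<noteq> 0 \<Longrightarrow> inverse a * a = 1"
    by transfer (simp add: null_seq_inverse_mult)
qed

end

lift_definition padic_norm :: "'p::prime_card padic \<Rightarrow> real" is lim_abs_seq
  by (rule lim_abs_seq_cong)

lemma padic_norm_mult: "padic_norm (x * y) = padic_norm x * padic_norm y"
  by transfer (rule lim_abs_seq_mult)

lemma padic_norm_ultra: "padic_norm (x + y) \<le> max (padic_norm x) (padic_norm y)"
  by transfer (rule lim_abs_seq_ultra)

lemma padic_norm_minus [simp]: "padic_norm (- x) = padic_norm x"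
  by transfer (rule lim_abs_seq_minus)

lemma padic_norm_nonneg: "padic_norm x \<ge> 0"
  by transfer (rule lim_abs_seq_nonneg)

lemma padic_norm_eq_0 [simp]: "padic_norm x = 0 \<longleftrightarrow> x = 0"
  by transfer (simp add: lim_abs_seq_eq_0)

instantiation padic :: (prime_card) metric_space
begin

definition dist_padic :: "'a padic \<Rightarrow> 'a padic \<Rightarrow> real" where
  "dist_padic x y = padic_norm (x - y)"

definition uniformity_padic :: "('a padic \<times> 'a padic) filter" where
  "uniformity_padic = (INF e\<in>{0 <..}. principal {(x, y). dist x y < e})"

definition open_padic :: "'a padic set \<Rightarrow> bool" where
  "open_padic U \<longleftrightarrow> (\<forall>x\<in>U. eventually (\<lambda>(x', y). x' = x \<longrightarrow> y \<in> U) uniformity)"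

instance
proof
  fix x y z :: "'a padic"
  show "dist x y = 0 \<longleftrightarrow> x = y" by (simp add: dist_padic_def)
  have "padic_norm (x - y) \<le> max (padic_norm (x - z)) (padic_norm (y - z))"
    using padic_norm_ultra[of "x - z" "z - y"] padic_norm_minus[of "y - z"] by simp
  thus "dist x y \<le> dist x z + dist y z"
    unfolding dist_padic_def
    using padic_norm_nonneg[of "x - z"] padic_norm_nonneg[of "y - z"] by linarith
qed (auto simp: uniformity_padic_def open_padic_def)

end

section \<open>Analytic functions\<close>

text \<open>\<open>d\<close>-dimensional \<open>p\<close>-adic space: sequences that vanish from index \<open>d\<close> on, with the
  subspace topology of the product topology.\<close>

definition padic_space :: "nat \<Rightarrow> (nat \<Rightarrow> 'p::prime_card padic) set" where
  "padic_space d = {x. \<forall>i\<ge>d. x i = 0}"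

definition multi_indices :: "nat \<Rightarrow> (nat \<Rightarrow> nat) set" where
  "multi_indices d = {\<alpha>. \<forall>i\<ge>d. \<alpha> i = 0}"

definition analytic_scalar ::
  "nat \<Rightarrow> ((nat \<Rightarrow> 'p::prime_card padic) \<Rightarrow> 'p padic) \<Rightarrow> (nat \<Rightarrow> 'p padic) set \<Rightarrow> bool" where
  "analytic_scalar d f U \<longleftrightarrow>
     openin (top_of_set (padic_space d)) U \<and>
     (\<forall>a\<in>U. \<exists>V C. openin (top_of_set (padic_space d)) V \<and> a \<in> V \<and> V \<subseteq> U \<and>
        (\<forall>x\<in>V. ((\<lambda>\<alpha>. C \<alpha> * (\<Prod>i<d. (x i - a i) ^ \<alpha> i)) has_sum f x) (multi_indices d)))"

definition analytic_between ::
  "nat \<Rightarrow> nat \<Rightarrow> ((nat \<Rightarrow> 'p::prime_card padic) \<Rightarrow> nat \<Rightarrow> 'p padic) \<Rightarrow> (nat \<Rightarrow> 'p padic) set \<Rightarrow> bool"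
  where
  "analytic_between d e f U \<longleftrightarrow>
     openin (top_of_set (padic_space d)) U \<and> f ` U \<subseteq> padic_space e \<and>
     (\<forall>j<e. analytic_scalar d (\<lambda>x. f x j) U)"

definition partial_deriv ::
  "nat \<Rightarrow> ((nat \<Rightarrow> 'p::prime_card padic) \<Rightarrow> 'p padic) \<Rightarrow> (nat \<Rightarrow> 'p padic) \<Rightarrow> 'p padic" where
  "partial_deriv i f a = Lim (at 0) (\<lambda>h. (f (a(i := a i + h)) - f a) / h)"

definition total_deriv ::
  "nat \<Rightarrow> ((nat \<Rightarrow> 'p::prime_card padic) \<Rightarrow> nat \<Rightarrow> 'p padic) \<Rightarrow> (nat \<Rightarrow> 'p padic) \<Rightarrow>
    (nat \<Rightarrow> 'p padic) \<Rightarrow> nat \<Rightarrow> 'p padic" where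
  "total_deriv d f a v = (\<lambda>j. \<Sum>i<d. partial_deriv i (\<lambda>x. f x j) a * v i)"


section \<open>Analytic manifolds\<close>

text \<open>As in Schneider's book, the charts of a manifold need not all have the same dimension.\<close>

record ('a, 'p::prime_card) chart =
  cdim :: nat
  cdom :: "'a set"
  cmap :: "'a \<Rightarrow> nat \<Rightarrow> 'p padic"

record ('a, 'p::prime_card) manifold =
  mtop :: "'a topology"
  atlas :: "('a, 'p) chart set"

abbreviation points :: "('a, 'p::prime_card) manifold \<Rightarrow> 'a set" where
  "points M \<equiv> topspace (mtop M)"

definition chart_inv :: "('a, 'p::prime_card) chart \<Rightarrow> (nat \<Rightarrow> 'p padic) \<Rightarrow> 'a" where
  "chart_inv c = inv_into (cdom c) (cmap c)"

definition local_rep ::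
  "('a, 'p::prime_card) chart \<Rightarrow> ('b, 'p) chart \<Rightarrow> ('a \<Rightarrow> 'b) \<Rightarrow> (nat \<Rightarrow> 'p padic) \<Rightarrow> nat \<Rightarrow> 'p padic"
  where "local_rep c c' f = cmap c' \<circ> f \<circ> chart_inv c"

definition is_chart :: "'a topology \<Rightarrow> ('a, 'p::prime_card) chart \<Rightarrow> bool" where
  "is_chart X c \<longleftrightarrow>
     openin X (cdom c) \<and>
     openin (top_of_set (padic_space (cdim c))) (cmap c ` cdom c) \<and>
     homeomorphic_map (subtopology X (cdom c)) (top_of_set (cmap c ` cdom c)) (cmap c)"

text \<open>The atlas is not required to be maximal. Since the transition maps are analytic, the notions
  below do not depend on whether an atlas or the maximal atlas containing it is used.\<close>

definition analytic_manifold :: "('a, 'p::prime_card) manifold \<Rightarrow> bool" where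
  "analytic_manifold M \<longleftrightarrow>
     Hausdorff_space (mtop M) \<and>
     (\<forall>c\<in>atlas M. is_chart (mtop M) c) \<and>
     (\<Union>c\<in>atlas M. cdom c) = points M \<and>
     (\<forall>c\<in>atlas M. \<forall>c'\<in>atlas M.
        analytic_between (cdim c) (cdim c') (local_rep c c' id) (cmap c ` (cdom c \<inter> cdom c')))"

definition has_dim :: "('a, 'p::prime_card) manifold \<Rightarrow> nat \<Rightarrow> bool" where
  "has_dim M d \<longleftrightarrow> (\<forall>c\<in>atlas M. cdim c = d)"

definition analytic_map ::
  "('a, 'p::prime_card) manifold \<Rightarrow> ('b, 'p) manifold \<Rightarrow> ('a \<Rightarrow> 'b) \<Rightarrow> bool" where
  "analytic_map M N f \<longleftrightarrow>
     continuous_map (mtop M) (mtop N) f \<and>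
     (\<forall>c\<in>atlas M. \<forall>c'\<in>atlas N.
        analytic_between (cdim c) (cdim c') (local_rep c c' f) (cmap c ` (cdom c \<inter> f -` cdom c')))"

definition prod_chart ::
  "('a, 'p::prime_card) chart \<Rightarrow> ('b, 'p) chart \<Rightarrow> ('a \<times> 'b, 'p) chart" where
  "prod_chart c c' =
     \<lparr>cdim = cdim c + cdim c', cdom = cdom c \<times> cdom c',
      cmap = (\<lambda>(x, y) i. if i < cdim c then cmap c x i else cmap c' y (i - cdim c))\<rparr>"

definition prod_manifold ::
  "('a, 'p::prime_card) manifold \<Rightarrow> ('b, 'p) manifold \<Rightarrow> ('a \<times> 'b, 'p) manifold" where
  "prod_manifold M N =
     \<lparr>mtop = prod_topology (mtop M) (mtop N),
      atlas = {prod_chart c c' | c c'. c \<in> atlas M \<and> c' \<in> atlas N}\<rparr>"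

definition paracompact_space :: "'a topology \<Rightarrow> bool" where
  "paracompact_space X \<longleftrightarrow>
     (\<forall>\<U>. (\<forall>U\<in>\<U>. openin X U) \<and> \<Union>\<U> = topspace X \<longrightarrow>
        (\<exists>\<V>. (\<forall>V\<in>\<V>. openin X V) \<and> \<Union>\<V> = topspace X \<and>
           (\<forall>V\<in>\<V>. \<exists>U\<in>\<U>. V \<subseteq> U) \<and> locally_finite_in X \<V>))"


section \<open>Tangent vectors and forms\<close>

text \<open>A tangent vector at \<open>m\<close> is the class of all pairs \<open>(c, v)\<close> of a chart \<open>c\<close> at \<open>m\<close> and
  its coordinate vector \<open>v\<close> in that chart, encoded as the function \<open>c \<mapsto> v\<close>. It is zero on
  all other charts, so that the vector space operations are pointwise.\<close>

type_synonym ('a, 'p) tangent = "('a, 'p) chart \<Rightarrow> nat \<Rightarrow> 'p padic"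

definition charts_at :: "('a, 'p::prime_card) manifold \<Rightarrow> 'a \<Rightarrow> ('a, 'p) chart set" where
  "charts_at M m = {c \<in> atlas M. m \<in> cdom c}"

definition tangent_space ::
  "('a, 'p::prime_card) manifold \<Rightarrow> 'a \<Rightarrow> ('a, 'p) tangent set" where
  "tangent_space M m =
     {t. (\<forall>c. c \<notin> charts_at M m \<longrightarrow> t c = (\<lambda>_. 0)) \<and>
         (\<forall>c\<in>charts_at M m. t c \<in> padic_space (cdim c)) \<and>
         (\<forall>c\<in>charts_at M m. \<forall>c'\<in>charts_at M m.
            t c' = total_deriv (cdim c) (local_rep c c' id) (cmap c m) (t c))}"

definition coord_vector ::
  "('a, 'p::prime_card) manifold \<Rightarrow> ('a, 'p) chart \<Rightarrow> nat \<Rightarrow> 'a \<Rightarrow> ('a, 'p) tangent" where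
  "coord_vector M c i m =
     (\<lambda>c'. if c' \<in> charts_at M m
       then total_deriv (cdim c) (local_rep c c' id) (cmap c m) (\<lambda>j. if j = i then 1 else 0)
       else (\<lambda>_. 0))"

text \<open>By the chain rule the push-forward and the differential do not depend on the chart at \<open>m\<close>.\<close>

definition chart_at :: "('a, 'p::prime_card) manifold \<Rightarrow> 'a \<Rightarrow> ('a, 'p) chart" where
  "chart_at M m = (SOME c. c \<in> charts_at M m)"

definition push_forward ::
  "('a, 'p::prime_card) manifold \<Rightarrow> ('b, 'p) manifold \<Rightarrow> ('a \<Rightarrow> 'b) \<Rightarrow> 'a \<Rightarrow>
    ('a, 'p) tangent \<Rightarrow> ('b, 'p) tangent" where
  "push_forward M N f m t =
     (\<lambda>c'. if c' \<in> charts_at N (f m)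
       then (let c = chart_at M m in total_deriv (cdim c) (local_rep c c' f) (cmap c m) (t c))
       else (\<lambda>_. 0))"

definition differential ::
  "('a, 'p::prime_card) manifold \<Rightarrow> ('a \<Rightarrow> 'p padic) \<Rightarrow> 'a \<Rightarrow> ('a, 'p) tangent \<Rightarrow> 'p padic" where
  "differential M f m t =
     (let c = chart_at M m in \<Sum>i<cdim c. partial_deriv i (f \<circ> chart_inv c) (cmap c m) * t c i)"

type_synonym ('a, 'p) two_form = "'a \<Rightarrow> ('a, 'p) tangent \<Rightarrow> ('a, 'p) tangent \<Rightarrow> 'p padic"

definition is_two_form :: "('a, 'p::prime_card) manifold \<Rightarrow> ('a, 'p) two_form \<Rightarrow> bool" where
  "is_two_form M \<omega> \<longleftrightarrow>
     (\<forall>m\<in>points M. \<forall>u\<in>tangent_space M m. \<forall>v\<in>tangent_space M m. \<forall>w\<in>tangent_space M m. \<forall>a b.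
        \<omega> m (\<lambda>c i. a * u c i + b * v c i) w = a * \<omega> m u w + b * \<omega> m v w \<and>
        \<omega> m w (\<lambda>c i. a * u c i + b * v c i) = a * \<omega> m w u + b * \<omega> m w v \<and>
        \<omega> m u u = 0)"

definition form_coeff ::
  "('a, 'p::prime_card) manifold \<Rightarrow> ('a, 'p) two_form \<Rightarrow> ('a, 'p) chart \<Rightarrow> nat \<Rightarrow> nat \<Rightarrow>
    (nat \<Rightarrow> 'p padic) \<Rightarrow> 'p padic" where
  "form_coeff M \<omega> c i j x =
     (let m = chart_inv c x in \<omega> m (coord_vector M c i m) (coord_vector M c j m))"

definition analytic_two_form :: "('a, 'p::prime_card) manifold \<Rightarrow> ('a, 'p) two_form \<Rightarrow> bool" where
  "analytic_two_form M \<omega> \<longleftrightarrow>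
     is_two_form M \<omega> \<and>
     (\<forall>c\<in>atlas M. \<forall>i<cdim c. \<forall>j<cdim c.
        analytic_scalar (cdim c) (form_coeff M \<omega> c i j) (cmap c ` cdom c))"

text \<open>The value of \<open>d\<omega>\<close> on the \<open>i\<close>-th, \<open>j\<close>-th and \<open>k\<close>-th coordinate vector fields of \<open>c\<close>.\<close>

definition ext_deriv_coeff ::
  "('a, 'p::prime_card) manifold \<Rightarrow> ('a, 'p) two_form \<Rightarrow> ('a, 'p) chart \<Rightarrow> nat \<Rightarrow> nat \<Rightarrow> nat \<Rightarrow>
    (nat \<Rightarrow> 'p padic) \<Rightarrow> 'p padic" where
  "ext_deriv_coeff M \<omega> c i j k x =
     partial_deriv i (form_coeff M \<omega> c j k) x
     - partial_deriv j (form_coeff M \<omega> c i k) x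
     + partial_deriv k (form_coeff M \<omega> c i j) x"

definition closed_two_form :: "('a, 'p::prime_card) manifold \<Rightarrow> ('a, 'p) two_form \<Rightarrow> bool" where
  "closed_two_form M \<omega> \<longleftrightarrow>
     (\<forall>c\<in>atlas M. \<forall>i<cdim c. \<forall>j<cdim c. \<forall>k<cdim c. \<forall>x\<in>cmap c ` cdom c.
        ext_deriv_coeff M \<omega> c i j k x = 0)"

definition nondegenerate :: "('a, 'p::prime_card) manifold \<Rightarrow> ('a, 'p) two_form \<Rightarrow> bool" where
  "nondegenerate M \<omega> \<longleftrightarrow>
     (\<forall>m\<in>points M. \<forall>u\<in>tangent_space M m. (\<forall>v\<in>tangent_space M m. \<omega> m u v = 0) \<longrightarrow> u = (\<lambda>_ _. 0))"

definition symplectic_manifold ::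
  "nat \<Rightarrow> ('a, 'p::prime_card) manifold \<Rightarrow> ('a, 'p) two_form \<Rightarrow> bool" where
  "symplectic_manifold n M \<omega> \<longleftrightarrow>
     analytic_manifold M \<and> has_dim M (2 * n) \<and>
     analytic_two_form M \<omega> \<and> closed_two_form M \<omega> \<and> nondegenerate M \<omega>"


section \<open>Lie groups and their actions\<close>

definition lie_group ::
  "('g, 'r) monoid_scheme \<Rightarrow> ('g, 'p::prime_card) manifold \<Rightarrow> bool" where
  "lie_group G \<G> \<longleftrightarrow>
     group G \<and> analytic_manifold \<G> \<and> points \<G> = carrier G \<and>
     analytic_map (prod_manifold \<G> \<G>) \<G> (\<lambda>(g, h). g \<otimes>\<^bsub>G\<^esub> h) \<and>
     analytic_map \<G> \<G> (\<lambda>g. inv\<^bsub>G\<^esub> g)"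

definition lie_algebra ::
  "('g, 'r) monoid_scheme \<Rightarrow> ('g, 'p::prime_card) manifold \<Rightarrow> ('g, 'p) tangent set" where
  "lie_algebra G \<G> = tangent_space \<G> \<one>\<^bsub>G\<^esub>"

definition lie_group_action ::
  "('g, 'r) monoid_scheme \<Rightarrow> ('g, 'p::prime_card) manifold \<Rightarrow> ('a, 'p) manifold \<Rightarrow>
    ('g \<Rightarrow> 'a \<Rightarrow> 'a) \<Rightarrow> bool" where
  "lie_group_action G \<G> M \<psi> \<longleftrightarrow>
     group_action G (points M) \<psi> \<and> analytic_map (prod_manifold \<G> M) M (\<lambda>(g, m). \<psi> g m)"

definition pull_back ::
  "('a, 'p::prime_card) manifold \<Rightarrow> ('b, 'p) manifold \<Rightarrow> ('a \<Rightarrow> 'b) \<Rightarrow> ('b, 'p) two_form \<Rightarrow>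
    ('a, 'p) two_form" where
  "pull_back M N f \<omega> = (\<lambda>m u v. \<omega> (f m) (push_forward M N f m u) (push_forward M N f m v))"

definition symplectic_action ::
  "('g, 'r) monoid_scheme \<Rightarrow> ('g, 'p::prime_card) manifold \<Rightarrow> ('a, 'p) manifold \<Rightarrow> ('a, 'p) two_form \<Rightarrow>
    ('g \<Rightarrow> 'a \<Rightarrow> 'a) \<Rightarrow> bool" where
  "symplectic_action G \<G> M \<omega> \<psi> \<longleftrightarrow>
     lie_group_action G \<G> M \<psi> \<and>
     (\<forall>g\<in>carrier G. \<forall>m\<in>points M. \<forall>u\<in>tangent_space M m. \<forall>v\<in>tangent_space M m.
        pull_back M M (\<psi> g) \<omega> m u v = \<omega> m u v)"

definition generated_field ::
  "('g, 'r) monoid_scheme \<Rightarrow> ('g, 'p::prime_card) manifold \<Rightarrow> ('a, 'p) manifold \<Rightarrow>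
    ('g \<Rightarrow> 'a \<Rightarrow> 'a) \<Rightarrow> ('g, 'p) tangent \<Rightarrow> 'a \<Rightarrow> ('a, 'p) tangent" where
  "generated_field G \<G> M \<psi> \<xi> m = push_forward \<G> M (\<lambda>g. \<psi> g m) \<one>\<^bsub>G\<^esub> \<xi>"


section \<open>Momentum maps\<close>

text \<open>Linear functionals on a space \<open>V\<close> of tangent vectors, extended by zero outside \<open>V\<close>.\<close>

definition dual_space ::
  "('g, 'p::prime_card) tangent set \<Rightarrow> (('g, 'p) tangent \<Rightarrow> 'p padic) set" where
  "dual_space V =
     {l. (\<forall>v. v \<notin> V \<longrightarrow> l v = 0) \<and>
         (\<forall>u\<in>V. \<forall>v\<in>V. \<forall>a b. l (\<lambda>c i. a * u c i + b * v c i) = a * l u + b * l v)}"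

text \<open>A finite-dimensional space \<open>W\<close> of functions is a manifold whose charts are the linear
  isomorphisms from \<open>W\<close> onto the coordinate space.\<close>

definition linear_charts :: "('x \<Rightarrow> 'p::prime_card padic) set \<Rightarrow> ('x \<Rightarrow> 'p padic, 'p) chart set" where
  "linear_charts W =
     {c. cdom c = W \<and> bij_betw (cmap c) W (padic_space (cdim c)) \<and>
         (\<forall>k\<in>W. \<forall>l\<in>W. \<forall>a b.
            cmap c (\<lambda>x. a * k x + b * l x) = (\<lambda>i. a * cmap c k i + b * cmap c l i))}"

definition vector_space_manifold ::
  "('x \<Rightarrow> 'p::prime_card padic) set \<Rightarrow> ('x \<Rightarrow> 'p padic, 'p) manifold" where
  "vector_space_manifold W =
     \<lparr>mtop = topology_generated_by
        {W \<inter> cmap c -` U | c U. c \<in> linear_charts W \<and> openin (top_of_set (padic_space (cdim c))) U},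
      atlas = linear_charts W\<rparr>"

definition momentum_map ::
  "('g, 'r) monoid_scheme \<Rightarrow> ('g, 'p::prime_card) manifold \<Rightarrow> ('a, 'p) manifold \<Rightarrow> ('a, 'p) two_form \<Rightarrow>
    ('g \<Rightarrow> 'a \<Rightarrow> 'a) \<Rightarrow> ('a \<Rightarrow> ('g, 'p) tangent \<Rightarrow> 'p padic) \<Rightarrow> bool" where
  "momentum_map G \<G> M \<omega> \<psi> \<mu> \<longleftrightarrow>
     analytic_map M (vector_space_manifold (dual_space (lie_algebra G \<G>))) \<mu> \<and>
     (\<forall>\<xi>\<in>lie_algebra G \<G>. \<forall>m\<in>points M. \<forall>v\<in>tangent_space M m.
        \<omega> m (generated_field G \<G> M \<psi> \<xi> m) v = differential M (\<lambda>m. \<mu> m \<xi>) m v)"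

definition weakly_hamiltonian ::
  "('g, 'r) monoid_scheme \<Rightarrow> ('g, 'p::prime_card) manifold \<Rightarrow> ('a, 'p) manifold \<Rightarrow> ('a, 'p) two_form \<Rightarrow>
    ('g \<Rightarrow> 'a \<Rightarrow> 'a) \<Rightarrow> bool" where
  "weakly_hamiltonian G \<G> M \<omega> \<psi> \<longleftrightarrow> (\<exists>\<mu>. momentum_map G \<G> M \<omega> \<psi> \<mu>)"

end

theory Submission
  imports Defs
begin

text \<open>
  Write the action in a chart of the group at the identity and a chart of \<open>M\<close>. Differentiating the
  invariance of \<open>\<omega>\<close> in a coordinate direction of the group shows that the Lie derivative of \<open>\<omega>\<close> along the
  corresponding generated field \<open>X\<close> vanishes; as \<open>\<omega>\<close> is closed, the analytic one-form \<open>\<omega>(X, \<cdot>)\<close> is closed.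
  A closed one-form given by convergent power series has a primitive on a smaller polydisc, obtained by
  integrating term by term. Since \<open>M\<close> is paracompact and has a basis of compact open sets, the local
  primitives can be chosen in a locally constant way, so they glue without any obstruction. The primitives
  for a basis of the Lie algebra are the components of a momentum map.
\<close>

section \<open>The topological field of p-adic numbers\<close>

text \<open>Two features of the ground field shape the proof. A function with zero derivative need
  not be locally constant, so identities between analytic functions are proved by comparing
  coefficients, and bounds are kept for expansions instead of values. The ultrametric inequality
  pays for this: Gauss norm bounds survive a change of centre and a composition without loss, and a
  family is summable as soon as it is null.

  Secondly, \<open>partial_deriv\<close> is a bare limit of difference quotients. Sums, products and
  compositions are therefore differentiated through a Frechet estimate, from which the value of the
  limit is read off; the chain rule with one map equal to \<open>id\<close> then covers all changes
  of chart, including those hidden in \<open>chart_at\<close>.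

  Gluing asks for no agreement on overlaps, because analyticity at \<open>m\<close> and the momentum
  equation at \<open>m\<close> depend only on the germ there. Near \<open>m\<close> a locally
  constant choice coincides with one fixed local primitive. All directions of the Lie algebra are
  treated over a common neighbourhood, so that one choice serves a whole basis.\<close>

declare padic_norm_nonneg [simp]

lemma padic_norm_0 [simp]: "padic_norm (0 :: 'p::prime_card padic) = 0"
  by simp

lemma padic_norm_1 [simp]: "padic_norm (1 :: 'p::prime_card padic) = 1"
  using padic_norm_mult[of "1 :: 'p padic" 1] padic_norm_eq_0[of "1 :: 'p padic"] by simp

lemma padic_norm_pos_iff [simp]: "padic_norm x > 0 \<longleftrightarrow> (x :: 'p::prime_card padic) \<noteq> 0"
  using padic_norm_nonneg[of x] padic_norm_eq_0[of x] by linarith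

lemma padic_norm_inverse: "padic_norm (inverse x) = inverse (padic_norm (x :: 'p::prime_card padic))"
proof (cases "x = 0")
  case False
  then have "padic_norm x * padic_norm (inverse x) = 1"
    by (simp flip: padic_norm_mult)
  then show ?thesis by (metis inverse_unique)
qed simp

lemma padic_norm_divide: "padic_norm (x / y) = padic_norm x / padic_norm (y :: 'p::prime_card padic)"
  by (simp add: divide_inverse padic_norm_mult padic_norm_inverse)

lemma padic_norm_power: "padic_norm (x ^ n) = padic_norm (x :: 'p::prime_card padic) ^ n"
  by (induction n) (auto simp: padic_norm_mult)

lemma padic_norm_prod: "padic_norm (\<Prod>i\<in>A. f i) = (\<Prod>i\<in>A. padic_norm (f i :: 'p::prime_card padic))"
  by (induction A rule: infinite_finite_induct) (auto simp: padic_norm_mult)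

lemma padic_norm_add_le:
  "padic_norm x \<le> B \<Longrightarrow> padic_norm y \<le> B \<Longrightarrow> padic_norm (x + y :: 'p::prime_card padic) \<le> B"
  using padic_norm_ultra[of x y] by linarith

lemma padic_norm_diff_le:
  "padic_norm x \<le> B \<Longrightarrow> padic_norm y \<le> B \<Longrightarrow> padic_norm (x - y :: 'p::prime_card padic) \<le> B"
  using padic_norm_add_le[of x B "- y"] by simp

lemma padic_norm_minus_commute: "padic_norm (x - y :: 'p::prime_card padic) = padic_norm (y - x)"
  by (metis minus_diff_eq padic_norm_minus)

lemma padic_norm_sum_le:
  assumes "\<And>i. i \<in> A \<Longrightarrow> padic_norm (f i :: 'p::prime_card padic) \<le> B" "0 \<le> B"
  shows "padic_norm (\<Sum>i\<in>A. f i) \<le> B"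
  using assms by (induction A rule: infinite_finite_induct) (auto intro: padic_norm_add_le)

lemma padic_norm_of_nat_le: "padic_norm (of_nat n :: 'p::prime_card padic) \<le> 1"
  by (induction n) (auto intro: padic_norm_add_le)

text \<open>Adding, negating and splitting unconditional sums requires a topological group. By the
  ultrametric inequality the same \<open>e\<close> serves for both summands.\<close>

instance padic :: (prime_card) topological_ab_group_add
proof
  fix a b :: "'a padic"
  show "((\<lambda>x. fst x + snd x) \<longlongrightarrow> a + b) (nhds a \<times>\<^sub>F nhds b)"
    unfolding tendsto_iff eventually_prod_filter dist_padic_def
  proof (intro allI impI)
    fix e :: real assume e: "e > 0"
    show "\<exists>P Q. eventually P (nhds a) \<and> eventually Q (nhds b) \<and>
        (\<forall>x y. P x \<longrightarrow> Q y \<longrightarrow> padic_norm (fst (x, y) + snd (x, y) - (a + b)) < e)"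
    proof (intro exI conjI allI impI)
      show "eventually (\<lambda>x. padic_norm (x - a) < e) (nhds a)"
        using e by (auto simp: eventually_nhds_metric dist_padic_def)
      show "eventually (\<lambda>x. padic_norm (x - b) < e) (nhds b)"
        using e by (auto simp: eventually_nhds_metric dist_padic_def)
      fix x y assume "padic_norm (x - a) < e" "padic_norm (y - b) < e"
      then show "padic_norm (fst (x, y) + snd (x, y) - (a + b)) < e"
        using padic_norm_ultra[of "x - a" "y - b"] by (simp add: algebra_simps)
    qed
  qed
next
  fix a :: "'a padic"
  show "(uminus \<longlongrightarrow> - a) (nhds a)"
    unfolding tendsto_iff by (auto simp: eventually_nhds_metric dist_padic_def padic_norm_minus_commute)
qed

text \<open>This is what allows a constant factor to be moved into an unconditional sum.\<close>

instance padic :: (prime_card) topological_semigroup_mult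
proof
  fix a b :: "'a padic"
  show "((\<lambda>x. fst x * snd x) \<longlongrightarrow> a * b) (nhds a \<times>\<^sub>F nhds b)"
    unfolding tendsto_iff eventually_prod_filter dist_padic_def
  proof (intro allI impI)
    fix e :: real assume e: "e > 0"
    define K where "K = max 1 (max (padic_norm a) (padic_norm b))"
    have K: "K \<ge> 1" "padic_norm a \<le> K" "padic_norm b \<le> K" by (auto simp: K_def)
    \<comment> \<open>The difference \<open>x * y - a * b\<close> is split as
      \<open>(x - a) * y + a * (y - b)\<close>. The bound 1 in \<open>u\<close> keeps
      \<open>y\<close> in the ball of radius \<open>K\<close>; the bound \<open>e / K\<close> then
      makes both summands smaller than \<open>e\<close>.\<close>
    define u where "u = min 1 (e / K)"
    have u: "u > 0" "u \<le> 1" "u * K \<le> e" using e K by (auto simp: u_def min_def field_simps)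
    show "\<exists>P Q. eventually P (nhds a) \<and> eventually Q (nhds b) \<and>
        (\<forall>x y. P x \<longrightarrow> Q y \<longrightarrow> padic_norm (fst (x, y) * snd (x, y) - (a * b)) < e)"
    proof (intro exI conjI allI impI)
      show "eventually (\<lambda>x. padic_norm (x - a) < u) (nhds a)"
        using u by (auto simp: eventually_nhds_metric dist_padic_def)
      show "eventually (\<lambda>x. padic_norm (x - b) < u) (nhds b)"
        using u by (auto simp: eventually_nhds_metric dist_padic_def)
      fix x y assume xy: "padic_norm (x - a) < u" "padic_norm (y - b) < u"
      have "padic_norm ((y - b) + b) \<le> K"
        using xy u K by (intro padic_norm_add_le) linarith+
      then have y: "padic_norm y \<le> K" by simp
      have "padic_norm (x - a) * padic_norm y \<le> padic_norm (x - a) * K"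
        using y by (intro mult_left_mono padic_norm_nonneg)
      also have "\<dots> < u * K"
        using xy K by (intro mult_strict_right_mono) auto
      finally have "padic_norm ((x - a) * y) < u * K"
        by (simp add: padic_norm_mult)
      moreover have "padic_norm (a * (y - b)) < K * u"
      proof -
        have "padic_norm a * padic_norm (y - b) \<le> K * padic_norm (y - b)"
          using K by (intro mult_right_mono padic_norm_nonneg)
        also have "\<dots> < K * u"
          using xy K by (intro mult_strict_left_mono) auto
        finally show ?thesis by (simp add: padic_norm_mult)
      qed
      ultimately have "padic_norm ((x - a) * y + a * (y - b)) < e"
        using padic_norm_ultra[of "(x - a) * y" "a * (y - b)"] u by (simp add: mult.commute)
      then show "padic_norm (fst (x, y) * snd (x, y) - (a * b)) < e"
        by (simp add: algebra_simps)
    qed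
  qed
qed

section \<open>The rationals inside the completion, and completeness\<close>

lift_definition padic_seq_of_rat :: "rat \<Rightarrow> 'p::prime_card padic_seq" is "\<lambda>q _. q" by simp

lift_definition padic_of_rat :: "rat \<Rightarrow> 'p::prime_card padic" is padic_seq_of_rat .

lemma padic_of_rat_add: "padic_of_rat (a + b) = (padic_of_rat a + padic_of_rat b :: 'p::prime_card padic)"
proof transfer
  fix a b :: rat
  have "padic_seq_of_rat (a + b) = (padic_seq_of_rat a + padic_seq_of_rat b :: 'p padic_seq)"
    by transfer simp
  then show "null_seq (padic_seq_of_rat (a + b) - (padic_seq_of_rat a + padic_seq_of_rat b) :: 'p padic_seq)"
    by simp
qed

lemma padic_of_rat_minus: "padic_of_rat (- b) = (- padic_of_rat b :: 'p::prime_card padic)"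
proof transfer
  fix b :: rat
  have "padic_seq_of_rat (- b) = (- padic_seq_of_rat b :: 'p padic_seq)"
    by transfer simp
  then show "null_seq (padic_seq_of_rat (- b) - (- padic_seq_of_rat b) :: 'p padic_seq)"
    by simp
qed

lemma padic_of_rat_diff: "padic_of_rat (a - b) = (padic_of_rat a - padic_of_rat b :: 'p::prime_card padic)"
  using padic_of_rat_add[of a "- b"] by (simp add: padic_of_rat_minus)

lemma padic_of_rat_0 [simp]: "padic_of_rat 0 = (0 :: 'p::prime_card padic)"
  using padic_of_rat_diff[of 0 0] by simp

lemma padic_of_rat_1 [simp]: "padic_of_rat 1 = (1 :: 'p::prime_card padic)"
proof transfer
  have "padic_seq_of_rat 1 = (1 :: 'p padic_seq)"
    by transfer simp
  then show "null_seq (padic_seq_of_rat 1 - 1 :: 'p padic_seq)"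
    by simp
qed

lemma padic_of_rat_of_nat [simp]: "padic_of_rat (of_nat n) = (of_nat n :: 'p::prime_card padic)"
  by (induction n) (auto simp: padic_of_rat_add)

lemma padic_norm_of_rat: "padic_norm (padic_of_rat q :: 'p::prime_card padic) = padic_abs CARD('p) q"
  by (transfer, transfer) simp

text \<open>A Cauchy sequence of rationals that represents \<open>x\<close> stays within
  \<open>e / 2\<close> of one of its own late terms, and this term is the approximation.\<close>

lemma padic_of_rat_dense:
  assumes "e > 0"
  shows "\<exists>q. padic_norm (x - padic_of_rat q :: 'p::prime_card padic) < e"
  using assms
proof (transfer, transfer)
  fix e :: real and X assume e: "e > 0" and X: "padic_Cauchy CARD('p) X"
  obtain k where k: "\<forall>m\<ge>k. \<forall>n\<ge>k. padic_abs CARD('p) (X m - X n) < e / 2"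
    using padic_CauchyD[OF X, of "e / 2"] e by auto
  have "lim (\<lambda>n. padic_abs CARD('p) (X n - X k)) \<le> e / 2"
  proof (rule LIMSEQ_le_const2)
    show "(\<lambda>n. padic_abs CARD('p) (X n - X k)) \<longlonglongrightarrow> lim (\<lambda>n. padic_abs CARD('p) (X n - X k))"
      using padic_abs_LIMSEQ_lim[where 'p='p, of "\<lambda>n. X n + - X k"]
        padic_Cauchy_add[OF prime_card X, of "\<lambda>n. - X k"] by simp
    show "\<exists>N. \<forall>n\<ge>N. padic_abs CARD('p) (X n - X k) \<le> e / 2" using k by (meson less_imp_le order_refl)
  qed
  then show "\<exists>q. lim (\<lambda>n. padic_abs CARD('p) (X n - q)) < e" using e by (intro exI[of _ "X k"]) linarith
qed

text \<open>The limit is the class of \<open>X\<close> itself: the norm of its difference from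
  \<open>X n\<close> is the limit in \<open>m\<close> of the absolute values of
  \<open>X n - X m\<close>.\<close>

lemma padic_Cauchy_rat_limit:
  assumes "padic_Cauchy CARD('p::prime_card) X"
  shows "\<exists>x :: 'p padic. \<forall>e>0. \<exists>k. \<forall>n\<ge>k. padic_norm (padic_of_rat (X n) - x) \<le> e"
proof -
  define S :: "'p padic_seq" where "S = Abs_padic_seq X"
  have R: "Rep_padic_seq S = X" using assms by (simp add: S_def Abs_padic_seq_inverse)
  show ?thesis
  proof (intro exI[of _ "abs_padic S"] allI impI)
    fix e :: real assume "e > 0"
    then obtain k where k: "\<forall>m\<ge>k. \<forall>n\<ge>k. padic_abs CARD('p) (X m - X n) < e"
      using padic_CauchyD[OF assms] by blast
    have "padic_norm (padic_of_rat (X n) - abs_padic S) \<le> e" if n: "n \<ge> k" for n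
    proof -
      have "padic_norm (padic_of_rat (X n) - abs_padic S) = lim (\<lambda>m. padic_abs CARD('p) (X n - X m))"
        by (simp add: padic_of_rat.abs_eq minus_padic.abs_eq padic_norm.abs_eq lim_abs_seq.rep_eq
            minus_padic_seq.rep_eq padic_seq_of_rat.rep_eq R)
      also have "\<dots> \<le> e"
      proof (rule LIMSEQ_le_const2)
        show "(\<lambda>m. padic_abs CARD('p) (X n - X m)) \<longlonglongrightarrow> lim (\<lambda>m. padic_abs CARD('p) (X n - X m))"
          using padic_abs_LIMSEQ_lim[where 'p='p, of "\<lambda>m. X n + - X m"]
            padic_Cauchy_add[OF prime_card _ padic_Cauchy_minus[OF prime_card assms], of "\<lambda>m. X n"] by simp
        show "\<exists>N. \<forall>m\<ge>N. padic_abs CARD('p) (X n - X m) \<le> e" using k n by (meson less_imp_le order_refl)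
      qed
      finally show ?thesis .
    qed
    then show "\<exists>k. \<forall>n\<ge>k. padic_norm (padic_of_rat (X n) - abs_padic S) \<le> e" by blast
  qed
qed

text \<open>Replacing the \<open>n\<close>-th term by a rational closer than
  \<open>1 / (n + 1)\<close> leaves a Cauchy sequence of rationals, which has a limit by the
  construction of the field. Completeness is what later makes null families summable.\<close>

instance padic :: (prime_card) complete_space
proof
  fix X :: "nat \<Rightarrow> 'a padic" assume "Cauchy X"
  then have C: "\<exists>M. \<forall>m\<ge>M. \<forall>n\<ge>M. padic_norm (X m - X n) < e" if "e > 0" for e
    using that by (auto simp: Cauchy_def dist_padic_def)
  have "\<exists>q. padic_norm (X n - padic_of_rat q) < inverse (real (Suc n))" for n
    by (intro padic_of_rat_dense) simp
  then obtain q where q: "padic_norm (X n - padic_of_rat (q n)) < inverse (real (Suc n))" for n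
    by metis
  have q': "\<exists>k. \<forall>n\<ge>k. padic_norm (X n - padic_of_rat (q n)) < e" if e: "e > 0" for e
  proof -
    obtain k where "inverse (real (Suc k)) < e" using reals_Archimedean[OF e] by blast
    moreover have "inverse (real (Suc n)) \<le> inverse (real (Suc k))" if "n \<ge> k" for n
      using that by (intro le_imp_inverse_le) auto
    ultimately show ?thesis using q by (meson less_trans le_less_trans)
  qed
  have "padic_Cauchy CARD('a) q"
    unfolding padic_Cauchy_def
  proof (intro allI impI)
    fix e :: real assume e: "e > 0"
    obtain M where M: "\<forall>m\<ge>M. \<forall>n\<ge>M. padic_norm (X m - X n) < e" using C[OF e] by blast
    obtain k where k: "\<forall>n\<ge>k. padic_norm (X n - padic_of_rat (q n)) < e" using q'[OF e] by blast
    have "padic_abs CARD('a) (q m - q n) < e" if mn: "m \<ge> max M k" "n \<ge> max M k" for m n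
    proof -
      have "padic_norm (X n - padic_of_rat (q n)) < e" "padic_norm (padic_of_rat (q m) - X m) < e" "padic_norm (X m - X n) < e"
        using M k mn by (auto simp: padic_norm_minus_commute)
      then have "padic_norm ((padic_of_rat (q m) - X m) + ((X m - X n) + (X n - padic_of_rat (q n)))) < e"
        using padic_norm_ultra[of "padic_of_rat (q m) - X m" "(X m - X n) + (X n - padic_of_rat (q n))"]
           padic_norm_ultra[of "X m - X n" "X n - padic_of_rat (q n)"] by linarith
      then show ?thesis by (simp add: padic_of_rat_diff flip: padic_norm_of_rat)
    qed
    then show "\<exists>k. \<forall>m\<ge>k. \<forall>n\<ge>k. padic_abs CARD('a) (q m - q n) < e" by blast
  qed
  then obtain x :: "'a padic" where x: "\<forall>e>0. \<exists>k. \<forall>n\<ge>k. padic_norm (padic_of_rat (q n) - x) \<le> e"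
    using padic_Cauchy_rat_limit by blast
  have "X \<longlonglongrightarrow> x"
    unfolding lim_sequentially dist_padic_def
  proof (intro allI impI)
    fix e :: real assume e: "e > 0"
    obtain k where k: "\<forall>n\<ge>k. padic_norm (padic_of_rat (q n) - x) \<le> e / 2" using x e by (meson half_gt_zero)
    obtain l where l: "\<forall>n\<ge>l. padic_norm (X n - padic_of_rat (q n)) < e" using q'[OF e] by blast
    have "padic_norm (X n - x) < e" if n: "n \<ge> max k l" for n
    proof -
      have "padic_norm (X n - padic_of_rat (q n)) < e" "padic_norm (padic_of_rat (q n) - x) \<le> e / 2"
        using k l n by auto
      then show ?thesis
        using padic_norm_ultra[of "X n - padic_of_rat (q n)" "padic_of_rat (q n) - x"] e by simp
    qed
    then show "\<exists>N. \<forall>n\<ge>N. padic_norm (X n - x) < e" by blast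
  qed
  then show "convergent X" by (auto simp: convergent_def)
qed

section \<open>Norms of natural numbers and characteristic zero\<close>

text \<open>The power of \<open>p\<close> that divides \<open>n\<close> is at most \<open>n\<close>.
  This crude bound suffices both for characteristic zero and for the denominators that integration
  introduces.\<close>

lemma padic_abs_of_nat_bound:
  assumes p: "prime p" and n: "n > 0"
  shows "padic_abs p (of_nat n) \<ge> 1 / real n"
proof -
  have "int n \<noteq> 0" using n by simp
  then have "padic_abs p (of_nat n) = real p powi (- int (multiplicity (int p) (int n)))"
    using padic_abs_eq[OF p, of "int n" 1] by simp
  also have "\<dots> = 1 / real p ^ multiplicity (int p) (int n)"
    by (simp add: power_int_minus divide_inverse)
  also have "\<dots> \<ge> 1 / real n"
  proof -
    have "int p ^ multiplicity (int p) (int n) \<le> int n"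
      using n by (intro zdvd_imp_le multiplicity_dvd) auto
    then have "real p ^ multiplicity (int p) (int n) \<le> real n"
      by (metis of_int_le_iff of_int_of_nat_eq of_int_power)
    then show ?thesis
      using p n by (intro divide_left_mono mult_pos_pos) (auto simp: prime_gt_0_nat)
  qed
  finally show ?thesis .
qed

lemma padic_norm_of_nat_bound:
  "n > 0 \<Longrightarrow> padic_norm (of_nat n :: 'p::prime_card padic) \<ge> 1 / real n"
  using padic_abs_of_nat_bound[OF prime_card[where 'a='p], of n]
  by (simp flip: padic_of_rat_of_nat add: padic_norm_of_rat)

text \<open>Positive integers have to be cancelled twice below: when coefficients are recovered from
  derivatives, and when a primitive divides by the degree.\<close>

instance padic :: (prime_card) field_char_0
proof
  show "inj (of_nat :: nat \<Rightarrow> 'a padic)"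
  proof (rule linorder_injI)
    fix m n :: nat assume "m < n"
    then have "1 / real (n - m) > 0" by simp
    then have "padic_norm (of_nat (n - m) :: 'a padic) > 0"
      using padic_norm_of_nat_bound[where 'p='a, of "n - m"] \<open>m < n\<close> by linarith
    then show "of_nat m \<noteq> (of_nat n :: 'a padic)" using \<open>m < n\<close> by (auto simp: of_nat_diff)
  qed
qed

lemma padic_norm_p: "padic_norm (of_nat CARD('p) :: 'p::prime_card padic) = 1 / real CARD('p)"
proof -
  have p: "prime CARD('p)" by (rule prime_card)
  have "padic_abs CARD('p) (of_nat CARD('p)) = real CARD('p) powi (- 1)"
    using padic_abs_eq[OF p, of "int CARD('p)" 1] p
    by simp
  then show ?thesis by (simp flip: padic_of_rat_of_nat add: padic_norm_of_rat power_int_minus divide_inverse)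
qed

lemma padic_small_elem:
  assumes "e > 0"
  shows "\<exists>k. padic_norm ((of_nat CARD('p) :: 'p::prime_card padic) ^ k) < e \<and> (of_nat CARD('p) :: 'p padic) ^ k \<noteq> 0"
proof -
  have p: "CARD('p) > 1" using prime_card[where 'a='p] prime_gt_1_nat by blast
  then have "1 / real CARD('p) < 1" by simp
  then obtain k where "(1 / real CARD('p)) ^ k < e" using real_arch_pow_inv[OF assms] by blast
  then show ?thesis using p by (intro exI[of _ k]) (simp add: padic_norm_power padic_norm_p)
qed

text \<open>\<open>partial_deriv\<close> is a \<open>Lim\<close> along \<open>at 0\<close>, and such
  a limit is unique only if the filter is nontrivial. Powers of \<open>p\<close> are nonzero
  elements arbitrarily close to 0.\<close>

lemma at_0_padic_neq_bot: "at (0 :: 'p::prime_card padic) \<noteq> bot"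
proof -
  have "\<exists>x. x \<noteq> 0 \<and> dist x (0 :: 'p padic) < e" if e: "e > 0" for e
  proof -
    obtain k where k: "padic_norm ((of_nat CARD('p) :: 'p padic) ^ k) < e" "(of_nat CARD('p) :: 'p padic) ^ k \<noteq> 0"
      using padic_small_elem[where 'p='p, OF e] by blast
    show ?thesis
      by (rule exI[of _ "of_nat CARD('p) ^ k"]) (use k in \<open>unfold dist_padic_def diff_0_right, blast\<close>)
  qed
  then show ?thesis
    by (simp add: trivial_limit_within islimpt_approachable)
qed

section \<open>Null families and unconditional sums\<close>

text \<open>Convergence to zero along the complements of finite sets, meant for nonnegative
  \<open>f\<close>. For norms of p-adic families it is equivalent to summability, by
  \<open>padic_summable_null_on\<close> and \<open>padic_null_on_summable\<close>.\<close>

definition null_on :: "('i \<Rightarrow> real) \<Rightarrow> 'i set \<Rightarrow> bool" where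
  "null_on f A \<longleftrightarrow> (\<forall>e>0. finite {i\<in>A. f i > e})"

lemma null_on_mono:
  assumes "null_on g A" "\<And>i. i \<in> A \<Longrightarrow> f i \<le> g i"
  shows "null_on f A"
  unfolding null_on_def
proof (intro allI impI)
  fix e :: real assume "e > 0"
  then have "finite {i\<in>A. g i > e}" using assms(1) by (simp add: null_on_def)
  moreover have "{i\<in>A. f i > e} \<subseteq> {i\<in>A. g i > e}" using assms(2) by force
  ultimately show "finite {i\<in>A. f i > e}" by (rule finite_subset[rotated])
qed

lemma null_on_finite: "finite A \<Longrightarrow> null_on f A"
  by (simp add: null_on_def)

lemma null_on_cmult:
  assumes "null_on f A" "c \<ge> 0" shows "null_on (\<lambda>i. c * f i) A"
proof (cases "c = 0")
  case True
  have "{i \<in> A. e < 0} = {}" if "e > 0" for e :: real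
    using that by auto
  then show ?thesis unfolding null_on_def True by simp
next
  case False
  then have c: "c > 0" using assms by simp
  show ?thesis unfolding null_on_def
  proof (intro allI impI)
    fix e :: real assume "e > 0"
    then have "finite {i\<in>A. f i > e / c}" using assms(1) c by (simp add: null_on_def)
    then show "finite {i\<in>A. c * f i > e}" using c by (simp add: pos_divide_less_eq mult.commute)
  qed
qed

lemma null_on_bounded:
  assumes "null_on f A" shows "\<exists>B>0. \<forall>i\<in>A. f i \<le> B"
proof -
  have fin: "finite {i\<in>A. f i > 1}" using assms by (simp add: null_on_def)
  define B where "B = Max (insert 1 (f ` {i\<in>A. f i > 1}))"
  have "B \<ge> 1" unfolding B_def using fin by (intro Max_ge) auto
  moreover have "f i \<le> B" if "i \<in> A" for i
  proof (cases "f i > 1")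
    case True
    then show ?thesis unfolding B_def using that fin by (intro Max_ge) auto
  qed (use \<open>B \<ge> 1\<close> in auto)
  ultimately show ?thesis by (intro exI[of _ B]) auto
qed

lemma null_on_inj:
  assumes "null_on f B" "inj_on h A" "h ` A \<subseteq> B"
  shows "null_on (\<lambda>i. f (h i)) A"
  unfolding null_on_def
proof (intro allI impI)
  fix e :: real assume "e > 0"
  then have "finite {i\<in>B. f i > e}" using assms by (simp add: null_on_def)
  moreover have "h ` {i\<in>A. f (h i) > e} \<subseteq> {i\<in>B. f i > e}" using assms by auto
  ultimately have "finite (h ` {i\<in>A. f (h i) > e})" by (rule finite_subset[rotated])
  then show "finite {i\<in>A. f (h i) > e}"
    by (rule finite_imageD) (use assms(2) in \<open>auto simp: inj_on_def\<close>)
qed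

lemma padic_has_sum_iff:
  fixes f :: "'i \<Rightarrow> 'p::prime_card padic"
  shows "(f has_sum s) A \<longleftrightarrow>
    (\<forall>e>0. \<exists>F. finite F \<and> F \<subseteq> A \<and> (\<forall>F'. finite F' \<and> F \<subseteq> F' \<and> F' \<subseteq> A \<longrightarrow> padic_norm (sum f F' - s) < e))"
  unfolding has_sum_def tendsto_iff eventually_finite_subsets_at_top dist_padic_def ..

text \<open>A finite partial sum that is closer to \<open>s\<close> than \<open>padic_norm s\<close>
  has at least the norm of \<open>s\<close>, and finite sums never leave the ball of radius
  \<open>B\<close>.\<close>

lemma padic_has_sum_norm_le:
  fixes f :: "'i \<Rightarrow> 'p::prime_card padic"
  assumes "(f has_sum s) A" "\<And>i. i \<in> A \<Longrightarrow> padic_norm (f i) \<le> B" "0 \<le> B"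
  shows "padic_norm s \<le> B"
proof (cases "s = 0")
  case False
  then have "padic_norm s > 0" by simp
  then obtain F where F: "finite F" "F \<subseteq> A" "padic_norm (sum f F - s) < padic_norm s"
    using assms(1) unfolding padic_has_sum_iff by (meson order_refl)
  have "padic_norm (sum f F) \<le> B"
    using F assms by (intro padic_norm_sum_le) auto
  moreover have "padic_norm s \<le> max (padic_norm (sum f F)) (padic_norm (s - sum f F))"
    using padic_norm_ultra[of "sum f F" "s - sum f F"] by simp
  ultimately show ?thesis using F(3) by (simp add: padic_norm_minus_commute max_def split: if_splits)
qed (use assms in auto)

text \<open>A single term outside \<open>F\<close> is the difference of two finite sums that are
  both within \<open>e\<close> of \<open>s\<close>.\<close>

lemma padic_summable_null_on:
  fixes f :: "'i \<Rightarrow> 'p::prime_card padic"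
  assumes "f summable_on A"
  shows "null_on (\<lambda>i. padic_norm (f i)) A"
  unfolding null_on_def
proof (intro allI impI)
  fix e :: real assume "e > 0"
  obtain s where "(f has_sum s) A" using assms by (auto simp: summable_on_def)
  then obtain F where F: "finite F" "F \<subseteq> A"
    and F': "\<And>F'. finite F' \<Longrightarrow> F \<subseteq> F' \<Longrightarrow> F' \<subseteq> A \<Longrightarrow> padic_norm (sum f F' - s) < e"
    using \<open>e > 0\<close> unfolding padic_has_sum_iff by meson
  have "padic_norm (f i) \<le> e" if i: "i \<in> A - F" for i
  proof -
    have "f i = (sum f (insert i F) - s) - (sum f F - s)"
      using F i by simp
    moreover have "padic_norm (sum f (insert i F) - s) < e" "padic_norm (sum f F - s) < e"
      using F i F'[of F] F'[of "insert i F"] by blast+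
    ultimately show ?thesis
      by (metis padic_norm_diff_le less_imp_le)
  qed
  then have "{i\<in>A. padic_norm (f i) > e} \<subseteq> F" by force
  then show "finite {i\<in>A. padic_norm (f i) > e}" using F(1) by (rule finite_subset)
qed

lemma padic_null_on_summable:
  fixes f :: "'i \<Rightarrow> 'p::prime_card padic"
  assumes "null_on (\<lambda>i. padic_norm (f i)) A"
  shows "f summable_on A"
proof -
  \<comment> \<open>\<open>E n\<close> collects the finitely many terms above
    \<open>1 / (n + 1)\<close>. Enlarging it within \<open>A\<close> changes the sum by at most
    \<open>1 / (n + 1)\<close>, so the sums over these sets form a Cauchy sequence.\<close>
  define E where "E n = {i\<in>A. padic_norm (f i) > inverse (real (Suc n))}" for n
  have E: "finite (E n)" "E n \<subseteq> A" for n
    using assms by (auto simp: null_on_def E_def)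
  have small: "padic_norm (sum f F - sum f (E n)) \<le> inverse (real (Suc n))"
    if "finite F" "E n \<subseteq> F" "F \<subseteq> A" for F n
  proof -
    have "sum f F - sum f (E n) = sum f (F - E n)"
      using that E by (simp add: sum_diff)
    moreover have "padic_norm (sum f (F - E n)) \<le> inverse (real (Suc n))"
      by (rule padic_norm_sum_le) (use that in \<open>auto simp: E_def not_less\<close>)
    ultimately show ?thesis by simp
  qed
  have mono: "E m \<subseteq> E n" if "m \<le> n" for m n
  proof -
    have "inverse (real (Suc n)) \<le> inverse (real (Suc m))"
      using that by (intro le_imp_inverse_le) auto
    then show ?thesis unfolding E_def by (intro Collect_mono) (meson le_less_trans)
  qed
  have ex: "\<exists>n. inverse (real (Suc n)) < e" if "e > 0" for e
    using reals_Archimedean[OF that] .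
  have "Cauchy (\<lambda>n. sum f (E n))"
  proof (rule metric_CauchyI)
    fix e :: real assume "e > 0"
    then obtain k where k: "inverse (real (Suc k)) < e" using ex by blast
    have "padic_norm (sum f (E m) - sum f (E n)) < e" if mn: "m \<ge> k" "n \<ge> k" for m n
    proof -
      have "padic_norm (sum f (E m) - sum f (E k)) \<le> inverse (real (Suc k))"
         "padic_norm (sum f (E n) - sum f (E k)) \<le> inverse (real (Suc k))"
        using mn small[OF E(1)[of m] mono E(2)] small[OF E(1)[of n] mono E(2)] by blast+
      from padic_norm_diff_le[OF this] show ?thesis using k by simp
    qed
    then show "\<exists>M. \<forall>m\<ge>M. \<forall>n\<ge>M. dist (sum f (E m)) (sum f (E n)) < e"
      by (auto simp: dist_padic_def)
  qed
  then obtain s where s: "(\<lambda>n. sum f (E n)) \<longlonglongrightarrow> s"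
    using Cauchy_convergent convergent_def by blast
  have "(f has_sum s) A"
    unfolding padic_has_sum_iff
  proof (intro allI impI)
    fix e :: real assume e: "e > 0"
    obtain k where k: "inverse (real (Suc k)) < e" using ex e by blast
    obtain l where l: "\<forall>n\<ge>l. padic_norm (sum f (E n) - s) < e"
      using s e by (auto simp: lim_sequentially dist_padic_def)
    define m where "m = max k l"
    have m: "inverse (real (Suc m)) < e"
    proof -
      have "inverse (real (Suc m)) \<le> inverse (real (Suc k))"
        by (intro le_imp_inverse_le) (auto simp: m_def)
      then show ?thesis using k by linarith
    qed
    show "\<exists>F. finite F \<and> F \<subseteq> A \<and>
        (\<forall>F'. finite F' \<and> F \<subseteq> F' \<and> F' \<subseteq> A \<longrightarrow> padic_norm (sum f F' - s) < e)"
    proof (intro exI[of _ "E m"] conjI E allI impI)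
      fix F assume F: "finite F \<and> E m \<subseteq> F \<and> F \<subseteq> A"
      have "padic_norm (sum f F - sum f (E m)) < e"
        using small[of F m] F m by linarith
      moreover have "padic_norm (sum f (E m) - s) < e" using l by (simp add: m_def)
      ultimately show "padic_norm (sum f F - s) < e"
        using padic_norm_ultra[of "sum f F - sum f (E m)" "sum f (E m) - s"] by simp
    qed
  qed
  then show ?thesis by (auto simp: summable_on_def)
qed

text \<open>The premise under which \<open>has_sum_Sigma\<close> turns a sum over a product into an
  iterated sum.\<close>

lemma padic_uniformly_continuous_add:
  "uniformly_continuous_on UNIV (\<lambda>(x :: 'p::prime_card padic, y). x + y)"
  unfolding uniformly_continuous_on_def
proof (intro allI impI)
  fix e :: real assume e: "e > 0"
  have "dist (fst u + snd u) (fst v + snd v) < e" if "dist u v < e" for u v :: "'p padic \<times> 'p padic"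
  proof -
    have "dist (fst u) (fst v) < e" "dist (snd u) (snd v) < e"
      using that dist_fst_le[of u v] dist_snd_le[of u v] by auto
    then show ?thesis
      using padic_norm_ultra[of "fst u - fst v" "snd u - snd v"]
      by (simp add: dist_padic_def algebra_simps)
  qed
  then show "\<exists>d>0. \<forall>x\<in>UNIV. \<forall>x'\<in>UNIV. dist x' x < d \<longrightarrow>
       dist (case x' of (x, y) \<Rightarrow> x + y) (case x of (x :: 'p padic, y) \<Rightarrow> x + y) < e"
    using e by (intro exI[of _ e]) (simp add: case_prod_beta)
qed

text \<open>A null double family is summable over the product, so both iterated sums equal that one
  sum. No absolute convergence is involved.\<close>

lemma padic_has_sum_swap:
  fixes f :: "'i \<Rightarrow> 'j \<Rightarrow> 'p::prime_card padic"
  assumes null: "null_on (\<lambda>(i, j). padic_norm (f i j)) (A \<times> B)"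
    and g: "\<And>i. i \<in> A \<Longrightarrow> (f i has_sum g i) B"
    and h: "\<And>j. j \<in> B \<Longrightarrow> ((\<lambda>i. f i j) has_sum h j) A"
    and s: "(g has_sum s) A"
  shows "(h has_sum s) B"
proof -
  have "(\<lambda>(i, j). f i j) summable_on A \<times> B"
    by (rule padic_null_on_summable) (use null in \<open>simp add: case_prod_unfold\<close>)
  then obtain t where t: "((\<lambda>(i, j). f i j) has_sum t) (A \<times> B)" by (auto simp: summable_on_def)
  have "(g has_sum t) A"
    by (rule has_sum_Sigma[OF padic_uniformly_continuous_add t]) (use g in simp)
  then have "t = s" using s by (rule has_sum_unique)
  have "prod.swap ` (B \<times> A) = A \<times> B" by auto
  with t have "((\<lambda>(i, j). f i j) has_sum t) (prod.swap ` (B \<times> A))" by simp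
  then have "((\<lambda>(j, i). f i j) has_sum t) (B \<times> A)"
    by (subst (asm) has_sum_reindex) (auto simp: o_def case_prod_unfold)
  then have "(h has_sum t) B"
    by (rule has_sum_Sigma[OF padic_uniformly_continuous_add]) (use h in simp)
  then show ?thesis using \<open>t = s\<close> by simp
qed

section \<open>Local compactness\<close>

text \<open>The residues modulo \<open>p\<close> are represented by the integers below
  \<open>p\<close>. A rational close to \<open>x\<close> has a denominator prime to
  \<open>p\<close>, and the digit is its residue.\<close>

lemma padic_digit:
  assumes "padic_norm (x :: 'p::prime_card padic) \<le> 1"
  shows "\<exists>n < CARD('p). \<exists>y. x = of_nat n + of_nat CARD('p) * y \<and> padic_norm y \<le> 1"
proof -
  let ?p = "CARD('p)"
  have p: "prime ?p" by (rule prime_card)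
  then have p0: "?p > 0" by (simp add: prime_gt_0_nat)
  obtain q where q: "padic_norm (x - padic_of_rat q) < 1 / real ?p"
    using padic_of_rat_dense[of "1 / real ?p" x] p0 by auto
  have "1 / real ?p \<le> 1" using p0 by simp
  then have "padic_norm (x - padic_of_rat q) \<le> 1" using q by linarith
  then have "padic_norm (padic_of_rat q :: 'p padic) \<le> 1"
    using padic_norm_diff_le[of x 1 "x - padic_of_rat q"] assms by simp
  then have q1: "padic_abs ?p q \<le> 1" by (simp add: padic_norm_of_rat)
  have "\<exists>n<?p. padic_abs ?p (q - of_nat n) \<le> 1 / real ?p"
  proof -
    obtain a b where ab: "quotient_of q = (a, b)" by (cases "quotient_of q")
    have b: "b > 0" and q_eq: "q = of_int a / of_int b" and cop: "coprime a b"
      using quotient_of_denom_pos[OF ab] quotient_of_div[OF ab] quotient_of_coprime[OF ab] by auto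
    \<comment> \<open>Otherwise coprimality makes \<open>a\<close> prime to \<open>p\<close>, and
      the absolute value of \<open>q\<close> would be at least \<open>p\<close>.\<close>
    have pb: "\<not> int ?p dvd b"
    proof
      assume d: "int ?p dvd b"
      have "\<not> int ?p dvd a"
        using cop d p by (metis coprime_common_divisor not_prime_unit prime_int_nat_transfer prime_nat_int_transfer)
      then have "a \<noteq> 0" and "multiplicity (int ?p) a = 0" by (auto simp: not_dvd_imp_multiplicity_0)
      moreover have "multiplicity (int ?p) b \<ge> 1"
        using d b p by (intro multiplicity_geI) (auto simp: prime_gt_1_nat not_prime_unit)
      ultimately have "padic_abs ?p q \<ge> real ?p powi 1"
        unfolding q_eq using b p0
        by (subst padic_abs_eq[OF p]) (auto intro!: power_int_increasing simp del: power_int_1_right power_int_of_nat)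
      moreover have "real ?p > 1" using p prime_gt_1_nat by simp
      ultimately show False using q1 by simp
    qed
    then have "coprime b (int ?p)"
      using p by (metis coprime_commute prime_imp_coprime prime_nat_int_transfer)
    then obtain u where u: "[b * u = 1] (mod int ?p)"
      using cong_solve_coprime_int by blast
    \<comment> \<open>\<open>u\<close> inverts \<open>b\<close> modulo \<open>p\<close>, so
      \<open>n\<close> is the residue of \<open>q = a / b\<close>.\<close>
    define n where "n = nat ((a * u) mod int ?p)"
    have n: "n < ?p" using p0 by (simp add: n_def nat_less_iff)
    have "[int n = a * u] (mod int ?p)" using p0 by (simp add: n_def cong_def)
    then have "[b * int n = b * (a * u)] (mod int ?p)" by (rule cong_scalar_left)
    also have "b * (a * u) = a * (b * u)" by (simp add: algebra_simps)
    also have "[a * (b * u) = a * 1] (mod int ?p)" using u by (rule cong_scalar_left)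
    finally have "int ?p dvd a - b * int n" by (simp add: cong_sym_eq cong_iff_dvd_diff)
    have "padic_abs ?p (q - of_nat n) \<le> 1 / real ?p"
    proof (cases "a - b * int n = 0")
      case True
      then have "q = of_nat n" using b by (simp add: q_eq field_simps)
      then show ?thesis by simp
    next
      case False
      have eq: "q - of_nat n = of_int (a - b * int n) / of_int b"
        using b by (simp add: q_eq field_simps)
      have "multiplicity (int ?p) (a - b * int n) \<ge> 1"
        using \<open>int ?p dvd a - b * int n\<close> False p
        by (intro multiplicity_geI) (auto simp: prime_gt_1_nat not_prime_unit)
      moreover have "multiplicity (int ?p) b = 0" using pb by (rule not_dvd_imp_multiplicity_0)
      ultimately have "padic_abs ?p (q - of_nat n) \<le> real ?p powi (- 1)"
        unfolding eq using b p0 False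
        by (subst padic_abs_eq[OF p]) (auto intro!: power_int_increasing simp del: power_int_minus power_int_minus1_right)
      then show ?thesis by (simp add: power_int_minus divide_inverse)
    qed
    then show ?thesis using n by blast
  qed
  then obtain n where n: "n < ?p" "padic_abs ?p (q - of_nat n) \<le> 1 / real ?p" by blast
  have "padic_norm (padic_of_rat q - of_nat n :: 'p padic) \<le> 1 / real ?p"
    using n(2) by (simp flip: padic_norm_of_rat add: padic_of_rat_diff)
  then have le: "padic_norm (x - of_nat n) \<le> 1 / real ?p"
    using padic_norm_add_le[of "x - padic_of_rat q" "1 / real ?p" "padic_of_rat q - of_nat n"] q by simp
  define y where "y = (x - of_nat n) / of_nat ?p"
  have "x = of_nat n + of_nat ?p * y" using p0 by (simp add: y_def)
  moreover have "padic_norm y \<le> 1"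
    using le p0 by (simp add: y_def padic_norm_divide padic_norm_p field_simps)
  ultimately show ?thesis using n(1) by blast
qed

text \<open>\<open>S\<close> holds the expansions with \<open>k\<close> digits; the induction step
  appends the next digit of the remainder \<open>y\<close>.\<close>

lemma padic_unit_ball_cover:
  "\<exists>S. finite S \<and> (\<forall>x :: 'p::prime_card padic. padic_norm x \<le> 1 \<longrightarrow>
     (\<exists>s\<in>S. \<exists>y. x = s + of_nat CARD('p) ^ k * y \<and> padic_norm y \<le> 1))"
proof (induction k)
  case 0
  show ?case by (intro exI[of _ "{0}"]) auto
next
  case (Suc k)
  then obtain S :: "'p padic set" where S: "finite S"
    "\<And>x. padic_norm x \<le> 1 \<Longrightarrow> \<exists>s\<in>S. \<exists>y. x = s + of_nat CARD('p) ^ k * y \<and> padic_norm y \<le> 1" by auto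
  define T where "T = (\<lambda>(s, n). s + of_nat CARD('p) ^ k * of_nat n) ` (S \<times> {..<CARD('p)})"
  have "\<exists>t\<in>T. \<exists>y. x = t + of_nat CARD('p) ^ Suc k * y \<and> padic_norm y \<le> 1"
    if x: "padic_norm x \<le> 1" for x
  proof -
    obtain s y where s: "s \<in> S" "x = s + of_nat CARD('p) ^ k * y" "padic_norm y \<le> 1"
      using S(2)[OF x] by blast
    obtain n z where n: "n < CARD('p)" "y = of_nat n + of_nat CARD('p) * z" "padic_norm z \<le> 1"
      using padic_digit[OF s(3)] by blast
    have "x = (s + of_nat CARD('p) ^ k * of_nat n) + of_nat CARD('p) ^ Suc k * z"
      by (simp add: s n algebra_simps)
    moreover have "s + of_nat CARD('p) ^ k * of_nat n \<in> T" using s n by (auto simp: T_def)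
    ultimately show ?thesis using n(3) by blast
  qed
  moreover have "finite T" using S(1) by (simp add: T_def)
  ultimately show ?case by blast
qed

text \<open>Balls are complete, and total boundedness is carried over from the unit ball by scaling.
  This is the source of the compact open sets on a manifold.\<close>

lemma padic_compact_cball: "compact (cball (a :: 'p::prime_card padic) r)"
  unfolding compact_eq_totally_bounded
proof (intro conjI allI impI)
  show "complete (cball a r)" by (simp add: complete_eq_closed)
  fix e :: real assume e: "e > 0"
  obtain k where k: "padic_norm ((of_nat CARD('p) :: 'p padic) ^ k) < 1 / (\<bar>r\<bar> + 1)"
     "(of_nat CARD('p) :: 'p padic) ^ k \<noteq> 0"
    using padic_small_elem[where 'p='p, of "1 / (\<bar>r\<bar> + 1)"]
    by (meson abs_ge_zero add_nonneg_pos divide_pos_pos zero_less_one)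
  \<comment> \<open>After moving \<open>a\<close> to 0, multiplication by \<open>c\<close> sends the
    ball of radius \<open>r\<close> into the unit ball. The pieces found there have radius below
    \<open>e * padic_norm c\<close>, hence radius below \<open>e\<close> after dividing by
    \<open>c\<close> again.\<close>
  define c :: "'p padic" where "c = of_nat CARD('p) ^ k"
  have c: "c \<noteq> 0" using k(2) unfolding c_def .
  have cn: "padic_norm c > 0" using c by simp
  have rc: "r * padic_norm c \<le> 1"
  proof -
    have "(\<bar>r\<bar> + 1) * padic_norm c < 1" using k(1) unfolding c_def
      by (simp add: pos_less_divide_eq mult.commute)
    moreover have "r * padic_norm c \<le> (\<bar>r\<bar> + 1) * padic_norm c"
      using cn by (intro mult_right_mono) auto
    ultimately show ?thesis by linarith
  qed
  obtain l where l: "padic_norm ((of_nat CARD('p) :: 'p padic) ^ l) < e * padic_norm c"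
    using padic_small_elem[where 'p='p, of "e * padic_norm c"] e cn by auto
  obtain S :: "'p padic set" where S: "finite S"
    "\<And>x. padic_norm x \<le> 1 \<Longrightarrow> \<exists>s\<in>S. \<exists>y. x = s + of_nat CARD('p) ^ l * y \<and> padic_norm y \<le> 1"
    using padic_unit_ball_cover[where 'p='p, of l] by auto
  have "x \<in> (\<Union>s\<in>(\<lambda>s. a + s / c) ` S. ball s e)" if x: "x \<in> cball a r" for x
  proof -
    have "padic_norm (x - a) \<le> r" using x by (simp add: dist_padic_def padic_norm_minus_commute)
    then have "padic_norm (x - a) * padic_norm c \<le> r * padic_norm c"
      using cn by (intro mult_right_mono) auto
    then have "padic_norm ((x - a) * c) \<le> 1" using rc by (simp add: padic_norm_mult)
    then obtain s y where s: "s \<in> S" "(x - a) * c = s + of_nat CARD('p) ^ l * y" "padic_norm y \<le> 1"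
      using S(2) by blast
    have "x - (a + s / c) = ((x - a) * c - s) / c" using c by (simp add: field_simps)
    also have "\<dots> = of_nat CARD('p) ^ l * y / c" by (simp add: s(2))
    finally have "padic_norm (x - (a + s / c)) = padic_norm ((of_nat CARD('p) :: 'p padic) ^ l) * padic_norm y / padic_norm c"
      by (simp only: padic_norm_divide padic_norm_mult)
    also have "\<dots> \<le> padic_norm ((of_nat CARD('p) :: 'p padic) ^ l) / padic_norm c"
      using s(3) cn by (intro divide_right_mono mult_left_le) (auto simp: padic_norm_nonneg)
    also have "\<dots> < e" using l cn by (simp add: pos_divide_less_eq)
    finally have "dist (a + s / c) x < e" by (simp add: dist_padic_def padic_norm_minus_commute)
    then show ?thesis using s(1) by auto
  qed
  then show "\<exists>K. finite K \<and> cball a r \<subseteq> (\<Union>x\<in>K. ball x e)"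
    using S(1) by (intro exI[of _ "(\<lambda>s. a + s / c) ` S"]) auto
qed

section \<open>Convergent power series on polydiscs\<close>

text \<open>These closed polydiscs are also open for positive radius, and each of their points is a
  centre. Hence a polydisc can be re-expanded about any of its points without shrinking.\<close>

definition polydisc :: "nat \<Rightarrow> (nat \<Rightarrow> 'p::prime_card padic) \<Rightarrow> real \<Rightarrow> (nat \<Rightarrow> 'p padic) set" where
  "polydisc d a r = {x \<in> padic_space d. \<forall>i<d. padic_norm (x i - a i) \<le> r}"

definition total_degree :: "nat \<Rightarrow> (nat \<Rightarrow> nat) \<Rightarrow> nat" where
  "total_degree d \<alpha> = (\<Sum>i<d. \<alpha> i)"

definition monomial :: "nat \<Rightarrow> (nat \<Rightarrow> 'p::prime_card padic) \<Rightarrow> (nat \<Rightarrow> nat) \<Rightarrow> (nat \<Rightarrow> 'p padic) \<Rightarrow> 'p padic" where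
  "monomial d a \<alpha> x = (\<Prod>i<d. (x i - a i) ^ \<alpha> i)"

text \<open>The decay of the coefficients is part of the definition: if \<open>r\<close> is not a
  value of the norm, convergence at the points of the polydisc gives decay only for a smaller
  radius.\<close>

definition pseries :: "nat \<Rightarrow> (nat \<Rightarrow> 'p::prime_card padic) \<Rightarrow> real \<Rightarrow> ((nat \<Rightarrow> nat) \<Rightarrow> 'p padic) \<Rightarrow>
    ((nat \<Rightarrow> 'p padic) \<Rightarrow> 'p padic) \<Rightarrow> bool" where
  "pseries d a r C f \<longleftrightarrow> a \<in> padic_space d \<and> r > 0 \<and>
     null_on (\<lambda>\<alpha>. padic_norm (C \<alpha>) * r ^ total_degree d \<alpha>) (multi_indices d) \<and>
     (\<forall>x\<in>polydisc d a r. ((\<lambda>\<alpha>. C \<alpha> * monomial d a \<alpha> x) has_sum f x) (multi_indices d))"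

text \<open>\<open>B\<close> bounds the Gauss norm of the expansion of \<open>f\<close> on the polydisc, hence also \<open>|f|\<close>; the radius may
  be any positive real, not only a value of the norm.\<close>

definition tate :: "nat \<Rightarrow> (nat \<Rightarrow> 'p::prime_card padic) \<Rightarrow> real \<Rightarrow> real \<Rightarrow>
    ((nat \<Rightarrow> 'p padic) \<Rightarrow> 'p padic) \<Rightarrow> bool" where
  "tate d a r B f \<longleftrightarrow> (\<exists>C. pseries d a r C f \<and> (\<forall>\<alpha>\<in>multi_indices d. padic_norm (C \<alpha>) * r ^ total_degree d \<alpha> \<le> B))"

section \<open>Polydiscs, total degrees and monomials\<close>

lemma polydisc_center: "a \<in> padic_space d \<Longrightarrow> r \<ge> 0 \<Longrightarrow> a \<in> polydisc d a r"
  by (simp add: polydisc_def)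

lemma polydisc_mono: "s \<le> r \<Longrightarrow> polydisc d a s \<subseteq> polydisc d a r"
  by (auto simp: polydisc_def intro: order_trans)

lemma polydisc_recentre:
  assumes "b \<in> polydisc d a r" shows "polydisc d b r = polydisc d a r"
proof -
  have "padic_norm (x i - b i) \<le> r \<longleftrightarrow> padic_norm (x i - a i) \<le> r" if "i < d" for x i
    using assms that padic_norm_add_le[of "x i - b i" r "b i - a i"] padic_norm_diff_le[of "x i - a i" r "b i - a i"]
    by (auto simp: polydisc_def)
  then show ?thesis by (auto simp: polydisc_def)
qed

lemma polydisc_upd:
  "x \<in> polydisc d a r \<Longrightarrow> i < d \<Longrightarrow> padic_norm h \<le> r \<Longrightarrow> x(i := x i + h) \<in> polydisc d a r"
  using padic_norm_add_le[of "x i - a i" r h] by (auto simp: polydisc_def padic_space_def algebra_simps)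

lemma polydisc_in_space: "x \<in> polydisc d a r \<Longrightarrow> x \<in> padic_space d"
  by (simp add: polydisc_def)

lemma total_degree_0 [simp]: "total_degree d (\<lambda>_. 0) = 0"
  by (simp add: total_degree_def)

lemma total_degree_add: "total_degree d (\<lambda>i. \<alpha> i + \<beta> i) = total_degree d \<alpha> + total_degree d \<beta>"
  by (simp add: total_degree_def sum.distrib)

lemma total_degree_upd_Suc: "i < d \<Longrightarrow> total_degree d (\<alpha>(i := Suc (\<alpha> i))) = Suc (total_degree d \<alpha>)"
  by (simp add: total_degree_def sum.remove[of _ i])

lemma multi_indices_0 [simp]: "(\<lambda>_. 0) \<in> multi_indices d"
  by (simp add: multi_indices_def)

lemma multi_indices_upd: "\<alpha> \<in> multi_indices d \<Longrightarrow> i < d \<Longrightarrow> \<alpha>(i := n) \<in> multi_indices d"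
  by (auto simp: multi_indices_def)

lemma total_degree_eq_0: "\<alpha> \<in> multi_indices d \<Longrightarrow> total_degree d \<alpha> = 0 \<longleftrightarrow> \<alpha> = (\<lambda>_. 0)"
  by (auto simp: total_degree_def multi_indices_def fun_eq_iff) (metis lessThan_iff not_le)

lemma monomial_0 [simp]: "monomial d a (\<lambda>_. 0) x = 1"
  by (simp add: monomial_def)

lemma monomial_add: "monomial d a (\<lambda>i. \<alpha> i + \<beta> i) x = monomial d a \<alpha> x * monomial d a \<beta> x"
  by (simp add: monomial_def power_add prod.distrib)

lemma monomial_center:
  assumes "\<alpha> \<in> multi_indices d" "\<alpha> \<noteq> (\<lambda>_. 0)" shows "monomial d a \<alpha> a = 0"
proof -
  obtain i where i: "\<alpha> i \<noteq> 0" using assms(2) by auto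
  then have "i < d" using assms(1) unfolding multi_indices_def by (metis (mono_tags) mem_Collect_eq not_le)
  then show ?thesis using i by (auto simp: monomial_def intro!: prod_zero bexI[of _ i])
qed

lemma monomial_norm_le:
  assumes "x \<in> polydisc d a r" "r \<ge> 0" shows "padic_norm (monomial d a \<alpha> x) \<le> r ^ total_degree d \<alpha>"
  unfolding monomial_def total_degree_def padic_norm_prod power_sum padic_norm_power
  by (rule prod_mono) (use assms in \<open>auto simp: polydisc_def intro!: power_mono\<close>)

lemma pseries_bounded:
  "pseries d a r C f \<Longrightarrow> \<exists>B>0. \<forall>\<alpha>\<in>multi_indices d. padic_norm (C \<alpha>) * r ^ total_degree d \<alpha> \<le> B"
  unfolding pseries_def using null_on_bounded by blast

lemma tate_bound_nonneg:
  assumes "tate d a r B f" shows "B \<ge> 0"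
proof -
  obtain C :: "(nat \<Rightarrow> nat) \<Rightarrow> 'a padic" where "padic_norm (C (\<lambda>_. 0)) * r ^ total_degree d (\<lambda>_. 0) \<le> B"
    using assms multi_indices_0[of d] unfolding tate_def by blast
  then have "padic_norm (C (\<lambda>_. 0)) \<le> B" by simp
  with padic_norm_nonneg show ?thesis by (rule order_trans)
qed

lemma tate_center: "tate d a r B f \<Longrightarrow> a \<in> padic_space d" and tate_radius: "tate d a r B f \<Longrightarrow> r > 0"
  by (auto simp: tate_def pseries_def)

lemma pseries_tate: "pseries d a r C f \<Longrightarrow> \<exists>B>0. tate d a r B f"
  using pseries_bounded unfolding tate_def by blast

lemma tate_mono: "tate d a r B f \<Longrightarrow> B \<le> B' \<Longrightarrow> tate d a r B' f"
  unfolding tate_def by (meson order_trans)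

lemma tate_cong:
  assumes "tate d a r B f" "\<And>x. x \<in> polydisc d a r \<Longrightarrow> f x = g x"
  shows "tate d a r B g"
  using assms unfolding tate_def pseries_def by auto

lemma tate_norm_le:
  assumes "tate d a r B f" "x \<in> polydisc d a r" shows "padic_norm (f x) \<le> B"
proof -
  obtain C where C: "pseries d a r C f" "\<And>\<alpha>. \<alpha> \<in> multi_indices d \<Longrightarrow> padic_norm (C \<alpha>) * r ^ total_degree d \<alpha> \<le> B"
    using assms(1) unfolding tate_def by blast
  have r: "r \<ge> 0" using C by (simp add: pseries_def)
  show ?thesis
  proof (rule padic_has_sum_norm_le)
    show "((\<lambda>\<alpha>. C \<alpha> * monomial d a \<alpha> x) has_sum f x) (multi_indices d)"
      using C(1) assms(2) by (simp add: pseries_def)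
    fix \<alpha> assume "\<alpha> \<in> multi_indices d"
    then show "padic_norm (C \<alpha> * monomial d a \<alpha> x) \<le> B"
      using C(2)[of \<alpha>] mult_left_mono[OF monomial_norm_le[OF assms(2) r, of \<alpha>], of "padic_norm (C \<alpha>)"]
      by (simp add: padic_norm_mult)
  qed (use tate_bound_nonneg[OF assms(1)] in simp)
qed

text \<open>Only finitely many rows have a bound \<open>B i\<close> above \<open>e\<close>, and each
  of them has finitely many large entries.\<close>

lemma null_on_prodI:
  assumes "null_on B I" "\<And>i j. i \<in> I \<Longrightarrow> j \<in> A \<Longrightarrow> h i j \<le> B i" "\<And>i. i \<in> I \<Longrightarrow> null_on (h i) A"
  shows "null_on (\<lambda>(i, j). h i j) (I \<times> A)"
  unfolding null_on_def
proof (intro allI impI)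
  fix e :: real assume e: "e > 0"
  have "{p \<in> I \<times> A. (case p of (i, j) \<Rightarrow> h i j) > e} \<subseteq> (SIGMA i:{i\<in>I. B i > e}. {j\<in>A. h i j > e})"
    using assms(2) by (force intro: less_le_trans)
  moreover have "finite (SIGMA i:{i\<in>I. B i > e}. {j\<in>A. h i j > e})"
    using assms(1,3) e by (intro finite_SigmaI) (auto simp: null_on_def)
  ultimately show "finite {p \<in> I \<times> A. (case p of (i, j) \<Rightarrow> h i j) > e}"
    by (rule finite_subset)
qed

text \<open>Products and compositions of power series are sums of families whose Gauss norms tend to zero, so
  this is the only place where a double series has to be rearranged.\<close>

lemma tate_has_sum:
  fixes f :: "'i \<Rightarrow> (nat \<Rightarrow> 'p::prime_card padic) \<Rightarrow> 'p padic"
  assumes a: "a \<in> padic_space d" and r: "r > 0" and K: "K \<ge> 0"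
    and f: "\<And>i. i \<in> I \<Longrightarrow> tate d a r (B i) (f i)"
    and B: "null_on B I" and BK: "\<And>i. i \<in> I \<Longrightarrow> B i \<le> K"
    and g: "\<And>x. x \<in> polydisc d a r \<Longrightarrow> ((\<lambda>i. f i x) has_sum g x) I"
  shows "tate d a r K g"
proof -
  let ?M = "multi_indices d"
  have "\<exists>C. pseries d a r C (f i) \<and> (\<forall>\<alpha>\<in>?M. padic_norm (C \<alpha>) * r ^ total_degree d \<alpha> \<le> B i)" if "i \<in> I" for i
    using f[OF that] by (simp add: tate_def)
  then obtain C where C: "\<And>i. i \<in> I \<Longrightarrow> pseries d a r (C i) (f i)"
      "\<And>i \<alpha>. i \<in> I \<Longrightarrow> \<alpha> \<in> ?M \<Longrightarrow> padic_norm (C i \<alpha>) * r ^ total_degree d \<alpha> \<le> B i" by metis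
  have null: "null_on (\<lambda>(i, \<alpha>). padic_norm (C i \<alpha>) * r ^ total_degree d \<alpha>) (I \<times> ?M)"
    by (rule null_on_prodI[OF B]) (use C in \<open>auto simp: pseries_def\<close>)
  \<comment> \<open>The expansion of the sum is formed coefficient by coefficient.\<close>
  define D where "D \<alpha> = infsum (\<lambda>i. C i \<alpha>) I" for \<alpha>
  have D: "((\<lambda>i. C i \<alpha>) has_sum D \<alpha>) I" if \<alpha>: "\<alpha> \<in> ?M" for \<alpha>
  proof -
    have "null_on (\<lambda>i. (1 / r ^ total_degree d \<alpha>) * B i) I"
      by (rule null_on_cmult[OF B]) (use r in simp)
    then have "null_on (\<lambda>i. padic_norm (C i \<alpha>)) I"
      by (rule null_on_mono) (use C(2)[OF _ \<alpha>] r in \<open>simp add: field_simps\<close>)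
    then show ?thesis unfolding D_def by (intro has_sum_infsum padic_null_on_summable)
  qed
  have Dle: "padic_norm (D \<alpha>) * r ^ total_degree d \<alpha> \<le> e"
    if \<alpha>: "\<alpha> \<in> ?M" and "\<And>i. i \<in> I \<Longrightarrow> padic_norm (C i \<alpha>) * r ^ total_degree d \<alpha> \<le> e" and "e \<ge> 0" for \<alpha> e
  proof -
    have "padic_norm (D \<alpha>) \<le> e / r ^ total_degree d \<alpha>"
      by (rule padic_has_sum_norm_le[OF D[OF \<alpha>]]) (use that r in \<open>auto simp: field_simps\<close>)
    then show ?thesis using r by (simp add: field_simps)
  qed
  have "null_on (\<lambda>\<alpha>. padic_norm (D \<alpha>) * r ^ total_degree d \<alpha>) ?M"
    unfolding null_on_def
  proof (intro allI impI)
    fix e :: real assume e: "e > 0"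
    \<comment> \<open>By \<open>Dle\<close> a coefficient \<open>D \<alpha>\<close> above
      \<open>e\<close> requires some \<open>C i \<alpha>\<close> above \<open>e\<close>, so the
      large indices are projections of finitely many large pairs.\<close>
    have "finite (snd ` {p \<in> I \<times> ?M. (case p of (i, \<alpha>) \<Rightarrow> padic_norm (C i \<alpha>) * r ^ total_degree d \<alpha>) > e})" (is "finite ?S")
      using null e by (simp add: null_on_def)
    moreover have "{\<alpha>\<in>?M. padic_norm (D \<alpha>) * r ^ total_degree d \<alpha> > e} \<subseteq> ?S"
    proof
      fix \<alpha> assume \<alpha>: "\<alpha> \<in> {\<alpha>\<in>?M. padic_norm (D \<alpha>) * r ^ total_degree d \<alpha> > e}"
      then obtain i where "i \<in> I" "padic_norm (C i \<alpha>) * r ^ total_degree d \<alpha> > e"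
        using Dle[of \<alpha> e] e by force
      then show "\<alpha> \<in> ?S" using \<alpha> by (intro image_eqI[of _ _ "(i, \<alpha>)"]) auto
    qed
    ultimately show "finite {\<alpha>\<in>?M. padic_norm (D \<alpha>) * r ^ total_degree d \<alpha> > e}" by (rule finite_subset[rotated])
  qed
  moreover have "((\<lambda>\<alpha>. D \<alpha> * monomial d a \<alpha> x) has_sum g x) ?M" if x: "x \<in> polydisc d a r" for x
  proof (rule padic_has_sum_swap)
    show "null_on (\<lambda>(i, \<alpha>). padic_norm (C i \<alpha> * monomial d a \<alpha> x)) (I \<times> ?M)"
      by (rule null_on_mono[OF null])
        (use monomial_norm_le[OF x] r in \<open>auto simp: padic_norm_mult intro!: mult_left_mono\<close>)
    show "((\<lambda>\<alpha>. C i \<alpha> * monomial d a \<alpha> x) has_sum f i x) ?M" if "i \<in> I" for i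
      using C(1)[OF that] x by (simp add: pseries_def)
    show "((\<lambda>i. C i \<alpha> * monomial d a \<alpha> x) has_sum D \<alpha> * monomial d a \<alpha> x) I" if "\<alpha> \<in> ?M" for \<alpha>
      by (rule has_sum_cmult_left[OF D[OF that]])
    show "((\<lambda>i. f i x) has_sum g x) I" by (rule g[OF x])
  qed
  ultimately have "pseries d a r D g" using a r by (simp add: pseries_def)
  moreover have "padic_norm (D \<alpha>) * r ^ total_degree d \<alpha> \<le> K" if "\<alpha> \<in> ?M" for \<alpha>
    by (rule Dle[OF that]) (use C(2)[OF _ that] BK K in \<open>auto intro: order_trans\<close>)
  ultimately show ?thesis unfolding tate_def by blast
qed

section \<open>Sums, products and powers of convergent series\<close>

lemma tate_sum:
  assumes "finite I" "a \<in> padic_space d" "r > 0" "K \<ge> 0" "\<And>i. i \<in> I \<Longrightarrow> tate d a r K (f i)"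
  shows "tate d a r K (\<lambda>x. \<Sum>i\<in>I. f i x)"
  by (rule tate_has_sum[where I = I and B = "\<lambda>_. K" and f = f])
     (use assms in \<open>auto intro: null_on_finite has_sum_finiteI\<close>)

lemma tate_add:
  assumes "tate d a r B f" "tate d a r B g" shows "tate d a r B (\<lambda>x. f x + g x)"
proof -
  have "tate d a r B (\<lambda>x. \<Sum>b\<in>UNIV. if b then f x else g x)"
  proof (rule tate_sum)
    show "tate d a r B (\<lambda>x. if b then f x else g x)" for b
      using assms by (cases b) simp_all
  qed (use assms tate_center tate_radius tate_bound_nonneg in auto)
  then show ?thesis by (simp add: UNIV_bool add.commute)
qed

text \<open>Multiplying by a monomial shifts the coefficients by \<open>\<beta>\<close>. This shift
  is the only coefficient manipulation that products will need.\<close>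

lemma tate_monomial_mult:
  assumes f: "tate d a r B f" and \<beta>: "\<beta> \<in> multi_indices d"
  shows "tate d a r (r ^ total_degree d \<beta> * B) (\<lambda>x. monomial d a \<beta> x * f x)"
proof -
  let ?M = "multi_indices d"
  obtain C where C: "pseries d a r C f" "\<And>\<alpha>. \<alpha> \<in> ?M \<Longrightarrow> padic_norm (C \<alpha>) * r ^ total_degree d \<alpha> \<le> B"
    using f unfolding tate_def by blast
  have r: "r > 0" using C by (simp add: pseries_def)
  define h where "h \<alpha> = (\<lambda>i. \<alpha> i + \<beta> i)" for \<alpha>
  have h: "inj_on h ?M" "h ` ?M \<subseteq> ?M"
    using \<beta> by (auto simp: inj_on_def h_def fun_eq_iff multi_indices_def)
  \<comment> \<open>Off the image of the shift the coefficient is 0, and on the image the truncated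
    subtraction is exact.\<close>
  define D where "D \<gamma> = (if \<gamma> \<in> h ` ?M then C (\<lambda>i. \<gamma> i - \<beta> i) else 0)" for \<gamma>
  have Dh: "D (h \<alpha>) = C \<alpha>" if "\<alpha> \<in> ?M" for \<alpha>
  proof -
    have "(\<lambda>i. h \<alpha> i - \<beta> i) = \<alpha>" by (simp add: h_def)
    then show ?thesis using that by (simp add: D_def)
  qed
  have D0: "D \<gamma> = 0" if "\<gamma> \<notin> h ` ?M" for \<gamma> using that by (simp add: D_def)
  have mh: "total_degree d (h \<alpha>) = total_degree d \<alpha> + total_degree d \<beta>" "monomial d a (h \<alpha>) x = monomial d a \<alpha> x * monomial d a \<beta> x" for \<alpha> x
    by (simp_all add: h_def total_degree_add monomial_add)
  have bound: "padic_norm (D \<gamma>) * r ^ total_degree d \<gamma> \<le> r ^ total_degree d \<beta> * B" if "\<gamma> \<in> ?M" for \<gamma>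
  proof (cases "\<gamma> \<in> h ` ?M")
    case True
    then obtain \<alpha> where "\<alpha> \<in> ?M" "\<gamma> = h \<alpha>" by auto
    then show ?thesis using C(2)[of \<alpha>] r by (simp add: Dh mh power_add)
  qed (use r tate_bound_nonneg[OF f] in \<open>simp add: D0\<close>)
  have "null_on (\<lambda>\<gamma>. padic_norm (D \<gamma>) * r ^ total_degree d \<gamma>) ?M"
    unfolding null_on_def
  proof (intro allI impI)
    fix e :: real assume e: "e > 0"
    have "null_on (\<lambda>\<alpha>. r ^ total_degree d \<beta> * (padic_norm (C \<alpha>) * r ^ total_degree d \<alpha>)) ?M"
      using C(1) r by (intro null_on_cmult) (auto simp: pseries_def)
    then have "finite (h ` {\<alpha>\<in>?M. r ^ total_degree d \<beta> * (padic_norm (C \<alpha>) * r ^ total_degree d \<alpha>) > e})" (is "finite ?S")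
      using e by (simp add: null_on_def)
    moreover have "{\<gamma>\<in>?M. padic_norm (D \<gamma>) * r ^ total_degree d \<gamma> > e} \<subseteq> ?S"
    proof
      fix \<gamma> assume \<gamma>: "\<gamma> \<in> {\<gamma>\<in>?M. padic_norm (D \<gamma>) * r ^ total_degree d \<gamma> > e}"
      then have "\<gamma> \<in> h ` ?M" using D0 e by force
      then obtain \<alpha> where "\<alpha> \<in> ?M" "\<gamma> = h \<alpha>" by auto
      then show "\<gamma> \<in> ?S" using \<gamma> by (auto simp: Dh mh power_add mult_ac)
    qed
    ultimately show "finite {\<gamma>\<in>?M. padic_norm (D \<gamma>) * r ^ total_degree d \<gamma> > e}" by (rule finite_subset[rotated])
  qed
  moreover have "((\<lambda>\<gamma>. D \<gamma> * monomial d a \<gamma> x) has_sum monomial d a \<beta> x * f x) ?M"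
    if x: "x \<in> polydisc d a r" for x
  proof -
    have "((\<lambda>\<alpha>. monomial d a \<beta> x * (C \<alpha> * monomial d a \<alpha> x)) has_sum monomial d a \<beta> x * f x) ?M"
      using C(1) x by (intro has_sum_cmult_right) (auto simp: pseries_def)
    also have "?this \<longleftrightarrow> (((\<lambda>\<gamma>. D \<gamma> * monomial d a \<gamma> x) \<circ> h) has_sum monomial d a \<beta> x * f x) ?M"
      by (rule has_sum_cong) (simp add: Dh mh)
    also have "\<dots> \<longleftrightarrow> ((\<lambda>\<gamma>. D \<gamma> * monomial d a \<gamma> x) has_sum monomial d a \<beta> x * f x) (h ` ?M)"
      by (rule has_sum_reindex[OF h(1), symmetric])
    also have "\<dots> \<longleftrightarrow> ((\<lambda>\<gamma>. D \<gamma> * monomial d a \<gamma> x) has_sum monomial d a \<beta> x * f x) ?M"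
      by (rule has_sum_cong_neutral) (use h(2) D0 in auto)
    finally show ?thesis .
  qed
  ultimately have "pseries d a r D (\<lambda>x. monomial d a \<beta> x * f x)"
    using C(1) by (simp add: pseries_def)
  then show ?thesis using bound unfolding tate_def by blast
qed

lemma tate_const:
  assumes "a \<in> padic_space d" "r > 0"
  shows "tate d a r (padic_norm c) (\<lambda>_. c)"
proof -
  let ?M = "multi_indices d"
  define C :: "(nat \<Rightarrow> nat) \<Rightarrow> 'a padic" where "C \<alpha> = (if \<alpha> = (\<lambda>_. 0) then c else 0)" for \<alpha>
  have "null_on (\<lambda>\<alpha>. padic_norm (C \<alpha>) * r ^ total_degree d \<alpha>) ?M"
    unfolding null_on_def
  proof (intro allI impI)
    fix e :: real assume "e > 0"
    then have "{\<alpha>\<in>?M. padic_norm (C \<alpha>) * r ^ total_degree d \<alpha> > e} \<subseteq> {\<lambda>_. 0}" by (auto simp: C_def)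
    then show "finite {\<alpha>\<in>?M. padic_norm (C \<alpha>) * r ^ total_degree d \<alpha> > e}" by (rule finite_subset) simp
  qed
  moreover have "((\<lambda>\<alpha>. C \<alpha> * monomial d a \<alpha> x) has_sum c) ?M" for x
  proof -
    have "((\<lambda>\<alpha>. C \<alpha> * monomial d a \<alpha> x) has_sum c) {\<lambda>_. 0}"
      by (rule has_sum_finiteI) (auto simp: C_def)
    also have "?this \<longleftrightarrow> ((\<lambda>\<alpha>. C \<alpha> * monomial d a \<alpha> x) has_sum c) ?M"
      by (rule has_sum_cong_neutral) (auto simp: C_def)
    finally show ?thesis .
  qed
  ultimately have "pseries d a r C (\<lambda>_. c)" using assms by (simp add: pseries_def)
  moreover have "\<forall>\<alpha>\<in>?M. padic_norm (C \<alpha>) * r ^ total_degree d \<alpha> \<le> padic_norm c"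
    by (auto simp: C_def)
  ultimately show ?thesis unfolding tate_def by blast
qed

lemma tate_cmult:
  assumes "tate d a r B f" shows "tate d a r (padic_norm c * B) (\<lambda>x. c * f x)"
proof -
  let ?M = "multi_indices d"
  obtain C where C: "pseries d a r C f" "\<And>\<alpha>. \<alpha> \<in> ?M \<Longrightarrow> padic_norm (C \<alpha>) * r ^ total_degree d \<alpha> \<le> B"
    using assms unfolding tate_def by blast
  have "null_on (\<lambda>\<alpha>. padic_norm c * (padic_norm (C \<alpha>) * r ^ total_degree d \<alpha>)) ?M"
    using C(1) by (intro null_on_cmult) (auto simp: pseries_def)
  moreover have "((\<lambda>\<alpha>. c * C \<alpha> * monomial d a \<alpha> x) has_sum c * f x) ?M" if "x \<in> polydisc d a r" for x
    unfolding mult.assoc using C(1) that by (intro has_sum_cmult_right) (auto simp: pseries_def)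
  ultimately have "pseries d a r (\<lambda>\<alpha>. c * C \<alpha>) (\<lambda>x. c * f x)"
    using C(1) by (simp add: pseries_def padic_norm_mult mult.assoc)
  moreover have "\<forall>\<alpha>\<in>?M. padic_norm (c * C \<alpha>) * r ^ total_degree d \<alpha> \<le> padic_norm c * B"
    using C(2) by (auto simp: padic_norm_mult mult.assoc intro!: mult_left_mono)
  ultimately show ?thesis unfolding tate_def by blast
qed

text \<open>Only \<open>f\<close> is expanded while \<open>g\<close> is kept whole: the product is a
  sum of multiples of monomials times \<open>g\<close>, with Gauss norms tending to zero.
  Convolution of coefficients never appears.\<close>

lemma tate_mult:
  assumes f: "tate d a r B f" and g: "tate d a r B' g"
  shows "tate d a r (B * B') (\<lambda>x. f x * g x)"
proof -
  let ?M = "multi_indices d"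
  obtain C where C: "pseries d a r C f" "\<And>\<alpha>. \<alpha> \<in> ?M \<Longrightarrow> padic_norm (C \<alpha>) * r ^ total_degree d \<alpha> \<le> B"
    using f unfolding tate_def by blast
  have B': "B' \<ge> 0" and B: "B \<ge> 0" using tate_bound_nonneg f g by blast+
  show ?thesis
  proof (rule tate_has_sum[where I = ?M and B = "\<lambda>\<alpha>. padic_norm (C \<alpha>) * (r ^ total_degree d \<alpha> * B')"
        and f = "\<lambda>\<alpha> x. C \<alpha> * (monomial d a \<alpha> x * g x)"])
    show "a \<in> padic_space d" "r > 0" using C(1) by (auto simp: pseries_def)
    show "tate d a r (padic_norm (C \<alpha>) * (r ^ total_degree d \<alpha> * B')) (\<lambda>x. C \<alpha> * (monomial d a \<alpha> x * g x))"
      if "\<alpha> \<in> ?M" for \<alpha>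
      by (intro tate_cmult tate_monomial_mult g that)
    have "null_on (\<lambda>\<alpha>. B' * (padic_norm (C \<alpha>) * r ^ total_degree d \<alpha>)) ?M"
      using C(1) B' by (intro null_on_cmult) (auto simp: pseries_def)
    then show "null_on (\<lambda>\<alpha>. padic_norm (C \<alpha>) * (r ^ total_degree d \<alpha> * B')) ?M" by (simp add: mult_ac)
    show "padic_norm (C \<alpha>) * (r ^ total_degree d \<alpha> * B') \<le> B * B'" if "\<alpha> \<in> ?M" for \<alpha>
      using mult_right_mono[OF C(2)[OF that] B'] by (simp add: mult.assoc)
    show "((\<lambda>\<alpha>. C \<alpha> * (monomial d a \<alpha> x * g x)) has_sum f x * g x) ?M" if "x \<in> polydisc d a r" for x
      unfolding mult.assoc[symmetric] using C(1) that by (intro has_sum_cmult_left) (auto simp: pseries_def)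
  qed (use B B' in simp)
qed

lemma tate_power:
  assumes "tate d a r B f" shows "tate d a r (B ^ n) (\<lambda>x. f x ^ n)"
proof (induction n)
  case 0
  show ?case using tate_const[OF tate_center[OF assms] tate_radius[OF assms], of 1] by simp
next
  case (Suc n)
  show ?case using tate_mult[OF assms Suc] by simp
qed

lemma tate_prod:
  assumes "a \<in> padic_space d" "r > 0" "\<And>i. i \<in> I \<Longrightarrow> tate d a r (B i) (f i)"
  shows "tate d a r (\<Prod>i\<in>I. B i) (\<lambda>x. \<Prod>i\<in>I. f i x)"
  using assms(3)
proof (induction I rule: infinite_finite_induct)
  case (insert i I)
  then show ?case using tate_mult[of d a r "B i" "f i"] by simp
qed (use tate_const[OF assms(1,2), of 1] in simp_all)

lemma tate_coord:
  assumes "a \<in> padic_space d" "r > 0" "i < d"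
  shows "tate d a r r (\<lambda>x. x i - a i)"
proof -
  define \<beta> where "\<beta> = (\<lambda>j. if j = i then 1 else 0 :: nat)"
  have "tate d a r (r ^ total_degree d \<beta> * padic_norm (1 :: 'a padic)) (\<lambda>x. monomial d a \<beta> x * 1)"
    by (rule tate_monomial_mult[OF tate_const[OF assms(1,2)]]) (use assms in \<open>auto simp: multi_indices_def \<beta>_def\<close>)
  moreover have "monomial d a \<beta> x = x i - a i" for x
  proof -
    have "monomial d a \<beta> x = (\<Prod>j<d. if j = i then x j - a j else 1)"
      unfolding monomial_def \<beta>_def by (rule prod.cong) auto
    then show ?thesis using assms(3) by simp
  qed
  moreover have "total_degree d \<beta> = 1" using assms(3) by (simp add: total_degree_def \<beta>_def)
  ultimately show ?thesis by simp
qed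

text \<open>Composition cannot be avoided: a \<open>p\<close>-adic function with zero derivative need not be locally
  constant, so analyticity of a primitive in a second chart does not follow from analyticity of its differential.\<close>

lemma tate_compose:
  assumes f: "tate e b s K f" and a: "a \<in> padic_space d" and r: "r > 0"
    and g: "\<And>j. j < e \<Longrightarrow> tate d a r s (\<lambda>x. g x j - b j)"
    and gs: "\<And>x. x \<in> polydisc d a r \<Longrightarrow> g x \<in> padic_space e"
  shows "tate d a r K (\<lambda>x. f (g x))"
proof -
  let ?M = "multi_indices e"
  obtain C where C: "pseries e b s C f" "\<And>\<alpha>. \<alpha> \<in> ?M \<Longrightarrow> padic_norm (C \<alpha>) * s ^ total_degree e \<alpha> \<le> K"
    using f unfolding tate_def by blast
  have gp: "g x \<in> polydisc e b s" if "x \<in> polydisc d a r" for x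
    using gs[OF that] tate_norm_le[OF g that] by (simp add: polydisc_def)
  show ?thesis
  proof (rule tate_has_sum[where I = ?M and B = "\<lambda>\<alpha>. padic_norm (C \<alpha>) * s ^ total_degree e \<alpha>"
        and f = "\<lambda>\<alpha> x. C \<alpha> * monomial e b \<alpha> (g x)"])
    show "tate d a r (padic_norm (C \<alpha>) * s ^ total_degree e \<alpha>) (\<lambda>x. C \<alpha> * monomial e b \<alpha> (g x))" for \<alpha>
      unfolding monomial_def total_degree_def power_sum
      by (intro tate_cmult tate_prod tate_power a r) (use g in auto)
    show "null_on (\<lambda>\<alpha>. padic_norm (C \<alpha>) * s ^ total_degree e \<alpha>) ?M" using C(1) by (simp add: pseries_def)
    show "((\<lambda>\<alpha>. C \<alpha> * monomial e b \<alpha> (g x)) has_sum f (g x)) ?M" if "x \<in> polydisc d a r" for x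
      using C(1) gp[OF that] by (simp add: pseries_def)
  qed (use a r C(2) tate_bound_nonneg[OF f] in auto)
qed

section \<open>Change of centre and of radius\<close>

text \<open>Re-expansion about \<open>b\<close> is composition with the identity:
  \<open>x j - a j\<close> is \<open>x j - b j\<close> plus a constant of norm at most
  \<open>r\<close>, so neither the radius nor the bound changes.\<close>

lemma tate_recentre:
  assumes "tate d a r B f" "b \<in> polydisc d a r"
  shows "tate d b r B f"
proof (rule tate_compose[where g = "\<lambda>x. x", OF assms(1)])
  show b: "b \<in> padic_space d" using assms(2) by (simp add: polydisc_def)
  show r: "r > 0" using assms(1) by (rule tate_radius)
  fix j assume j: "j < d"
  have "tate d b r r (\<lambda>x. (x j - b j) + (b j - a j))"
    by (rule tate_add[OF tate_coord[OF b r j] tate_mono[OF tate_const[OF b r]]])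
       (use assms(2) j in \<open>simp add: polydisc_def\<close>)
  then show "tate d b r r (\<lambda>x. x j - a j)" by simp
qed (simp add: polydisc_def)

lemma pseries_shrink:
  assumes "pseries d a r C f" "0 < s" "s \<le> r"
  shows "pseries d a s C f"
  unfolding pseries_def
proof (intro conjI ballI)
  show "null_on (\<lambda>\<alpha>. padic_norm (C \<alpha>) * s ^ total_degree d \<alpha>) (multi_indices d)"
  proof (rule null_on_mono)
    show "null_on (\<lambda>\<alpha>. padic_norm (C \<alpha>) * r ^ total_degree d \<alpha>) (multi_indices d)"
      using assms(1) by (simp add: pseries_def)
  qed (use assms in \<open>auto intro!: mult_left_mono power_mono\<close>)
  show "((\<lambda>\<alpha>. C \<alpha> * monomial d a \<alpha> x) has_sum f x) (multi_indices d)" if "x \<in> polydisc d a s" for x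
    using assms(1) that polydisc_mono[OF assms(3), of d a] by (auto simp: pseries_def)
qed (use assms in \<open>auto simp: pseries_def\<close>)

lemma tate_shrink:
  assumes "tate d a r B f" "0 < s" "s \<le> r"
  shows "tate d a s B f"
proof -
  obtain C where C: "pseries d a r C f" "\<And>\<alpha>. \<alpha> \<in> multi_indices d \<Longrightarrow> padic_norm (C \<alpha>) * r ^ total_degree d \<alpha> \<le> B"
    using assms unfolding tate_def by blast
  have le: "padic_norm (C \<alpha>) * s ^ total_degree d \<alpha> \<le> padic_norm (C \<alpha>) * r ^ total_degree d \<alpha>" for \<alpha>
    using assms by (intro mult_left_mono power_mono) auto
  then show ?thesis using C(2) pseries_shrink[OF C(1) assms(2,3)] unfolding tate_def by (meson order_trans)
qed

section \<open>Partial derivatives of power series\<close>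

text \<open>The estimate is multiplied out by \<open>h\<close>, so that \<open>h = 0\<close> is no
  exception. It is applied with \<open>e / 2\<close> to obtain the strict inequality of the
  limit.\<close>

lemma partial_deriv_eqI:
  fixes f :: "(nat \<Rightarrow> 'p::prime_card padic) \<Rightarrow> 'p padic"
  assumes "\<And>e. e > 0 \<Longrightarrow> \<exists>\<delta>>0. \<forall>h. padic_norm h \<le> \<delta> \<longrightarrow>
      padic_norm (f (a(i := a i + h)) - f a - D * h) \<le> e * padic_norm h"
  shows "partial_deriv i f a = D"
  unfolding partial_deriv_def
proof (rule tendsto_Lim[OF at_0_padic_neq_bot])
  show "((\<lambda>h. (f (a(i := a i + h)) - f a) / h) \<longlongrightarrow> D) (at 0)"
    unfolding tendsto_iff eventually_at dist_padic_def
  proof (intro allI impI)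
    fix e :: real assume e: "e > 0"
    obtain \<delta> where \<delta>: "\<delta> > 0" "\<And>h. padic_norm h \<le> \<delta> \<Longrightarrow>
        padic_norm (f (a(i := a i + h)) - f a - D * h) \<le> e / 2 * padic_norm h"
      using assms[of "e / 2"] e by auto
    have "padic_norm ((f (a(i := a i + h)) - f a) / h - D) < e" if h: "h \<noteq> 0" "padic_norm h \<le> \<delta>" for h
    proof -
      have "(f (a(i := a i + h)) - f a) / h - D = (f (a(i := a i + h)) - f a - D * h) / h"
        using h by (simp add: field_simps)
      then have "padic_norm ((f (a(i := a i + h)) - f a) / h - D) \<le> (e / 2 * padic_norm h) / padic_norm h"
        using \<delta>(2)[OF h(2)] by (simp only: padic_norm_divide divide_right_mono padic_norm_nonneg)
      also have "\<dots> < e" using h e by simp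
      finally show ?thesis .
    qed
    then show "\<exists>d>0. \<forall>x\<in>UNIV. x \<noteq> 0 \<and> padic_norm (x - 0) < d \<longrightarrow>
        padic_norm ((f (a(i := a i + x)) - f a) / x - D) < e"
      using \<delta>(1) by (intro exI[of _ \<delta>]) simp
  qed
qed

text \<open>The real number \<open>s\<close> stands for the maximum norm of \<open>x - a\<close>, which has no sensible value for \<open>d = 0\<close>.\<close>

definition frechet :: "nat \<Rightarrow> ((nat \<Rightarrow> 'p::prime_card padic) \<Rightarrow> 'p padic) \<Rightarrow> (nat \<Rightarrow> 'p padic) \<Rightarrow>
    (nat \<Rightarrow> 'p padic) \<Rightarrow> bool" where
  "frechet d f a D \<longleftrightarrow> a \<in> padic_space d \<and> (\<forall>e>0. \<exists>r>0. \<forall>s. 0 \<le> s \<longrightarrow> s \<le> r \<longrightarrow> (\<forall>x\<in>polydisc d a s.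
     padic_norm (f x - f a - (\<Sum>i<d. D i * (x i - a i))) \<le> e * s))"

lemma frechet_partial_deriv:
  assumes f: "frechet d f a D" and i: "i < d"
  shows "partial_deriv i f a = D i"
proof (rule partial_deriv_eqI)
  fix e :: real assume "e > 0"
  then obtain r where r: "r > 0" "\<And>s x. 0 \<le> s \<Longrightarrow> s \<le> r \<Longrightarrow> x \<in> polydisc d a s \<Longrightarrow>
     padic_norm (f x - f a - (\<Sum>i<d. D i * (x i - a i))) \<le> e * s"
    using f unfolding frechet_def by meson
  have a: "a \<in> padic_space d" using f by (simp add: frechet_def)
  have "padic_norm (f (a(i := a i + h)) - f a - D i * h) \<le> e * padic_norm h" if h: "padic_norm h \<le> r" for h
  proof -
    have "a(i := a i + h) \<in> polydisc d a (padic_norm h)"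
      by (rule polydisc_upd) (use a i in \<open>auto intro: polydisc_center\<close>)
    from r(2)[OF _ h this] have "padic_norm (f (a(i := a i + h)) - f a -
        (\<Sum>j<d. D j * ((a(i := a i + h)) j - a j))) \<le> e * padic_norm h" by simp
    moreover have "(\<Sum>j<d. D j * ((a(i := a i + h)) j - a j)) = (\<Sum>j<d. if j = i then D i * h else 0)"
      by (rule sum.cong) auto
    ultimately show ?thesis using i by simp
  qed
  then show "\<exists>\<delta>>0. \<forall>h. padic_norm h \<le> \<delta> \<longrightarrow> padic_norm (f (a(i := a i + h)) - f a - D i * h) \<le> e * padic_norm h"
    using r(1) by blast
qed

lemma frechet_cong:
  assumes f: "frechet d f a D" and r: "r > 0" and eq: "\<And>x. x \<in> polydisc d a r \<Longrightarrow> f x = g x"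
  shows "frechet d g a D"
  unfolding frechet_def
proof (intro conjI allI impI)
  show a: "a \<in> padic_space d" using f by (simp add: frechet_def)
  fix e :: real assume "e > 0"
  then obtain r' where r': "r' > 0" "\<And>s x. 0 \<le> s \<Longrightarrow> s \<le> r' \<Longrightarrow> x \<in> polydisc d a s \<Longrightarrow>
     padic_norm (f x - f a - (\<Sum>i<d. D i * (x i - a i))) \<le> e * s"
    using f unfolding frechet_def by meson
  have "padic_norm (g x - g a - (\<Sum>i<d. D i * (x i - a i))) \<le> e * s"
    if "0 \<le> s" "s \<le> min r r'" "x \<in> polydisc d a s" for s x
  proof -
    have "f x = g x" using that polydisc_mono[of s r d a] by (intro eq) auto
    moreover have "f a = g a" using polydisc_center[OF a, of r] r by (intro eq) auto
    ultimately show ?thesis using r'(2)[of s x] that by simp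
  qed
  then show "\<exists>r>0. \<forall>s. 0 \<le> s \<longrightarrow> s \<le> r \<longrightarrow> (\<forall>x\<in>polydisc d a s.
     padic_norm (g x - g a - (\<Sum>i<d. D i * (x i - a i))) \<le> e * s)"
    using r r'(1) by (intro exI[of _ "min r r'"]) auto
qed

section \<open>Termwise differentiation\<close>

definition deriv_coeff :: "nat \<Rightarrow> ((nat \<Rightarrow> nat) \<Rightarrow> 'p::prime_card padic) \<Rightarrow> (nat \<Rightarrow> nat) \<Rightarrow> 'p padic" where
  "deriv_coeff i C \<alpha> = of_nat (Suc (\<alpha> i)) * C (\<alpha>(i := Suc (\<alpha> i)))"

text \<open>The factor \<open>r\<close> on the left replaces the exponent \<open>n - 1\<close> on
  the right and spares the case \<open>n = 0\<close>. No factor \<open>n\<close> arises, by the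
  ultrametric inequality.\<close>

lemma power_diff_norm_le:
  fixes y h :: "'p::prime_card padic"
  assumes "padic_norm y \<le> r" "padic_norm h \<le> r"
  shows "r * padic_norm ((y + h) ^ n - y ^ n) \<le> padic_norm h * r ^ n"
proof (induction n)
  case (Suc n)
  have r: "r \<ge> 0" using assms(1) padic_norm_nonneg order_trans by blast
  have eq: "(y + h) ^ Suc n - y ^ Suc n = (y + h) * ((y + h) ^ n - y ^ n) + h * y ^ n"
    by (simp add: algebra_simps)
  have "padic_norm ((y + h) * ((y + h) ^ n - y ^ n)) \<le> r * padic_norm ((y + h) ^ n - y ^ n)"
    unfolding padic_norm_mult by (intro mult_right_mono padic_norm_add_le assms) simp
  also have "\<dots> \<le> padic_norm h * r ^ n" by (rule Suc)
  finally have 1: "padic_norm ((y + h) * ((y + h) ^ n - y ^ n)) \<le> padic_norm h * r ^ n" .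
  have 2: "padic_norm (h * y ^ n) \<le> padic_norm h * r ^ n"
    unfolding padic_norm_mult padic_norm_power by (intro mult_left_mono power_mono assms) auto
  show ?case
    using mult_left_mono[OF padic_norm_add_le[OF 1 2] r] unfolding eq by (simp add: mult_ac)
qed simp

text \<open>The first-order Taylor remainder of a power obeys a recursion: the next one is
  \<open>y\<close> times the previous one plus \<open>h * ((y + h) ^ n - y ^ n)\<close>. So
  induction needs only \<open>power_diff_norm_le\<close> and no binomial expansion.\<close>

lemma power_second_order:
  fixes y h :: "'p::prime_card padic"
  assumes "padic_norm y \<le> r" "padic_norm h \<le> r"
  shows "r\<^sup>2 * padic_norm ((y + h) ^ n - y ^ n - of_nat n * y ^ (n - 1) * h) \<le> (padic_norm h)\<^sup>2 * r ^ n"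
proof (induction n)
  case (Suc n)
  have r: "r \<ge> 0" using assms(1) padic_norm_nonneg order_trans by blast
  define E where "E = (y + h) ^ n - y ^ n - of_nat n * y ^ (n - 1) * h"
  define z where "z = of_nat n * y ^ (n - 1)"
  \<comment> \<open>For \<open>n = 0\<close> the truncated exponent \<open>n - 1\<close> is
    harmless, as the factor \<open>of_nat n\<close> vanishes.\<close>
  have yn: "of_nat n * y ^ n = y * z" by (cases n) (simp_all add: z_def)
  have E_z: "E = (y + h) ^ n - y ^ n - z * h" by (simp add: E_def z_def)
  have eq: "(y + h) ^ Suc n - y ^ Suc n - of_nat (Suc n) * y ^ (Suc n - 1) * h
      = y * E + h * ((y + h) ^ n - y ^ n)"
  proof -
    have "of_nat (Suc n) * y ^ (Suc n - 1) * h = y * z * h + h * y ^ n"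
      by (simp only: yn[symmetric]) (simp add: algebra_simps)
    then have "?thesis \<longleftrightarrow> (y + h) ^ Suc n - y ^ Suc n - (y * z * h + h * y ^ n) = y * E + h * ((y + h) ^ n - y ^ n)"
      by (simp only:)
    then show ?thesis unfolding E_z by (simp add: algebra_simps)
  qed
  have 1: "r\<^sup>2 * padic_norm (y * E) \<le> (padic_norm h)\<^sup>2 * r ^ Suc n"
  proof -
    have "r\<^sup>2 * padic_norm (y * E) = padic_norm y * (r\<^sup>2 * padic_norm E)" by (simp add: padic_norm_mult)
    also have "\<dots> \<le> r * ((padic_norm h)\<^sup>2 * r ^ n)"
      by (rule mult_mono[OF assms(1) Suc[folded E_def]]) (use r in auto)
    finally show ?thesis by (simp add: mult_ac)
  qed
  have 2: "r\<^sup>2 * padic_norm (h * ((y + h) ^ n - y ^ n)) \<le> (padic_norm h)\<^sup>2 * r ^ Suc n"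
  proof -
    have "r\<^sup>2 * padic_norm (h * ((y + h) ^ n - y ^ n)) = (padic_norm h * r) * (r * padic_norm ((y + h) ^ n - y ^ n))"
      by (simp add: padic_norm_mult power2_eq_square mult_ac)
    also have "\<dots> \<le> (padic_norm h * r) * (padic_norm h * r ^ n)"
      by (intro mult_left_mono power_diff_norm_le assms) (use r in simp)
    finally show ?thesis by (simp add: power2_eq_square mult_ac)
  qed
  have "padic_norm (y * E + h * ((y + h) ^ n - y ^ n)) \<le> max (padic_norm (y * E)) (padic_norm (h * ((y + h) ^ n - y ^ n)))"
    by (rule padic_norm_ultra)
  then have "r\<^sup>2 * padic_norm (y * E + h * ((y + h) ^ n - y ^ n)) \<le> r\<^sup>2 * max (padic_norm (y * E)) (padic_norm (h * ((y + h) ^ n - y ^ n)))"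
    by (intro mult_left_mono) auto
  then show ?case unfolding eq using 1 2 by (auto simp: max_def split: if_splits)
qed simp

text \<open>Differentiation multiplies coefficients by integers, of norm at most 1, and lowers the
  degree by one. The derivative thus converges with the same radius, at the price of a factor
  \<open>1 / r\<close>; the quadratic remainders of all terms have a common bound.\<close>

lemma pseries_partial_deriv:
  fixes f :: "(nat \<Rightarrow> 'p::prime_card padic) \<Rightarrow> 'p padic"
  assumes f: "pseries d a r C f" and i: "i < d"
  shows "pseries d a r (deriv_coeff i C) (partial_deriv i f)"
proof -
  let ?M = "multi_indices d"
  have a: "a \<in> padic_space d" and r: "r > 0" using f by (auto simp: pseries_def)
  obtain K where K: "K > 0" "\<And>\<alpha>. \<alpha> \<in> ?M \<Longrightarrow> padic_norm (C \<alpha>) * r ^ total_degree d \<alpha> \<le> K"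
    using pseries_bounded[OF f] by blast
  define h where "h \<alpha> = \<alpha>(i := Suc (\<alpha> i))" for \<alpha> :: "nat \<Rightarrow> nat"
  have h: "inj_on h ?M" "h ` ?M \<subseteq> ?M" "\<And>\<alpha>. total_degree d (h \<alpha>) = Suc (total_degree d \<alpha>)"
    using i by (auto simp: h_def inj_on_def fun_eq_iff total_degree_upd_Suc multi_indices_upd split: if_splits)
  have null: "null_on (\<lambda>\<alpha>. padic_norm (deriv_coeff i C \<alpha>) * r ^ total_degree d \<alpha>) ?M"
  proof -
    have "null_on (\<lambda>\<alpha>. padic_norm (C \<alpha>) * r ^ total_degree d \<alpha>) ?M" using f by (simp add: pseries_def)
    from null_on_cmult[OF null_on_inj[OF this h(1,2)], of "1 / r"] r
    have "null_on (\<lambda>\<alpha>. 1 / r * (padic_norm (C (h \<alpha>)) * r ^ total_degree d (h \<alpha>))) ?M" by simp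
    then show ?thesis
    proof (rule null_on_mono)
      fix \<alpha>
      have "padic_norm (deriv_coeff i C \<alpha>) \<le> padic_norm (C (h \<alpha>))"
        unfolding deriv_coeff_def padic_norm_mult h_def
        by (intro mult_left_le_one_le padic_norm_of_nat_le) auto
      then show "padic_norm (deriv_coeff i C \<alpha>) * r ^ total_degree d \<alpha> \<le> 1 / r * (padic_norm (C (h \<alpha>)) * r ^ total_degree d (h \<alpha>))"
        using r by (simp add: h(3) mult_right_mono)
    qed
  qed
  have "((\<lambda>\<alpha>. deriv_coeff i C \<alpha> * monomial d a \<alpha> x) has_sum partial_deriv i f x) ?M"
    if x: "x \<in> polydisc d a r" for x
  proof -
    have "(\<lambda>\<alpha>. deriv_coeff i C \<alpha> * monomial d a \<alpha> x) summable_on ?M"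
      by (rule padic_null_on_summable, rule null_on_mono[OF null])
         (use monomial_norm_le[OF x] r in \<open>auto simp: padic_norm_mult intro!: mult_left_mono\<close>)
    then obtain g where g: "((\<lambda>\<alpha>. deriv_coeff i C \<alpha> * monomial d a \<alpha> x) has_sum g) ?M"
      by (auto simp: summable_on_def)
    \<comment> \<open>\<open>P\<close> is the monomial without its \<open>i\<close>-th factor, which
      reduces the remainder to a power of the single variable \<open>y\<close>.\<close>
    define P where "P \<alpha> = (\<Prod>j\<in>{..<d} - {i}. (x j - a j) ^ \<alpha> j)" for \<alpha> :: "nat \<Rightarrow> nat"
    define y where "y = x i - a i"
    have y: "padic_norm y \<le> r" using x i by (simp add: polydisc_def y_def)
    have Pn: "padic_norm (P \<alpha>) * r ^ \<alpha> i \<le> r ^ total_degree d \<alpha>" for \<alpha>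
    proof -
      have "padic_norm (P \<alpha>) \<le> (\<Prod>j\<in>{..<d} - {i}. r ^ \<alpha> j)"
        unfolding P_def padic_norm_prod padic_norm_power
        by (rule prod_mono) (use x in \<open>auto simp: polydisc_def intro!: power_mono\<close>)
      then have "padic_norm (P \<alpha>) * r ^ \<alpha> i \<le> (\<Prod>j\<in>{..<d} - {i}. r ^ \<alpha> j) * r ^ \<alpha> i"
        using r by (intro mult_right_mono) auto
      also have "\<dots> = r ^ total_degree d \<alpha>"
        using i by (simp add: total_degree_def power_sum prod.remove[of "{..<d}" i] mult.commute)
      finally show ?thesis .
    qed
    have mon: "monomial d a \<alpha> (x(i := x i + t)) = (y + t) ^ \<alpha> i * P \<alpha>" for \<alpha> t
    proof -
      have "(\<Prod>j\<in>{..<d} - {i}. ((x(i := x i + t)) j - a j) ^ \<alpha> j) = P \<alpha>"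
        unfolding P_def by (rule prod.cong) auto
      then show ?thesis using i by (simp add: monomial_def prod.remove[of "{..<d}" i] y_def algebra_simps)
    qed
    have monx: "monomial d a \<alpha> x = y ^ \<alpha> i * P \<alpha>" for \<alpha>
      using mon[of \<alpha> 0] by simp
    \<comment> \<open>\<open>T \<alpha>\<close> is the derivative of the term with index
      \<open>\<alpha>\<close>. Reindexing along \<open>h\<close> omits only indices with
      \<open>\<alpha> i = 0\<close>, where \<open>T\<close> is zero.\<close>
    define T where "T \<alpha> = C \<alpha> * (of_nat (\<alpha> i) * y ^ (\<alpha> i - 1) * P \<alpha>)" for \<alpha>
    have Ph: "P (h \<alpha>) = P \<alpha>" for \<alpha> unfolding P_def h_def by (rule prod.cong) auto
    have "T (h \<alpha>) = deriv_coeff i C \<alpha> * monomial d a \<alpha> x" for \<alpha>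
      unfolding T_def Ph monx by (simp add: deriv_coeff_def h_def)
    with g have "((T \<circ> h) has_sum g) ?M" by (simp add: o_def)
    then have "(T has_sum g) (h ` ?M)" using has_sum_reindex[OF h(1)] by blast
    also have "?this \<longleftrightarrow> (T has_sum g) ?M"
    proof (rule has_sum_cong_neutral)
      fix \<alpha> assume \<alpha>: "\<alpha> \<in> ?M - h ` ?M"
      have "\<alpha> i = 0"
      proof (rule ccontr)
        assume "\<alpha> i \<noteq> 0"
        then have "\<alpha> = h (\<alpha>(i := \<alpha> i - 1))" by (auto simp: h_def fun_eq_iff)
        moreover have "\<alpha>(i := \<alpha> i - 1) \<in> ?M" using \<alpha> i by (intro multi_indices_upd) auto
        ultimately show False using \<alpha> by blast
      qed
      then show "T \<alpha> = 0" by (simp add: T_def)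
    qed (use h(2) in auto)
    finally have T: "(T has_sum g) ?M" .
    have est: "padic_norm (f (x(i := x i + t)) - f x - g * t) \<le> K / r\<^sup>2 * (padic_norm t)\<^sup>2"
      if t: "padic_norm t \<le> r" for t
    proof (rule padic_has_sum_norm_le)
      have "x(i := x i + t) \<in> polydisc d a r" by (rule polydisc_upd[OF x i t])
      then have "((\<lambda>\<alpha>. C \<alpha> * monomial d a \<alpha> (x(i := x i + t))) has_sum f (x(i := x i + t))) ?M"
        using f by (simp add: pseries_def)
      moreover have "((\<lambda>\<alpha>. C \<alpha> * monomial d a \<alpha> x) has_sum f x) ?M"
        using f x by (simp add: pseries_def)
      moreover have "((\<lambda>\<alpha>. T \<alpha> * t) has_sum g * t) ?M" using T by (rule has_sum_cmult_left)
      ultimately have "((\<lambda>\<alpha>. C \<alpha> * monomial d a \<alpha> (x(i := x i + t)) + - (C \<alpha> * monomial d a \<alpha> x) + - (T \<alpha> * t)) has_sum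
          f (x(i := x i + t)) + - f x + - (g * t)) ?M"
        by (intro has_sum_add) (simp_all add: has_sum_uminus)
      then show "((\<lambda>\<alpha>. C \<alpha> * monomial d a \<alpha> (x(i := x i + t)) + - (C \<alpha> * monomial d a \<alpha> x) + - (T \<alpha> * t)) has_sum
          f (x(i := x i + t)) - f x - g * t) ?M" by simp
      fix \<alpha> assume \<alpha>: "\<alpha> \<in> ?M"
      define E where "E = (y + t) ^ \<alpha> i - y ^ \<alpha> i - of_nat (\<alpha> i) * y ^ (\<alpha> i - 1) * t"
      have eq: "C \<alpha> * monomial d a \<alpha> (x(i := x i + t)) + - (C \<alpha> * monomial d a \<alpha> x) + - (T \<alpha> * t) = C \<alpha> * (E * P \<alpha>)"
        unfolding mon monx T_def E_def by (simp add: algebra_simps)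
      have "r\<^sup>2 * padic_norm (C \<alpha> * (E * P \<alpha>)) = (r\<^sup>2 * padic_norm E) * (padic_norm (C \<alpha>) * padic_norm (P \<alpha>))"
        by (simp add: padic_norm_mult)
      also have "\<dots> \<le> ((padic_norm t)\<^sup>2 * r ^ \<alpha> i) * (padic_norm (C \<alpha>) * padic_norm (P \<alpha>))"
        unfolding E_def by (intro mult_right_mono power_second_order y t) auto
      also have "\<dots> = (padic_norm t)\<^sup>2 * (padic_norm (C \<alpha>) * (padic_norm (P \<alpha>) * r ^ \<alpha> i))"
        by simp
      also have "\<dots> \<le> (padic_norm t)\<^sup>2 * (padic_norm (C \<alpha>) * r ^ total_degree d \<alpha>)"
        by (intro mult_left_mono Pn) auto
      also have "\<dots> \<le> (padic_norm t)\<^sup>2 * K"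
        by (intro mult_left_mono K \<alpha>) auto
      finally show "padic_norm (C \<alpha> * monomial d a \<alpha> (x(i := x i + t)) + - (C \<alpha> * monomial d a \<alpha> x) + - (T \<alpha> * t))
          \<le> K / r\<^sup>2 * (padic_norm t)\<^sup>2"
        unfolding eq using r by (simp add: field_simps)
    qed (use K r in auto)
    have "partial_deriv i f x = g"
    proof (rule partial_deriv_eqI)
      fix e :: real assume e: "e > 0"
      define \<delta> where "\<delta> = min r (e * r\<^sup>2 / K)"
      have \<delta>: "\<delta> > 0" "\<delta> \<le> r" "K / r\<^sup>2 * \<delta> \<le> e"
        using r e K by (auto simp: \<delta>_def min_def field_simps)
      have "padic_norm (f (x(i := x i + t)) - f x - g * t) \<le> e * padic_norm t" if t: "padic_norm t \<le> \<delta>" for t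
      proof -
        have "padic_norm (f (x(i := x i + t)) - f x - g * t) \<le> K / r\<^sup>2 * (padic_norm t)\<^sup>2"
          using est t \<delta> by simp
        also have "\<dots> = (K / r\<^sup>2 * padic_norm t) * padic_norm t" by (simp add: power2_eq_square)
        also have "\<dots> \<le> (K / r\<^sup>2 * \<delta>) * padic_norm t"
          using t K r by (intro mult_right_mono mult_left_mono) auto
        also have "\<dots> \<le> e * padic_norm t" using \<delta> by (intro mult_right_mono) auto
        finally show ?thesis .
      qed
      then show "\<exists>\<delta>>0. \<forall>t. padic_norm t \<le> \<delta> \<longrightarrow> padic_norm (f (x(i := x i + t)) - f x - g * t) \<le> e * padic_norm t"
        using \<delta>(1) by blast
    qed
    then show ?thesis using g by simp
  qed
  then show ?thesis using a r null by (simp add: pseries_def)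
qed

section \<open>Uniqueness of coefficients\<close>

lemma pseries_center:
  assumes "pseries d a r C f" shows "f a = C (\<lambda>_. 0)"
proof -
  have "a \<in> polydisc d a r" using assms by (intro polydisc_center) (auto simp: pseries_def)
  then have "((\<lambda>\<alpha>. C \<alpha> * monomial d a \<alpha> a) has_sum f a) (multi_indices d)"
    using assms by (simp add: pseries_def)
  moreover have "((\<lambda>\<alpha>. C \<alpha> * monomial d a \<alpha> a) has_sum C (\<lambda>_. 0)) (multi_indices d)"
  proof -
    have "((\<lambda>\<alpha>. C \<alpha> * monomial d a \<alpha> a) has_sum C (\<lambda>_. 0)) {\<lambda>_. 0}"
      by (rule has_sum_finiteI) auto
    also have "?this \<longleftrightarrow> ?thesis"
      by (rule has_sum_cong_neutral) (auto simp: monomial_center)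
    finally show ?thesis .
  qed
  ultimately show ?thesis by (rule has_sum_unique)
qed

lemma partial_deriv_zero:
  assumes "\<And>x. x \<in> polydisc d a r \<Longrightarrow> f x = 0" "r > 0" "i < d" "x \<in> polydisc d a r"
  shows "partial_deriv i f x = 0"
proof (rule partial_deriv_eqI)
  fix e :: real assume "e > 0"
  show "\<exists>\<delta>>0. \<forall>h. padic_norm h \<le> \<delta> \<longrightarrow> padic_norm (f (x(i := x i + h)) - f x - 0 * h) \<le> e * padic_norm h"
    using assms polydisc_upd[OF assms(4,3)] \<open>e > 0\<close> by (intro exI[of _ r]) auto
qed

text \<open>Induction on the degree over all series at once. The constant coefficient is the value
  at the centre; any other is, up to a positive integer factor, a coefficient of lower degree of a
  partial derivative, which again vanishes on the polydisc.\<close>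

lemma pseries_zero:
  assumes "pseries d a r C f" "\<And>x. x \<in> polydisc d a r \<Longrightarrow> f x = 0" "\<alpha> \<in> multi_indices d"
  shows "C \<alpha> = 0"
  using assms
proof (induction "total_degree d \<alpha>" arbitrary: C f \<alpha>)
  case 0
  then have "\<alpha> = (\<lambda>_. 0)" using total_degree_eq_0 by metis
  moreover have "a \<in> polydisc d a r" using 0(2) by (intro polydisc_center) (auto simp: pseries_def)
  ultimately show ?case using pseries_center[OF 0(2)] 0(3) by simp
next
  case (Suc n)
  then have "\<alpha> \<noteq> (\<lambda>_. 0)" by (metis total_degree_eq_0 nat.distinct(1))
  then obtain i where i: "\<alpha> i \<noteq> 0" by auto
  have id: "i < d" using i Suc(5) unfolding multi_indices_def by (metis (mono_tags) mem_Collect_eq not_le)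
  define \<beta> where "\<beta> = \<alpha>(i := \<alpha> i - 1)"
  have \<beta>: "\<beta> \<in> multi_indices d" unfolding \<beta>_def using Suc(5) id by (rule multi_indices_upd)
  have \<alpha>: "\<alpha> = \<beta>(i := Suc (\<beta> i))" using i by (auto simp: \<beta>_def fun_eq_iff)
  have "n = total_degree d \<beta>" using Suc(2) total_degree_upd_Suc[OF id, of \<beta>] \<alpha> by simp
  moreover have "pseries d a r (deriv_coeff i C) (partial_deriv i f)" by (rule pseries_partial_deriv[OF Suc(3) id])
  moreover have "partial_deriv i f x = 0" if "x \<in> polydisc d a r" for x
    by (rule partial_deriv_zero[OF Suc(4) _ id that]) (use Suc(3) in \<open>auto simp: pseries_def\<close>)
  ultimately have "deriv_coeff i C \<beta> = 0" using \<beta> Suc(1) by blast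
  \<comment> \<open>The integer factor can be cancelled because the characteristic is zero.\<close>
  then have "of_nat (Suc (\<beta> i)) * C \<alpha> = 0" unfolding deriv_coeff_def \<alpha> by simp
  then show ?case by (simp only: mult_eq_0_iff of_nat_eq_0_iff) simp
qed

lemma pseries_diff:
  assumes "pseries d a r C f" "pseries d a r C' g"
  shows "pseries d a r (\<lambda>\<alpha>. C \<alpha> - C' \<alpha>) (\<lambda>x. f x - g x)"
  unfolding pseries_def
proof (intro conjI ballI)
  let ?M = "multi_indices d"
  have r: "r > 0" using assms by (simp add: pseries_def)
  show "null_on (\<lambda>\<alpha>. padic_norm (C \<alpha> - C' \<alpha>) * r ^ total_degree d \<alpha>) ?M"
    unfolding null_on_def
  proof (intro allI impI)
    fix e :: real assume "e > 0"
    then have "finite ({\<alpha>\<in>?M. padic_norm (C \<alpha>) * r ^ total_degree d \<alpha> > e} \<union> {\<alpha>\<in>?M. padic_norm (C' \<alpha>) * r ^ total_degree d \<alpha> > e})" (is "finite ?S")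
      using assms by (auto simp: pseries_def null_on_def)
    moreover have "{\<alpha>\<in>?M. padic_norm (C \<alpha> - C' \<alpha>) * r ^ total_degree d \<alpha> > e} \<subseteq> ?S"
    proof -
      have "padic_norm (C \<alpha> - C' \<alpha>) * r ^ total_degree d \<alpha> \<le> e"
        if "padic_norm (C \<alpha>) * r ^ total_degree d \<alpha> \<le> e" "padic_norm (C' \<alpha>) * r ^ total_degree d \<alpha> \<le> e" for \<alpha>
        using that r padic_norm_diff_le[of "C \<alpha>" "e / r ^ total_degree d \<alpha>" "C' \<alpha>"] by (simp add: field_simps)
      then show ?thesis by (auto simp: not_le[symmetric])
    qed
    ultimately show "finite {\<alpha>\<in>?M. padic_norm (C \<alpha> - C' \<alpha>) * r ^ total_degree d \<alpha> > e}" by (rule finite_subset[rotated])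
  qed
  fix x assume x: "x \<in> polydisc d a r"
  have "((\<lambda>\<alpha>. C \<alpha> * monomial d a \<alpha> x + - (C' \<alpha> * monomial d a \<alpha> x)) has_sum (f x + - g x)) ?M"
    using assms x by (intro has_sum_add) (auto simp: pseries_def has_sum_uminus)
  then show "((\<lambda>\<alpha>. (C \<alpha> - C' \<alpha>) * monomial d a \<alpha> x) has_sum (f x - g x)) ?M"
    by (simp add: algebra_simps)
qed (use assms in \<open>auto simp: pseries_def\<close>)

text \<open>Converts the closedness of a one-form, an identity between functions, into relations
  between coefficients.\<close>

lemma pseries_unique:
  assumes "pseries d a r C f" "pseries d a r C' g" "\<And>x. x \<in> polydisc d a r \<Longrightarrow> f x = g x" "\<alpha> \<in> multi_indices d"
  shows "C \<alpha> = C' \<alpha>"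
  using pseries_zero[OF pseries_diff[OF assms(1,2)] _ assms(4)] assms(3) by simp

text \<open>Both mixed derivatives are sums of the same series, since the index shifts in different
  directions commute.\<close>

lemma pseries_partial_deriv_commute:
  assumes f: "pseries d a r C f" and ij: "i < d" "j < d" and x: "x \<in> polydisc d a r"
  shows "partial_deriv i (partial_deriv j f) x = partial_deriv j (partial_deriv i f) x"
proof (cases "i = j")
  case False
  have eq: "deriv_coeff i (deriv_coeff j C) = deriv_coeff j (deriv_coeff i C)"
  proof
    fix \<alpha>
    have "\<alpha>(i := Suc (\<alpha> i), j := Suc (\<alpha> j)) = \<alpha>(j := Suc (\<alpha> j), i := Suc (\<alpha> i))"
      by (rule fun_upd_twist[OF False])
    then show "deriv_coeff i (deriv_coeff j C) \<alpha> = deriv_coeff j (deriv_coeff i C) \<alpha>"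
      using False by (simp add: deriv_coeff_def del: of_nat_Suc)
  qed
  have "((\<lambda>\<alpha>. deriv_coeff i (deriv_coeff j C) \<alpha> * monomial d a \<alpha> x) has_sum partial_deriv i (partial_deriv j f) x) (multi_indices d)"
    using pseries_partial_deriv[OF pseries_partial_deriv[OF f ij(2)] ij(1)] x by (simp add: pseries_def)
  moreover have "((\<lambda>\<alpha>. deriv_coeff i (deriv_coeff j C) \<alpha> * monomial d a \<alpha> x) has_sum partial_deriv j (partial_deriv i f) x) (multi_indices d)"
    unfolding eq using pseries_partial_deriv[OF pseries_partial_deriv[OF f ij(1)] ij(2)] x by (simp add: pseries_def)
  ultimately show ?thesis by (rule has_sum_unique)
qed simp

section \<open>Expansion to first order\<close>

text \<open>Once the constant and linear terms are removed, only total degrees of at least 2 remain,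
  and on the polydisc of radius \<open>s\<close> these contribute at most
  \<open>K * (s / r)\<^sup>2\<close>.\<close>

lemma pseries_frechet_center:
  assumes f: "pseries d a r C f"
  shows "frechet d f a (\<lambda>i. partial_deriv i f a)"
proof -
  let ?M = "multi_indices d"
  have a: "a \<in> padic_space d" and r: "r > 0" using f by (auto simp: pseries_def)
  obtain K where K: "K > 0" "\<And>\<alpha>. \<alpha> \<in> ?M \<Longrightarrow> padic_norm (C \<alpha>) * r ^ total_degree d \<alpha> \<le> K"
    using pseries_bounded[OF f] by blast
  define u where "u i = (\<lambda>j. if j = i then Suc 0 else 0)" for i :: nat
  have D: "partial_deriv i f a = C (u i)" if "i < d" for i
    using pseries_center[OF pseries_partial_deriv[OF f that]]
    by (simp add: deriv_coeff_def u_def fun_upd_def)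
  have mu: "monomial d a (u i) x = x i - a i" if "i < d" for i x
  proof -
    have "monomial d a (u i) x = (\<Prod>j<d. if j = i then x j - a j else 1)"
      unfolding monomial_def u_def by (rule prod.cong) auto
    then show ?thesis using that by simp
  qed
  \<comment> \<open>The indices of total degree at most 1: zero and the unit indices
    \<open>u i\<close>, whose coefficients are the partial derivatives at \<open>a\<close>.\<close>
  define F where "F = insert (\<lambda>_. 0) (u ` {..<d})"
  have F: "finite F" "F \<subseteq> ?M" by (auto simp: F_def u_def multi_indices_def)
  have inj: "inj_on u {..<d}" by (auto simp: inj_on_def u_def fun_eq_iff split: if_splits)
  have nu: "(\<lambda>_. 0) \<notin> u ` {..<d}"
  proof
    assume "(\<lambda>_. 0) \<in> u ` {..<d}"
    then obtain i where "(\<lambda>_. 0) = u i" by auto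
    from fun_cong[OF this, of i] show False by (simp add: u_def)
  qed
  have deg: "total_degree d \<alpha> \<ge> 2" if \<alpha>: "\<alpha> \<in> ?M - F" for \<alpha>
  proof -
    have "\<alpha> \<noteq> (\<lambda>_. 0)" using \<alpha> by (auto simp: F_def)
    then obtain i where i: "\<alpha> i \<noteq> 0" by auto
    have id: "i < d" using i \<alpha> unfolding multi_indices_def by (metis (mono_tags) DiffD1 mem_Collect_eq not_le)
    have "\<alpha> \<noteq> u i" using \<alpha> id by (auto simp: F_def)
    then obtain j where j: "\<alpha> j \<noteq> u i j" by auto
    have jd: "j < d" using j id \<alpha> unfolding multi_indices_def u_def
      by (metis (mono_tags) DiffD1 mem_Collect_eq not_le)
    show ?thesis
    proof (cases "j = i")
      case True
      then have "\<alpha> i \<ge> 2" using i j by (simp add: u_def)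
      also have "\<alpha> i \<le> total_degree d \<alpha>" unfolding total_degree_def using id by (intro member_le_sum) auto
      finally show ?thesis .
    next
      case False
      then have "\<alpha> i \<ge> 1" "\<alpha> j \<ge> 1" using i j by (auto simp: u_def)
      moreover have "(\<Sum>k\<in>{i, j}. \<alpha> k) \<le> total_degree d \<alpha>"
        unfolding total_degree_def using id jd by (intro sum_mono2) auto
      ultimately show ?thesis using False by auto
    qed
  qed
  have est: "padic_norm (f x - f a - (\<Sum>i<d. partial_deriv i f a * (x i - a i))) \<le> K * (s / r)\<^sup>2"
    if s: "0 \<le> s" "s \<le> r" and x: "x \<in> polydisc d a s" for s x
  proof (rule padic_has_sum_norm_le)
    have "((\<lambda>\<alpha>. C \<alpha> * monomial d a \<alpha> x) has_sum f x) ?M"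
      using f x polydisc_mono[OF s(2), of d a] by (auto simp: pseries_def)
    moreover have "((\<lambda>\<alpha>. C \<alpha> * monomial d a \<alpha> x) has_sum (\<Sum>\<alpha>\<in>F. C \<alpha> * monomial d a \<alpha> x)) F"
      by (rule has_sum_finiteI[OF F(1) refl])
    ultimately have "((\<lambda>\<alpha>. C \<alpha> * monomial d a \<alpha> x) has_sum (f x - (\<Sum>\<alpha>\<in>F. C \<alpha> * monomial d a \<alpha> x))) (?M - F)"
      by (rule has_sum_Diff[OF _ _ F(2)])
    moreover have "(\<Sum>\<alpha>\<in>F. C \<alpha> * monomial d a \<alpha> x) = f a + (\<Sum>i<d. partial_deriv i f a * (x i - a i))"
      unfolding F_def using nu inj by (simp add: sum.reindex pseries_center[OF f] D mu)
    ultimately show "((\<lambda>\<alpha>. C \<alpha> * monomial d a \<alpha> x) has_sum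
        (f x - f a - (\<Sum>i<d. partial_deriv i f a * (x i - a i)))) (?M - F)"
      by (simp add: algebra_simps)
    fix \<alpha> assume \<alpha>: "\<alpha> \<in> ?M - F"
    define n where "n = total_degree d \<alpha>"
    have n: "n \<ge> 2" using deg[OF \<alpha>] by (simp add: n_def)
    have "padic_norm (C \<alpha> * monomial d a \<alpha> x) \<le> padic_norm (C \<alpha>) * s ^ n"
      unfolding padic_norm_mult n_def by (intro mult_left_mono monomial_norm_le x s) simp
    also have "\<dots> = (padic_norm (C \<alpha>) * r ^ n) * (s / r) ^ n" using r by (simp add: power_divide)
    also have "\<dots> \<le> K * (s / r) ^ 2"
      using K \<alpha> n s r by (intro mult_mono power_decreasing) (auto simp: n_def)
    finally show "padic_norm (C \<alpha> * monomial d a \<alpha> x) \<le> K * (s / r)\<^sup>2" .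
  qed (use K s r in auto)
  show ?thesis
    unfolding frechet_def
  proof (intro conjI a allI impI)
    fix e :: real assume e: "e > 0"
    define \<rho> where "\<rho> = min r (e * r\<^sup>2 / K)"
    have \<rho>: "\<rho> > 0" "\<rho> \<le> r" "K / r\<^sup>2 * \<rho> \<le> e"
      using r e K by (auto simp: \<rho>_def min_def field_simps)
    have "padic_norm (f x - f a - (\<Sum>i<d. partial_deriv i f a * (x i - a i))) \<le> e * s"
      if s: "0 \<le> s" "s \<le> \<rho>" and x: "x \<in> polydisc d a s" for s x
    proof -
      have "padic_norm (f x - f a - (\<Sum>i<d. partial_deriv i f a * (x i - a i))) \<le> K * (s / r)\<^sup>2"
        by (rule est) (use s \<rho> x in auto)
      also have "\<dots> = (K / r\<^sup>2 * s) * s" by (simp add: power2_eq_square power_divide)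
      also have "\<dots> \<le> (K / r\<^sup>2 * \<rho>) * s"
        using s K r by (intro mult_right_mono mult_left_mono) auto
      also have "\<dots> \<le> e * s" using \<rho> s by (intro mult_right_mono) auto
      finally show ?thesis .
    qed
    then show "\<exists>r>0. \<forall>s. 0 \<le> s \<longrightarrow> s \<le> r \<longrightarrow> (\<forall>x\<in>polydisc d a s.
      padic_norm (f x - f a - (\<Sum>i<d. partial_deriv i f a * (x i - a i))) \<le> e * s)"
      using \<rho>(1) by blast
  qed
qed

text \<open>Differentiability away from the centre follows from that at the centre, because every
  point of the polydisc is a centre.\<close>

lemma tate_frechet:
  assumes f: "tate d a r B f" and x: "x \<in> polydisc d a r"
  shows "frechet d f x (\<lambda>i. partial_deriv i f x)"
  using tate_recentre[OF assms] unfolding tate_def by (auto intro: pseries_frechet_center)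

lemma tate_partial_deriv:
  assumes f: "tate d a r B f" and i: "i < d"
  shows "\<exists>B'. tate d a r B' (partial_deriv i f)"
  using pseries_tate[OF pseries_partial_deriv[OF _ i]] f unfolding tate_def by blast

lemma tate_partial_deriv_commute:
  assumes "tate d a r B f" "i < d" "j < d" "x \<in> polydisc d a r"
  shows "partial_deriv i (partial_deriv j f) x = partial_deriv j (partial_deriv i f) x"
  using assms pseries_partial_deriv_commute unfolding tate_def by blast

section \<open>Derivatives and the chain rule\<close>

text \<open>Takes the minimum of finitely many radii; this works for every \<open>P\<close> that
  passes to smaller radii.\<close>

lemma common_radius:
  assumes "\<And>j. j < (e::nat) \<Longrightarrow> \<exists>r>0. P j (r::real)" "\<And>j r s. P j r \<Longrightarrow> 0 < s \<Longrightarrow> s \<le> r \<Longrightarrow> P j s"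
  shows "\<exists>r>0. \<forall>j<e. P j r"
  using assms(1)
proof (induction e)
  case (Suc e)
  obtain r where r: "r > 0" "\<And>j. j < e \<Longrightarrow> P j r" using Suc by (meson less_SucI)
  obtain r' where r': "r' > 0" "P e r'" using Suc(2)[of e] by auto
  have "P j (min r r')" if "j < Suc e" for j
    using r r' that assms(2) by (cases "j = e") (metis less_SucE min.cobounded1 min.cobounded2 min_less_iff_conj)+
  then show ?case using r(1) r'(1) by (intro exI[of _ "min r r'"]) auto
qed (auto intro: exI[of _ 1])

lemma frechet_lipschitz:
  assumes "frechet d f a D"
  shows "\<exists>L>0. \<exists>r>0. \<forall>s. 0 \<le> s \<longrightarrow> s \<le> r \<longrightarrow> (\<forall>x\<in>polydisc d a s. padic_norm (f x - f a) \<le> L * s)"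
proof -
  \<comment> \<open>The summand 1 pays for the remainder, taken with error factor 1, and keeps
    \<open>L\<close> positive when \<open>d = 0\<close>.\<close>
  define L where "L = 1 + (\<Sum>i<d. padic_norm (D i))"
  have L: "L \<ge> 1" by (simp add: L_def sum_nonneg)
  have Di: "padic_norm (D i) \<le> L" if "i < d" for i
  proof -
    have "padic_norm (D i) \<le> (\<Sum>i<d. padic_norm (D i))" using that by (intro member_le_sum) auto
    then show ?thesis by (simp add: L_def)
  qed
  obtain r where r: "r > 0" "\<And>s x. 0 \<le> s \<Longrightarrow> s \<le> r \<Longrightarrow> x \<in> polydisc d a s \<Longrightarrow>
     padic_norm (f x - f a - (\<Sum>i<d. D i * (x i - a i))) \<le> 1 * s"
    using assms unfolding frechet_def by (meson zero_less_one)
  have "padic_norm (f x - f a) \<le> L * s" if "0 \<le> s" "s \<le> r" "x \<in> polydisc d a s" for s x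
  proof -
    have "padic_norm (\<Sum>i<d. D i * (x i - a i)) \<le> L * s"
      by (rule padic_norm_sum_le)
        (use that L Di in \<open>auto simp: padic_norm_mult polydisc_def intro!: mult_mono\<close>)
    moreover have "s \<le> L * s" using L that(1) mult_right_mono[of 1 L s] by simp
    then have "padic_norm (f x - f a - (\<Sum>i<d. D i * (x i - a i))) \<le> L * s"
      using r(2)[OF that] by simp
    ultimately show ?thesis using padic_norm_add_le by fastforce
  qed
  then show ?thesis using r(1) L by (intro exI[of _ L]) auto
qed

lemma frechet_const: "a \<in> padic_space d \<Longrightarrow> frechet d (\<lambda>_. c) a (\<lambda>_. 0)"
  by (auto simp: frechet_def intro!: exI[of _ 1])

lemma frechet_add:
  assumes "frechet d f a D" "frechet d g a E"
  shows "frechet d (\<lambda>x. f x + g x) a (\<lambda>i. D i + E i)"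
  unfolding frechet_def
proof (intro conjI allI impI)
  fix e :: real assume e: "e > 0"
  obtain r where r: "r > 0" "\<And>s x. 0 \<le> s \<Longrightarrow> s \<le> r \<Longrightarrow> x \<in> polydisc d a s \<Longrightarrow>
     padic_norm (f x - f a - (\<Sum>i<d. D i * (x i - a i))) \<le> e * s"
    using assms(1) e unfolding frechet_def by meson
  obtain r' where r': "r' > 0" "\<And>s x. 0 \<le> s \<Longrightarrow> s \<le> r' \<Longrightarrow> x \<in> polydisc d a s \<Longrightarrow>
     padic_norm (g x - g a - (\<Sum>i<d. E i * (x i - a i))) \<le> e * s"
    using assms(2) e unfolding frechet_def by meson
  have "padic_norm (f x + g x - (f a + g a) - (\<Sum>i<d. (D i + E i) * (x i - a i))) \<le> e * s"
    if "0 \<le> s" "s \<le> min r r'" "x \<in> polydisc d a s" for s x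
  proof -
    have "f x + g x - (f a + g a) - (\<Sum>i<d. (D i + E i) * (x i - a i)) =
       (f x - f a - (\<Sum>i<d. D i * (x i - a i))) + (g x - g a - (\<Sum>i<d. E i * (x i - a i)))"
      by (simp add: distrib_right sum.distrib)
    then show ?thesis using padic_norm_add_le[OF r(2)[of s x] r'(2)[of s x]] that by (simp only: min.bounded_iff)
  qed
  then show "\<exists>r>0. \<forall>s. 0 \<le> s \<longrightarrow> s \<le> r \<longrightarrow> (\<forall>x\<in>polydisc d a s.
     padic_norm (f x + g x - (f a + g a) - (\<Sum>i<d. (D i + E i) * (x i - a i))) \<le> e * s)"
    using r(1) r'(1) by (intro exI[of _ "min r r'"]) auto
qed (use assms in \<open>simp add: frechet_def\<close>)

lemma frechet_sum:
  assumes "a \<in> padic_space d" "\<And>k. k \<in> A \<Longrightarrow> frechet d (f k) a (D k)"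
  shows "frechet d (\<lambda>x. \<Sum>k\<in>A. f k x) a (\<lambda>i. \<Sum>k\<in>A. D k i)"
  using assms(2)
proof (induction A rule: infinite_finite_induct)
  case (insert k A)
  then show ?case using frechet_add[of d "f k" a "D k"] by simp
qed (use frechet_const[OF assms(1)] in simp_all)

lemma frechet_mult:
  assumes "frechet d f a D" "frechet d g a E"
  shows "frechet d (\<lambda>x. f x * g x) a (\<lambda>i. D i * g a + f a * E i)"
  unfolding frechet_def
proof (intro conjI allI impI)
  fix e :: real assume e: "e > 0"
  obtain L r1 where L: "L > 0" "r1 > 0" "\<And>s x. 0 \<le> s \<Longrightarrow> s \<le> r1 \<Longrightarrow> x \<in> polydisc d a s \<Longrightarrow>
      padic_norm (f x - f a) \<le> L * s"
    using frechet_lipschitz[OF assms(1)] by blast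
  obtain L' r2 where L': "L' > 0" "r2 > 0" "\<And>s x. 0 \<le> s \<Longrightarrow> s \<le> r2 \<Longrightarrow> x \<in> polydisc d a s \<Longrightarrow>
      padic_norm (g x - g a) \<le> L' * s"
    using frechet_lipschitz[OF assms(2)] by blast
  define K where "K = 1 + padic_norm (f a) + padic_norm (g a)"
  have K: "K > 0" "padic_norm (f a) \<le> K" "padic_norm (g a) \<le> K"
    by (auto simp: K_def add_pos_nonneg)
  have eK: "e / K > 0" using e K by simp
  obtain r where r: "r > 0" "\<And>s x. 0 \<le> s \<Longrightarrow> s \<le> r \<Longrightarrow> x \<in> polydisc d a s \<Longrightarrow>
     padic_norm (f x - f a - (\<Sum>i<d. D i * (x i - a i))) \<le> e / K * s"
    using assms(1) eK unfolding frechet_def by meson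
  obtain r' where r': "r' > 0" "\<And>s x. 0 \<le> s \<Longrightarrow> s \<le> r' \<Longrightarrow> x \<in> polydisc d a s \<Longrightarrow>
     padic_norm (g x - g a - (\<Sum>i<d. E i * (x i - a i))) \<le> e / K * s"
    using assms(2) eK unfolding frechet_def by meson
  \<comment> \<open>The last bound makes the product of the two increments, which is of size
    \<open>L * L' * s\<^sup>2\<close>, at most \<open>e * s\<close>.\<close>
  define \<rho> where "\<rho> = min (min r r') (min (min r1 r2) (e / (L * L')))"
  have \<rho>: "\<rho> > 0" "\<rho> \<le> r" "\<rho> \<le> r'" "\<rho> \<le> r1" "\<rho> \<le> r2" "\<rho> \<le> e / (L * L')"
    using r(1) r'(1) L(1,2) L'(1,2) e by (auto simp: \<rho>_def)
  then have \<rho>LL: "\<rho> * (L * L') \<le> e"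
    using L(1) L'(1) by (simp add: pos_le_divide_eq)
  have "padic_norm (f x * g x - f a * g a - (\<Sum>i<d. (D i * g a + f a * E i) * (x i - a i))) \<le> e * s"
    if s: "0 \<le> s" "s \<le> \<rho>" and x: "x \<in> polydisc d a s" for s x
  proof -
    define F where "F = f x - f a - (\<Sum>i<d. D i * (x i - a i))"
    define G where "G = g x - g a - (\<Sum>i<d. E i * (x i - a i))"
    have eq: "f x * g x - f a * g a - (\<Sum>i<d. (D i * g a + f a * E i) * (x i - a i)) =
        (g a * F + f a * G) + (f x - f a) * (g x - g a)"
    proof -
      have "(\<Sum>i<d. (D i * g a + f a * E i) * (x i - a i)) =
          g a * (\<Sum>i<d. D i * (x i - a i)) + f a * (\<Sum>i<d. E i * (x i - a i))"
        by (simp add: sum_distrib_left sum.distrib[symmetric] algebra_simps)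
      then show ?thesis by (simp add: F_def G_def algebra_simps)
    qed
    have "padic_norm (g a * F) \<le> K * (e / K * s)"
      unfolding padic_norm_mult F_def using K s \<rho> x by (intro mult_mono r(2)) auto
    moreover have "padic_norm (f a * G) \<le> K * (e / K * s)"
      unfolding padic_norm_mult G_def using K s \<rho> x by (intro mult_mono r'(2)) auto
    moreover have "padic_norm ((f x - f a) * (g x - g a)) \<le> e * s"
    proof -
      have "padic_norm ((f x - f a) * (g x - g a)) \<le> (L * s) * (L' * s)"
        unfolding padic_norm_mult using L L' s \<rho> x by (intro mult_mono L(3) L'(3)) auto
      also have "\<dots> = (s * (L * L')) * s" by simp
      also have "\<dots> \<le> (\<rho> * (L * L')) * s" using s L L' by (intro mult_right_mono) auto
      also have "\<dots> \<le> e * s" using \<rho>LL s by (intro mult_right_mono) auto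
      finally show ?thesis .
    qed
    ultimately show ?thesis unfolding eq using K by (intro padic_norm_add_le) auto
  qed
  then show "\<exists>r>0. \<forall>s. 0 \<le> s \<longrightarrow> s \<le> r \<longrightarrow> (\<forall>x\<in>polydisc d a s.
     padic_norm (f x * g x - f a * g a - (\<Sum>i<d. (D i * g a + f a * E i) * (x i - a i))) \<le> e * s)"
    using \<rho>(1) by (intro exI[of _ \<rho>]) auto
qed (use assms in \<open>simp add: frechet_def\<close>)

text \<open>A polydisc contains only points of \<open>padic_space e\<close>, and the estimate for
  \<open>f\<close> holds only there. The premise with \<open>\<rho>\<close> supplies this
  membership, which the coordinates below \<open>e\<close> do not control.\<close>

lemma frechet_compose:
  assumes f: "frechet e f (g a) D"
    and g: "\<And>j. j < e \<Longrightarrow> frechet d (\<lambda>x. g x j) a (E j)"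
    and \<rho>: "\<rho> > 0" "\<And>x. x \<in> polydisc d a \<rho> \<Longrightarrow> g x \<in> padic_space e" and a: "a \<in> padic_space d"
  shows "frechet d (\<lambda>x. f (g x)) a (\<lambda>i. \<Sum>j<e. D j * E j i)"
  unfolding frechet_def
proof (intro conjI a allI impI)
  fix \<epsilon> :: real assume \<epsilon>: "\<epsilon> > 0"
  have "\<exists>L r. L > 0 \<and> r > 0 \<and> (\<forall>s. 0 \<le> s \<longrightarrow> s \<le> r \<longrightarrow> (\<forall>x\<in>polydisc d a s. padic_norm (g x j - g a j) \<le> L * s))" if "j < e" for j
    using frechet_lipschitz[OF g[OF that]] by blast
  then obtain L r where Lr: "\<And>j. j < e \<Longrightarrow> L j > 0" "\<And>j. j < e \<Longrightarrow> r j > 0"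
     "\<And>j s x. j < e \<Longrightarrow> 0 \<le> s \<Longrightarrow> s \<le> r j \<Longrightarrow> x \<in> polydisc d a s \<Longrightarrow> padic_norm (g x j - g a j) \<le> L j * s"
    by metis
  \<comment> \<open>\<open>M\<close> is a common Lipschitz constant of the coordinates of
    \<open>g\<close>, so \<open>f\<close> is used with error \<open>\<epsilon> / M\<close> at radius
    \<open>M * s\<close>. The bound \<open>N\<close> on the derivatives of \<open>f\<close> likewise
    calls for error \<open>\<epsilon> / N\<close> in \<open>g\<close>.\<close>
  define M where "M = 1 + (\<Sum>j<e. L j)"
  have M: "M > 0" "\<And>j. j < e \<Longrightarrow> L j \<le> M"
  proof -
    show "M > 0" unfolding M_def using Lr(1) by (intro add_pos_nonneg sum_nonneg) (auto intro: less_imp_le)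
    fix j assume "j < e"
    then have "L j \<le> (\<Sum>j<e. L j)" using Lr(1) by (intro member_le_sum) (auto intro: less_imp_le)
    then show "L j \<le> M" by (simp add: M_def)
  qed
  define N where "N = 1 + (\<Sum>j<e. padic_norm (D j))"
  have N: "N > 0" "\<And>j. j < e \<Longrightarrow> padic_norm (D j) \<le> N"
  proof -
    show "N > 0" unfolding N_def by (intro add_pos_nonneg sum_nonneg) auto
    fix j assume "j < e"
    then have "padic_norm (D j) \<le> (\<Sum>j<e. padic_norm (D j))" by (intro member_le_sum) auto
    then show "padic_norm (D j) \<le> N" by (simp add: N_def)
  qed
  have "\<epsilon> / M > 0" using \<epsilon> M by simp
  then obtain r1 where r1: "r1 > 0" "\<And>s y. 0 \<le> s \<Longrightarrow> s \<le> r1 \<Longrightarrow> y \<in> polydisc e (g a) s \<Longrightarrow>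
     padic_norm (f y - f (g a) - (\<Sum>j<e. D j * (y j - g a j))) \<le> \<epsilon> / M * s"
    using f unfolding frechet_def by meson
  have eN: "\<epsilon> / N > 0" using \<epsilon> N by simp
  have "\<exists>r2>0. \<forall>j<e. \<forall>s. 0 \<le> s \<longrightarrow> s \<le> r2 \<longrightarrow> (\<forall>x\<in>polydisc d a s.
     padic_norm (g x j - g a j - (\<Sum>i<d. E j i * (x i - a i))) \<le> \<epsilon> / N * s)"
  proof (rule common_radius)
    fix j assume "j < e"
    from g[OF this] eN show "\<exists>r2>0. \<forall>s. 0 \<le> s \<longrightarrow> s \<le> r2 \<longrightarrow> (\<forall>x\<in>polydisc d a s.
     padic_norm (g x j - g a j - (\<Sum>i<d. E j i * (x i - a i))) \<le> \<epsilon> / N * s)"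
      unfolding frechet_def by blast
  qed (meson order_trans)
  then obtain r2 where r2: "r2 > 0" "\<And>j s x. j < e \<Longrightarrow> 0 \<le> s \<Longrightarrow> s \<le> r2 \<Longrightarrow> x \<in> polydisc d a s \<Longrightarrow>
     padic_norm (g x j - g a j - (\<Sum>i<d. E j i * (x i - a i))) \<le> \<epsilon> / N * s" by blast
  have "\<exists>r3>0. \<forall>j<e. r3 \<le> r j" by (rule common_radius) (use Lr(2) in auto)
  then obtain r3 where r3: "r3 > 0" "\<And>j. j < e \<Longrightarrow> r3 \<le> r j" by blast
  define \<tau> where "\<tau> = min (min \<rho> (r1 / M)) (min r2 r3)"
  have \<tau>: "\<tau> > 0" "\<tau> \<le> \<rho>" "\<tau> \<le> r1 / M" "\<tau> \<le> r2" "\<tau> \<le> r3"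
    using \<rho>(1) r1(1) r2(1) r3(1) M(1) by (auto simp: \<tau>_def)
  have "padic_norm (f (g x) - f (g a) - (\<Sum>i<d. (\<Sum>j<e. D j * E j i) * (x i - a i))) \<le> \<epsilon> * s"
    if s: "0 \<le> s" "s \<le> \<tau>" and x: "x \<in> polydisc d a s" for s x
  proof -
    have gx: "g x \<in> polydisc e (g a) (M * s)"
      unfolding polydisc_def
    proof (intro CollectI conjI allI impI)
      show "g x \<in> padic_space e" using x s \<tau> polydisc_mono[of s \<rho> d a] by (intro \<rho>(2)) auto
      fix j assume j: "j < e"
      have "padic_norm (g x j - g a j) \<le> L j * s" by (rule Lr(3)[OF j s(1) _ x]) (use s \<tau> r3(2)[OF j] in linarith)
      also have "\<dots> \<le> M * s" using M(2)[OF j] s by (intro mult_right_mono) auto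
      finally show "padic_norm (g x j - g a j) \<le> M * s" .
    qed
    have "s \<le> r1 / M" using s \<tau>(3) by linarith
    then have "M * s \<le> r1" using M(1) by (simp add: field_simps)
    then have "padic_norm (f (g x) - f (g a) - (\<Sum>j<e. D j * (g x j - g a j))) \<le> \<epsilon> / M * (M * s)"
      using M(1) s by (intro r1(2) gx) auto
    then have 1: "padic_norm (f (g x) - f (g a) - (\<Sum>j<e. D j * (g x j - g a j))) \<le> \<epsilon> * s"
      using M by simp
    have 2: "padic_norm (\<Sum>j<e. D j * (g x j - g a j - (\<Sum>i<d. E j i * (x i - a i)))) \<le> \<epsilon> * s"
    proof (rule padic_norm_sum_le)
      fix j assume "j \<in> {..<e}"
      then have "padic_norm (D j * (g x j - g a j - (\<Sum>i<d. E j i * (x i - a i)))) \<le> N * (\<epsilon> / N * s)"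
        unfolding padic_norm_mult using N s \<tau> x by (intro mult_mono r2(2)) auto
      then show "padic_norm (D j * (g x j - g a j - (\<Sum>i<d. E j i * (x i - a i)))) \<le> \<epsilon> * s" using N by simp
    qed (use \<epsilon> s in simp)
    have "(\<Sum>i<d. (\<Sum>j<e. D j * E j i) * (x i - a i)) = (\<Sum>j<e. D j * (\<Sum>i<d. E j i * (x i - a i)))"
      unfolding sum_distrib_left sum_distrib_right by (subst sum.swap) (simp add: mult.assoc)
    then have "f (g x) - f (g a) - (\<Sum>i<d. (\<Sum>j<e. D j * E j i) * (x i - a i)) =
       (f (g x) - f (g a) - (\<Sum>j<e. D j * (g x j - g a j))) +
       (\<Sum>j<e. D j * (g x j - g a j - (\<Sum>i<d. E j i * (x i - a i))))"
      by (simp add: right_diff_distrib sum_subtractf)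
    then show ?thesis using padic_norm_add_le[OF 1 2] by (simp only:)
  qed
  then show "\<exists>r>0. \<forall>s. 0 \<le> s \<longrightarrow> s \<le> r \<longrightarrow> (\<forall>x\<in>polydisc d a s.
     padic_norm (f (g x) - f (g a) - (\<Sum>i<d. (\<Sum>j<e. D j * E j i) * (x i - a i))) \<le> \<epsilon> * s)"
    using \<tau>(1) by blast
qed

section \<open>Topology of the coordinate space\<close>

text \<open>A basic open set of the product restricts only finitely many coordinates, and those from
  \<open>d\<close> on agree with \<open>a\<close> because both points vanish there.\<close>

lemma openin_padic_space_polydisc:
  assumes "openin (top_of_set (padic_space d)) V" "a \<in> V"
  shows "\<exists>r>0. polydisc d a r \<subseteq> V"
proof -
  obtain T where T: "open T" "V = padic_space d \<inter> T" using assms(1) by (auto simp: openin_open)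
  then have "openin (product_topology (\<lambda>_. euclidean) UNIV) T" "a \<in> T"
    using assms(2) by (auto simp: open_fun_def)
  then obtain X where X: "a \<in> Pi\<^sub>E UNIV X" "\<And>i. open (X i)" "Pi\<^sub>E UNIV X \<subseteq> T" "finite {i. X i \<noteq> UNIV}"
    by (force dest: product_topology_open_contains_basis)
  obtain N where N: "\<And>i. i \<ge> N \<Longrightarrow> X i = UNIV"
    using X(4) unfolding finite_nat_set_iff_bounded_le by (metis (mono_tags) mem_Collect_eq not_less_eq_eq)
  have "\<exists>r>0. \<forall>i<N. \<forall>y. padic_norm (y - a i) \<le> r \<longrightarrow> y \<in> X i"
  proof (rule common_radius)
    fix i
    have "a i \<in> X i" using X(1) by auto
    then obtain e where "e > 0" "cball (a i) e \<subseteq> X i" using X(2) open_contains_cball by blast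
    then show "\<exists>r>0. \<forall>y. padic_norm (y - a i) \<le> r \<longrightarrow> y \<in> X i"
      by (intro exI[of _ e]) (auto simp: dist_padic_def padic_norm_minus_commute subset_eq)
  qed auto
  then obtain r where r: "r > 0" "\<And>i y. i < N \<Longrightarrow> padic_norm (y - a i) \<le> r \<Longrightarrow> y \<in> X i" by blast
  have "x \<in> V" if x: "x \<in> polydisc d a r" for x
  proof -
    have "x i \<in> X i" for i
    proof (cases "i < N")
      case True
      have "padic_norm (x i - a i) \<le> r"
      proof (cases "i < d")
        case False
        then show ?thesis using x assms(2) T(2) r(1) by (simp add: polydisc_def padic_space_def)
      qed (use x in \<open>simp add: polydisc_def\<close>)
      then show ?thesis using r(2) True by blast
    qed (use N in auto)
    then have "x \<in> T" using X(3) by auto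
    then show ?thesis using x T(2) by (simp add: polydisc_def)
  qed
  then show ?thesis using r(1) by blast
qed

lemma openin_padic_space_iff:
  "openin (top_of_set (padic_space d)) V \<longleftrightarrow>
    V \<subseteq> padic_space d \<and> (\<forall>a\<in>V. \<exists>r>0. polydisc d a r \<subseteq> (V :: (nat \<Rightarrow> 'p::prime_card padic) set))"
proof
  assume V: "openin (top_of_set (padic_space d)) V"
  show "V \<subseteq> padic_space d \<and> (\<forall>a\<in>V. \<exists>r>0. polydisc d a r \<subseteq> V)"
    using openin_padic_space_polydisc[OF V] openin_imp_subset[OF V] by simp
next
  assume V: "V \<subseteq> padic_space d \<and> (\<forall>a\<in>V. \<exists>r>0. polydisc d a r \<subseteq> V)"
  show "openin (top_of_set (padic_space d)) V"
  proof (rule openin_subopen[THEN iffD2], intro ballI)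
    fix a assume "a \<in> V"
    then obtain r where r: "r > 0" "polydisc d a r \<subseteq> V" using V by blast
    define T where "T = (\<Inter>i<d. (\<lambda>x :: nat \<Rightarrow> 'p padic. x i) -` ball (a i) r)"
    have "open T"
      unfolding T_def
      by (intro open_INT ballI finite_lessThan open_vimage open_ball continuous_on_product_coordinates)
    then have "openin (top_of_set (padic_space d)) (padic_space d \<inter> T)" by (rule openin_open_Int)
    moreover have "a \<in> padic_space d \<inter> T"
    proof
      show "a \<in> padic_space d" using \<open>a \<in> V\<close> V by blast
      show "a \<in> T" using r(1) by (simp add: T_def)
    qed
    moreover have "padic_space d \<inter> T \<subseteq> polydisc d a r"
      by (auto simp: T_def polydisc_def dist_padic_def padic_norm_minus_commute intro: less_imp_le)
    ultimately show "\<exists>T. openin (top_of_set (padic_space d)) T \<and> a \<in> T \<and> T \<subseteq> V"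
      using r(2) by (meson subset_trans)
  qed
qed

lemma openin_polydisc: "r > 0 \<Longrightarrow> openin (top_of_set (padic_space d)) (polydisc d a r)"
  unfolding openin_padic_space_iff using polydisc_recentre by (fastforce simp: polydisc_in_space)

text \<open>By Tychonoff: a polydisc is a product of compact balls and, from index \<open>d\<close>
  on, of the singleton of 0.\<close>

lemma compact_polydisc:
  fixes a :: "nat \<Rightarrow> 'p::prime_card padic"
  shows "compact (polydisc d a r)"
proof -
  define K where "K i = (if i < d then cball (a i) r else {0})" for i
  have "polydisc d a r = Pi\<^sub>E UNIV K"
    by (auto simp: polydisc_def padic_space_def K_def dist_padic_def padic_norm_minus_commute Pi_iff
        split: if_splits)
  moreover have "compactin (product_topology (\<lambda>_. euclidean) UNIV) (Pi\<^sub>E UNIV K)"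
    unfolding compactin_PiE by (auto simp: K_def padic_compact_cball)
  ultimately show ?thesis by (simp add: euclidean_product_topology)
qed

section \<open>Analytic functions and the Poincare lemma\<close>

text \<open>The pointwise form of \<open>analytic_scalar\<close>, free of a domain.
  \<open>analytic_scalar_imp_analytic_at\<close> and \<open>analytic_scalarI\<close> translate
  between the two.\<close>

definition analytic_at :: "nat \<Rightarrow> ((nat \<Rightarrow> 'p::prime_card padic) \<Rightarrow> 'p padic) \<Rightarrow> (nat \<Rightarrow> 'p padic) \<Rightarrow> bool" where
  "analytic_at d f a \<longleftrightarrow> (\<exists>r B. tate d a r B f)"

lemma analytic_at_common_radius:
  assumes "\<And>j. j < (e::nat) \<Longrightarrow> analytic_at d (f j) a"
  shows "\<exists>r>0. \<forall>j<e. \<exists>B. tate d a r B (f j)"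
proof (rule common_radius)
  show "\<exists>r>0. \<exists>B. tate d a r B (f j)" if "j < e" for j
    using assms[OF that] tate_radius unfolding analytic_at_def by blast
qed (use tate_shrink in blast)

lemma analytic_at_nearby: "tate d a r B f \<Longrightarrow> b \<in> polydisc d a r \<Longrightarrow> analytic_at d f b"
  unfolding analytic_at_def using tate_recentre by blast

lemma analytic_at_cong:
  assumes "analytic_at d f a" "s > 0" "\<And>x. x \<in> polydisc d a s \<Longrightarrow> f x = g x"
  shows "analytic_at d g a"
proof -
  obtain r B where f: "tate d a r B f" using assms(1) unfolding analytic_at_def by blast
  define t where "t = min r s"
  have t: "t > 0" "t \<le> r" "t \<le> s" using assms(2) tate_radius[OF f] by (auto simp: t_def)
  have "tate d a t B g"
    by (rule tate_cong[OF tate_shrink[OF f t(1,2)]]) (use assms(3) polydisc_mono[OF t(3), of d a] in auto)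
  then show ?thesis unfolding analytic_at_def by blast
qed

lemma analytic_at_frechet:
  assumes "analytic_at d f a" shows "frechet d f a (\<lambda>i. partial_deriv i f a)"
proof -
  obtain r B where f: "tate d a r B f" using assms(1) unfolding analytic_at_def by blast
  show ?thesis
    by (rule tate_frechet[OF f polydisc_center]) (use tate_radius[OF f] tate_center[OF f] in auto)
qed

lemma analytic_at_const: "a \<in> padic_space d \<Longrightarrow> analytic_at d (\<lambda>_. c) a"
  unfolding analytic_at_def using tate_const[of a d 1 c] by (intro exI) auto

lemma analytic_at_add:
  assumes "analytic_at d f a" "analytic_at d g a" shows "analytic_at d (\<lambda>x. f x + g x) a"
proof -
  obtain r B where f: "tate d a r B f" using assms(1) unfolding analytic_at_def by blast
  obtain s B' where g: "tate d a s B' g" using assms(2) unfolding analytic_at_def by blast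
  have pos: "r > 0" "s > 0" using tate_radius[OF f] tate_radius[OF g] .
  have "tate d a (min r s) (max B B') (\<lambda>x. f x + g x)"
    by (intro tate_add tate_mono[OF tate_shrink[OF f]] tate_mono[OF tate_shrink[OF g]]) (use pos in auto)
  then show ?thesis unfolding analytic_at_def by blast
qed

lemma analytic_at_mult:
  assumes "analytic_at d f a" "analytic_at d g a" shows "analytic_at d (\<lambda>x. f x * g x) a"
proof -
  obtain r B where f: "tate d a r B f" using assms(1) unfolding analytic_at_def by blast
  obtain s B' where g: "tate d a s B' g" using assms(2) unfolding analytic_at_def by blast
  have pos: "r > 0" "s > 0" using tate_radius[OF f] tate_radius[OF g] .
  have "tate d a (min r s) (B * B') (\<lambda>x. f x * g x)"
    by (intro tate_mult tate_shrink[OF f] tate_shrink[OF g]) (use pos in auto)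
  then show ?thesis unfolding analytic_at_def by blast
qed

lemma analytic_at_sum:
  assumes "a \<in> padic_space d" "\<And>k. k \<in> A \<Longrightarrow> analytic_at d (f k) a"
  shows "analytic_at d (\<lambda>x. \<Sum>k\<in>A. f k x) a"
  using assms(2)
  by (induction A rule: infinite_finite_induct) (auto intro: analytic_at_add analytic_at_const[OF assms(1)])

text \<open>Without its constant term the series gains a factor \<open>\<rho> / r\<close> in Gauss
  norm. Composition requires the inner function to be small in this norm, not only in its
  values.\<close>

lemma tate_small:
  assumes f: "tate d a r B f" and s: "s > 0"
  shows "\<exists>\<rho>>0. \<rho> \<le> r \<and> tate d a \<rho> s (\<lambda>x. f x - f a)"
proof -
  let ?M = "multi_indices d"
  have a: "a \<in> padic_space d" and r: "r > 0" using tate_center[OF f] tate_radius[OF f] .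
  have "tate d a r (max B (padic_norm (- f a))) (\<lambda>x. f x + - f a)"
    by (intro tate_add tate_mono[OF f] tate_mono[OF tate_const[OF a r]]) auto
  then obtain C where C: "pseries d a r C (\<lambda>x. f x + - f a)" unfolding tate_def by blast
  obtain K where K: "K > 0" "\<And>\<alpha>. \<alpha> \<in> ?M \<Longrightarrow> padic_norm (C \<alpha>) * r ^ total_degree d \<alpha> \<le> K"
    using pseries_bounded[OF C] by blast
  have C0: "C (\<lambda>_. 0) = 0" using pseries_center[OF C] by simp
  define \<rho> where "\<rho> = min r (s * r / K)"
  have \<rho>: "\<rho> > 0" "\<rho> \<le> r" "\<rho> \<le> s * r / K" using r s K by (auto simp: \<rho>_def)
  have \<rho>': "K * (\<rho> / r) \<le> s" using \<rho>(3) K(1) r by (simp add: field_simps)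
  have "padic_norm (C \<alpha>) * \<rho> ^ total_degree d \<alpha> \<le> s" if \<alpha>: "\<alpha> \<in> ?M" for \<alpha>
  proof (cases "\<alpha> = (\<lambda>_. 0)")
    case False
    then obtain n where n: "total_degree d \<alpha> = Suc n" using total_degree_eq_0[OF \<alpha>] by (cases "total_degree d \<alpha>") auto
    have "padic_norm (C \<alpha>) * \<rho> ^ total_degree d \<alpha> = (padic_norm (C \<alpha>) * r ^ total_degree d \<alpha>) * (\<rho> / r) ^ total_degree d \<alpha>"
      using r by (simp add: power_divide)
    also have "\<dots> \<le> K * (\<rho> / r)"
    proof (rule mult_mono)
      have "(\<rho> / r) ^ total_degree d \<alpha> \<le> (\<rho> / r) ^ 1"
        using \<rho> r n by (intro power_decreasing) auto
      then show "(\<rho> / r) ^ total_degree d \<alpha> \<le> \<rho> / r" by simp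
    qed (use K \<alpha> \<rho> r in auto)
    finally show ?thesis using \<rho>' by simp
  qed (use C0 s in simp)
  then have "tate d a \<rho> s (\<lambda>x. f x + - f a)"
    using pseries_shrink[OF C \<rho>(1,2)] unfolding tate_def by blast
  then show ?thesis using \<rho> by auto
qed

lemma analytic_at_compose:
  assumes f: "analytic_at e f (g a)" and g: "\<And>j. j < e \<Longrightarrow> analytic_at d (\<lambda>x. g x j) a"
    and a: "a \<in> padic_space d" and t: "t > 0" "\<And>x. x \<in> polydisc d a t \<Longrightarrow> g x \<in> padic_space e"
  shows "analytic_at d (\<lambda>x. f (g x)) a"
proof -
  obtain s K where f: "tate e (g a) s K f" using f unfolding analytic_at_def by blast
  have s: "s > 0" using tate_radius[OF f] .
  have "\<exists>r>0. \<forall>j<e. tate d a r s (\<lambda>x. g x j - g a j)"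
  proof (rule common_radius)
    fix j assume "j < e"
    then obtain r B where "tate d a r B (\<lambda>x. g x j)" using g unfolding analytic_at_def by blast
    from tate_small[OF this s] show "\<exists>r>0. tate d a r s (\<lambda>x. g x j - g a j)" by blast
  qed (rule tate_shrink)
  then obtain r where r: "r > 0" "\<And>j. j < e \<Longrightarrow> tate d a r s (\<lambda>x. g x j - g a j)" by blast
  define \<rho> where "\<rho> = min r t"
  have \<rho>: "\<rho> > 0" "\<rho> \<le> r" "\<rho> \<le> t" using r t by (auto simp: \<rho>_def)
  have "tate d a \<rho> K (\<lambda>x. f (g x))"
    by (rule tate_compose[OF f a \<rho>(1) tate_shrink[OF r(2) \<rho>(1,2)]])
      (use t(2) polydisc_mono[OF \<rho>(3), of d a] in auto)
  then show ?thesis unfolding analytic_at_def by blast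
qed

section \<open>Comparison with the definition of analytic functions\<close>

text \<open>The definition gives convergence at points only. Convergence at a point \<open>y\<close>
  whose first \<open>d\<close> coordinates all differ from those of \<open>a\<close> by the same
  element \<open>t\<close> is exactly decay of the coefficients for the radius
  \<open>padic_norm t\<close>.\<close>

lemma analytic_scalar_imp_analytic_at:
  fixes f :: "(nat \<Rightarrow> 'p::prime_card padic) \<Rightarrow> 'p padic"
  assumes f: "analytic_scalar d f U" and a: "a \<in> U"
  shows "analytic_at d f a"
proof -
  let ?M = "multi_indices d"
  obtain V C where V: "openin (top_of_set (padic_space d)) V" "a \<in> V"
    and C: "\<And>x. x \<in> V \<Longrightarrow> ((\<lambda>\<alpha>. C \<alpha> * (\<Prod>i<d. (x i - a i) ^ \<alpha> i)) has_sum f x) ?M"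
    using f a unfolding analytic_scalar_def by meson
  have ad: "a \<in> padic_space d" using V openin_imp_subset by blast
  obtain r where r: "r > 0" "polydisc d a r \<subseteq> V" using openin_padic_space_polydisc[OF V] by blast
  obtain k where k: "padic_norm ((of_nat CARD('p) :: 'p padic) ^ k) < r" "(of_nat CARD('p) :: 'p padic) ^ k \<noteq> 0"
    using padic_small_elem[where 'p='p, OF r(1)] by blast
  define t :: "'p padic" where "t = of_nat CARD('p) ^ k"
  define s where "s = padic_norm t"
  have s: "s > 0" "s \<le> r" using k unfolding s_def t_def by (simp_all add: less_imp_le)
  define y where "y i = (if i < d then a i + t else 0)" for i
  have "y \<in> polydisc d a s" by (auto simp: y_def polydisc_def padic_space_def s_def)
  then have "((\<lambda>\<alpha>. C \<alpha> * (\<Prod>i<d. (y i - a i) ^ \<alpha> i)) has_sum f y) ?M"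
    using C polydisc_mono[OF s(2), of d a] r(2) by blast
  then have "null_on (\<lambda>\<alpha>. padic_norm (C \<alpha> * (\<Prod>i<d. (y i - a i) ^ \<alpha> i))) ?M"
    by (intro padic_summable_null_on) (auto simp: summable_on_def)
  moreover have "padic_norm (C \<alpha> * (\<Prod>i<d. (y i - a i) ^ \<alpha> i)) = padic_norm (C \<alpha>) * s ^ total_degree d \<alpha>" for \<alpha>
    unfolding padic_norm_mult padic_norm_prod padic_norm_power total_degree_def power_sum
    by (intro arg_cong[where f = "\<lambda>z. padic_norm (C \<alpha>) * z"] prod.cong) (auto simp: y_def s_def)
  ultimately have "null_on (\<lambda>\<alpha>. padic_norm (C \<alpha>) * s ^ total_degree d \<alpha>) ?M" by simp
  then have "pseries d a s C f"
    unfolding pseries_def monomial_def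
    using C polydisc_mono[OF s(2), of d a] r(2) s(1) ad by blast
  then show ?thesis using pseries_tate unfolding analytic_at_def by blast
qed

lemma analytic_scalarI:
  assumes U: "openin (top_of_set (padic_space d)) U" and f: "\<And>a. a \<in> U \<Longrightarrow> analytic_at d f a"
  shows "analytic_scalar d f U"
  unfolding analytic_scalar_def
proof (intro conjI U ballI)
  fix a assume a: "a \<in> U"
  obtain r B where rB: "tate d a r B f" using f[OF a] unfolding analytic_at_def by blast
  obtain s where s: "s > 0" "polydisc d a s \<subseteq> U" using openin_padic_space_polydisc[OF U a] by blast
  define t where "t = min r s"
  have t: "t > 0" "t \<le> r" "t \<le> s" using s tate_radius[OF rB] by (auto simp: t_def)
  obtain C where C: "pseries d a t C f" using tate_shrink[OF rB t(1,2)] unfolding tate_def by blast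
  have "a \<in> polydisc d a t" using tate_center[OF rB] t by (intro polydisc_center) auto
  then show "\<exists>V C. openin (top_of_set (padic_space d)) V \<and> a \<in> V \<and> V \<subseteq> U \<and>
        (\<forall>x\<in>V. ((\<lambda>\<alpha>. C \<alpha> * (\<Prod>i<d. (x i - a i) ^ \<alpha> i)) has_sum f x) (multi_indices d))"
    using C openin_polydisc[OF t(1), of d a] polydisc_mono[OF t(3), of d a] s(2)
    unfolding pseries_def monomial_def by (intro exI[of _ "polydisc d a t"] exI[of _ C]) auto
qed

section \<open>The Poincare lemma\<close>

lemma finite_multi_indices: "finite {\<alpha> \<in> multi_indices d. total_degree d \<alpha> \<le> N}"
proof -
  have "finite {\<alpha> :: nat \<Rightarrow> nat. \<forall>i. (i \<in> {..<d} \<longrightarrow> \<alpha> i \<in> {..N}) \<and> (i \<notin> {..<d} \<longrightarrow> \<alpha> i = 0)}"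
    by (rule finite_set_of_finite_funs) auto
  moreover have "{\<alpha> \<in> multi_indices d. total_degree d \<alpha> \<le> N} \<subseteq>
      {\<alpha>. \<forall>i. (i \<in> {..<d} \<longrightarrow> \<alpha> i \<in> {..N}) \<and> (i \<notin> {..<d} \<longrightarrow> \<alpha> i = 0)}"
  proof -
    have "\<alpha> i \<le> N" if "total_degree d \<alpha> \<le> N" "i < d" for \<alpha> i
    proof -
      have "\<alpha> i \<le> total_degree d \<alpha>" unfolding total_degree_def using that by (intro member_le_sum) auto
      then show ?thesis using that by simp
    qed
    then show ?thesis by (auto simp: multi_indices_def)
  qed
  ultimately show ?thesis by (rule finite_subset[rotated])
qed

text \<open>There are finitely many multi-indices of bounded degree, so decay in the degree is decay
  along the multi-indices.\<close>

lemma null_on_total_degree: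
  assumes "(f :: nat \<Rightarrow> real) \<longlonglongrightarrow> 0"
  shows "null_on (\<lambda>\<alpha>. f (total_degree d \<alpha>)) (multi_indices d)"
  unfolding null_on_def
proof (intro allI impI)
  fix e :: real assume "e > 0"
  then obtain N where N: "\<And>n. n \<ge> N \<Longrightarrow> f n < e"
    using order_tendstoD(2)[OF assms, of e] by (auto simp: eventually_sequentially)
  have "{\<alpha> \<in> multi_indices d. f (total_degree d \<alpha>) > e} \<subseteq> {\<alpha> \<in> multi_indices d. total_degree d \<alpha> \<le> N}"
  proof
    fix \<alpha> assume \<alpha>: "\<alpha> \<in> {\<alpha> \<in> multi_indices d. f (total_degree d \<alpha>) > e}"
    then have "\<not> total_degree d \<alpha> \<ge> N" using N[of "total_degree d \<alpha>"] by auto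
    then show "\<alpha> \<in> {\<alpha> \<in> multi_indices d. total_degree d \<alpha> \<le> N}" using \<alpha> by simp
  qed
  then show "finite {\<alpha> \<in> multi_indices d. f (total_degree d \<alpha>) > e}"
    using finite_multi_indices by (rule finite_subset)
qed

text \<open>The primitive is the radial integral of \<open>\<Sum>j. x j * A j (t x)\<close> over \<open>0 \<le> t \<le> 1\<close>, taken term by term.
  Dividing by the degree \<open>n\<close> enlarges a coefficient by at most \<open>n\<close>, which the halved radius absorbs.\<close>

lemma pseries_poincare:
  fixes A :: "nat \<Rightarrow> (nat \<Rightarrow> 'p::prime_card padic) \<Rightarrow> 'p padic"
  assumes a: "a \<in> padic_space d" and r: "r > 0"
    and A: "\<And>j. j < d \<Longrightarrow> pseries d a r (C j) (A j)"
    and closed: "\<And>x i j. x \<in> polydisc d a r \<Longrightarrow> i < d \<Longrightarrow> j < d \<Longrightarrow> partial_deriv i (A j) x = partial_deriv j (A i) x"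
  shows "\<exists>H h. pseries d a (r / 2) H h \<and> (\<forall>i<d. \<forall>x\<in>polydisc d a (r / 2). partial_deriv i h x = A i x)"
proof -
  let ?M = "multi_indices d"
  have "\<exists>K>0. \<forall>j<d. \<forall>\<alpha>\<in>?M. padic_norm (C j \<alpha>) * r ^ total_degree d \<alpha> \<le> K"
  proof -
    have "\<forall>j<d. \<exists>K>0. \<forall>\<alpha>\<in>?M. padic_norm (C j \<alpha>) * r ^ total_degree d \<alpha> \<le> K"
      using pseries_bounded[OF A] by blast
    then obtain K where K: "\<And>j. j < d \<Longrightarrow> K j > 0"
       "\<And>j \<alpha>. j < d \<Longrightarrow> \<alpha> \<in> ?M \<Longrightarrow> padic_norm (C j \<alpha>) * r ^ total_degree d \<alpha> \<le> K j" by metis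
    have "K j \<le> 1 + (\<Sum>j<d. K j)" if "j < d" for j
    proof -
      have "K j \<le> (\<Sum>j<d. K j)" using that K(1) by (intro member_le_sum) (auto intro: less_imp_le)
      then show ?thesis by simp
    qed
    moreover have "1 + (\<Sum>j<d. K j) > 0" using K(1) by (intro add_pos_nonneg sum_nonneg) (auto intro: less_imp_le)
    ultimately show ?thesis using K(2) by (intro exI[of _ "1 + (\<Sum>j<d. K j)"]) (auto intro: order_trans)
  qed
  then obtain K where K: "K > 0" "\<And>j \<alpha>. j < d \<Longrightarrow> \<alpha> \<in> ?M \<Longrightarrow> padic_norm (C j \<alpha>) * r ^ total_degree d \<alpha> \<le> K"
    by blast
  define t where "t j \<beta> = (if \<beta> j > 0 then C j (\<beta>(j := \<beta> j - 1)) else 0)" for j and \<beta> :: "nat \<Rightarrow> nat"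
  \<comment> \<open>At degree 0 the quotient is 0, so the primitive vanishes at \<open>a\<close>.
    The numerator is the coefficient of the sum of the products of \<open>A j\<close> with the
    \<open>j\<close>-th coordinate.\<close>
  define H where "H \<beta> = (\<Sum>j<d. t j \<beta>) / of_nat (total_degree d \<beta>)" for \<beta>
  have t_bound: "padic_norm (t j \<beta>) * r ^ total_degree d \<beta> \<le> K * r" if "j < d" "\<beta> \<in> ?M" for j \<beta>
  proof (cases "\<beta> j > 0")
    case True
    define \<gamma> where "\<gamma> = \<beta>(j := \<beta> j - 1)"
    have \<gamma>: "\<gamma> \<in> ?M" unfolding \<gamma>_def using that by (intro multi_indices_upd)
    have "\<beta> = \<gamma>(j := Suc (\<gamma> j))" using True by (auto simp: \<gamma>_def)
    then have "total_degree d \<beta> = Suc (total_degree d \<gamma>)" using total_degree_upd_Suc[OF that(1)] by metis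
    moreover have "t j \<beta> = C j \<gamma>" using True by (simp add: t_def \<gamma>_def)
    ultimately show ?thesis using K(2)[OF that(1) \<gamma>] r by simp
  qed (use K r in \<open>simp add: t_def\<close>)
  have H_bound: "padic_norm (H \<beta>) * (r / 2) ^ total_degree d \<beta> \<le> K * r * (real (total_degree d \<beta>) * (1 / 2) ^ total_degree d \<beta>)"
    if \<beta>: "\<beta> \<in> ?M" for \<beta>
  proof (cases "total_degree d \<beta> = 0")
    case False
    define n where "n = total_degree d \<beta>"
    have n: "n > 0" using False by (simp add: n_def)
    have rn: "r ^ n > 0" using r by simp
    have "padic_norm (\<Sum>j<d. t j \<beta>) \<le> K * r / r ^ n"
    proof (rule padic_norm_sum_le)
      fix j assume "j \<in> {..<d}"
      then show "padic_norm (t j \<beta>) \<le> K * r / r ^ n"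
        using t_bound[OF _ \<beta>, of j] rn by (simp add: pos_le_divide_eq n_def)
    qed (use K r in simp)
    moreover have "padic_norm (of_nat n :: 'p padic) \<ge> 1 / real n" by (rule padic_norm_of_nat_bound[OF n])
    moreover have "1 / real n > 0" using n by simp
    ultimately have "padic_norm (H \<beta>) \<le> (K * r / r ^ n) / (1 / real n)"
      unfolding H_def n_def[symmetric] padic_norm_divide using K r by (intro frac_le) auto
    then have "padic_norm (H \<beta>) * (r / 2) ^ n \<le> ((K * r / r ^ n) / (1 / real n)) * (r / 2) ^ n"
      using r by (intro mult_right_mono) auto
    also have "\<dots> = K * r * (real n * (1 / 2) ^ n)"
      using r by (simp add: power_divide)
    finally show ?thesis by (simp add: n_def)
  qed (simp add: H_def)
  have H_null: "null_on (\<lambda>\<beta>. padic_norm (H \<beta>) * (r / 2) ^ total_degree d \<beta>) ?M"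
  proof (rule null_on_mono[OF _ H_bound])
    have "(\<lambda>n. real n * (1 / 2) ^ n) \<longlonglongrightarrow> 0" using powser_times_n_limit_0[of "1 / 2 :: real"] by simp
    from tendsto_mult_left[OF this, of "K * r"]
    have "(\<lambda>n. K * r * (real n * (1 / 2) ^ n)) \<longlonglongrightarrow> 0" by simp
    then show "null_on (\<lambda>\<beta>. K * r * (real (total_degree d \<beta>) * (1 / 2) ^ total_degree d \<beta>)) ?M"
      by (rule null_on_total_degree)
  qed
  define h where "h x = infsum (\<lambda>\<beta>. H \<beta> * monomial d a \<beta> x) ?M" for x
  have h: "pseries d a (r / 2) H h"
    unfolding pseries_def
  proof (intro conjI ballI a H_null)
    show "r / 2 > 0" using r by simp
    fix x assume x: "x \<in> polydisc d a (r / 2)"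
    have "(\<lambda>\<beta>. H \<beta> * monomial d a \<beta> x) summable_on ?M"
      by (rule padic_null_on_summable, rule null_on_mono[OF H_null])
        (use monomial_norm_le[OF x] r in \<open>auto simp: padic_norm_mult intro!: mult_left_mono\<close>)
    then show "((\<lambda>\<beta>. H \<beta> * monomial d a \<beta> x) has_sum h x) ?M" unfolding h_def by (rule has_sum_infsum)
  qed
  \<comment> \<open>Closedness on the level of coefficients.\<close>
  have rel: "deriv_coeff i (C j) \<gamma> = deriv_coeff j (C i) \<gamma>" if "i < d" "j < d" "\<gamma> \<in> ?M" for i j \<gamma>
    by (rule pseries_unique[OF pseries_partial_deriv[OF A[OF that(2)] that(1)]
          pseries_partial_deriv[OF A[OF that(1)] that(2)] closed[OF _ that(1,2)] that(3)])
  have coef: "deriv_coeff i H \<beta> = C i \<beta>" if i: "i < d" and \<beta>: "\<beta> \<in> ?M" for i \<beta>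
  proof -
    define \<beta>' where "\<beta>' = \<beta>(i := Suc (\<beta> i))"
    have deg: "total_degree d \<beta>' = Suc (total_degree d \<beta>)" using i by (simp add: \<beta>'_def total_degree_upd_Suc)
    \<comment> \<open>Closedness trades \<open>C j\<close> for \<open>C i\<close> with the factor
      \<open>\<beta>' j\<close>. Summed over \<open>j\<close> these factors give the total degree of
      \<open>\<beta>'\<close>, which cancels the denominator of \<open>H\<close>.\<close>
    have trm: "of_nat (Suc (\<beta> i)) * t j \<beta>' = of_nat (if j = i then Suc (\<beta> i) else \<beta> j) * C i \<beta>" if j: "j < d" for j
    proof (cases "j = i")
      case True
      then show ?thesis by (simp add: t_def \<beta>'_def)
    next
      case False
      show ?thesis
      proof (cases "\<beta> j > 0")
        case True
        define \<gamma> where "\<gamma> = \<beta>(j := \<beta> j - 1)"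
        have \<gamma>: "\<gamma> \<in> ?M" unfolding \<gamma>_def using \<beta> j by (rule multi_indices_upd)
        have "\<gamma>(j := Suc (\<gamma> j)) = \<beta>" using True by (auto simp: \<gamma>_def)
        moreover have "\<gamma>(i := Suc (\<gamma> i)) = \<beta>'(j := \<beta>' j - 1)"
          using False by (auto simp: \<gamma>_def \<beta>'_def fun_eq_iff)
        moreover have "\<gamma> i = \<beta> i" "Suc (\<gamma> j) = \<beta> j" using False True by (auto simp: \<gamma>_def)
        ultimately have "of_nat (Suc (\<beta> i)) * C j (\<beta>'(j := \<beta>' j - 1)) = of_nat (\<beta> j) * C i \<beta>"
          using rel[OF i j \<gamma>] unfolding deriv_coeff_def by (simp only:)
        moreover have "\<beta>' j > 0" using False True by (simp add: \<beta>'_def)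
        ultimately show ?thesis using False by (simp only: t_def if_True if_False)
      qed (use False in \<open>simp add: t_def \<beta>'_def\<close>)
    qed
    have "of_nat (Suc (\<beta> i)) * (\<Sum>j<d. t j \<beta>') = (\<Sum>j<d. of_nat (if j = i then Suc (\<beta> i) else \<beta> j) * C i \<beta>)"
      unfolding sum_distrib_left using trm by (intro sum.cong) auto
    also have "\<dots> = of_nat (\<Sum>j<d. if j = i then Suc (\<beta> i) else \<beta> j) * C i \<beta>"
      by (simp only: sum_distrib_right of_nat_sum)
    also have "(\<Sum>j<d. if j = i then Suc (\<beta> i) else \<beta> j) = total_degree d \<beta>'"
      unfolding total_degree_def \<beta>'_def by (rule sum.cong) auto
    finally have "of_nat (Suc (\<beta> i)) * (\<Sum>j<d. t j \<beta>') = of_nat (total_degree d \<beta>') * C i \<beta>" .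
    moreover have "(of_nat (total_degree d \<beta>') :: 'p padic) \<noteq> 0" unfolding deg by (simp only: of_nat_eq_0_iff)
    ultimately show ?thesis
      unfolding deriv_coeff_def \<beta>'_def[symmetric] H_def by (simp add: field_simps)
  qed
  have "partial_deriv i h x = A i x" if i: "i < d" and x: "x \<in> polydisc d a (r / 2)" for i x
  proof -
    have "((\<lambda>\<alpha>. deriv_coeff i H \<alpha> * monomial d a \<alpha> x) has_sum partial_deriv i h x) ?M"
      using pseries_partial_deriv[OF h i] x by (simp add: pseries_def)
    also have "?this \<longleftrightarrow> ((\<lambda>\<alpha>. C i \<alpha> * monomial d a \<alpha> x) has_sum partial_deriv i h x) ?M"
      by (rule has_sum_cong) (simp add: coef[OF i])
    finally have "((\<lambda>\<alpha>. C i \<alpha> * monomial d a \<alpha> x) has_sum partial_deriv i h x) ?M" .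
    moreover have "((\<lambda>\<alpha>. C i \<alpha> * monomial d a \<alpha> x) has_sum A i x) ?M"
      using A[OF i] x polydisc_mono[of "r / 2" r d a] r by (auto simp: pseries_def)
    ultimately show ?thesis by (rule has_sum_unique)
  qed
  then show ?thesis using h by blast
qed

lemma tate_poincare:
  fixes A :: "nat \<Rightarrow> (nat \<Rightarrow> 'p::prime_card padic) \<Rightarrow> 'p padic"
  assumes a: "a \<in> padic_space d" and r: "r > 0"
    and A: "\<And>j. j < d \<Longrightarrow> \<exists>B. tate d a r B (A j)"
    and closed: "\<And>x i j. x \<in> polydisc d a r \<Longrightarrow> i < d \<Longrightarrow> j < d \<Longrightarrow> partial_deriv i (A j) x = partial_deriv j (A i) x"
  shows "\<exists>h B. tate d a (r / 2) B h \<and> (\<forall>i<d. \<forall>x\<in>polydisc d a (r / 2). partial_deriv i h x = A i x)"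
proof -
  have "\<exists>C. pseries d a r C (A j)" if "j < d" for j
    using A[OF that] unfolding tate_def by blast
  then obtain C where "\<And>j. j < d \<Longrightarrow> pseries d a r (C j) (A j)" by metis
  from pseries_poincare[OF a r this closed] show ?thesis using pseries_tate by blast
qed

section \<open>The momentum one-form in coordinates\<close>

text \<open>The layout of the coordinates of a product chart, see \<open>cmap_prod_chart\<close>.
  The second dimension is no parameter, as \<open>x\<close> vanishes beyond it anyway.\<close>

definition concat_coords :: "nat \<Rightarrow> (nat \<Rightarrow> 'p::prime_card padic) \<Rightarrow> (nat \<Rightarrow> 'p padic) \<Rightarrow> nat \<Rightarrow> 'p padic" where
  "concat_coords k y x i = (if i < k then y i else x (i - k))"

lemma concat_coords_in_space: "x \<in> padic_space d \<Longrightarrow> concat_coords k y x \<in> padic_space (k + d)"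
  by (auto simp: concat_coords_def padic_space_def)

lemma concat_coords_in_polydisc:
  "y \<in> polydisc k y0 r \<Longrightarrow> x \<in> polydisc d x0 r \<Longrightarrow> concat_coords k y x \<in> polydisc (k + d) (concat_coords k y0 x0) r"
  by (auto simp: polydisc_def concat_coords_in_space) (auto simp: concat_coords_def)

lemma concat_coords_eq_iff:
  assumes "y \<in> padic_space k" "y' \<in> padic_space k"
  shows "concat_coords k y x = concat_coords k y' x' \<longleftrightarrow> y = y' \<and> x = x'"
proof
  assume eq: "concat_coords k y x = concat_coords k y' x'"
  have "y i = y' i" for i
    using fun_cong[OF eq, of i] assms by (cases "i < k") (auto simp: concat_coords_def padic_space_def)
  moreover have "x i = x' i" for i
    using fun_cong[OF eq, of "k + i"] by (simp add: concat_coords_def)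
  ultimately show "y = y' \<and> x = x'" by auto
qed auto

text \<open>No differentiability is involved: both sides are the same \<open>Lim\<close>
  expression.\<close>

lemma partial_deriv_concat_coords_left:
  assumes "a < k"
  shows "partial_deriv a f (concat_coords k y x) = partial_deriv a (\<lambda>y. f (concat_coords k y x)) y"
proof -
  have "(concat_coords k y x)(a := concat_coords k y x a + h) = concat_coords k (y(a := y a + h)) x" for h
    using assms by (auto simp: concat_coords_def fun_eq_iff)
  then show ?thesis unfolding partial_deriv_def by simp
qed

lemma partial_deriv_concat_coords_right:
  "partial_deriv (k + i) f (concat_coords k y x) = partial_deriv i (\<lambda>x. f (concat_coords k y x)) x"
proof -
  have "(concat_coords k y x)(k + i := concat_coords k y x (k + i) + h) = concat_coords k y (x(i := x i + h))" for h
    by (auto simp: concat_coords_def fun_eq_iff)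
  then show ?thesis unfolding partial_deriv_def by simp
qed

text \<open>\<open>Lim\<close> is a definite description, so locally equal functions give the same
  value whether or not the limit exists.\<close>

lemma partial_deriv_cong:
  assumes "r > 0" "x \<in> padic_space d" "i < d" "\<And>z. z \<in> polydisc d x r \<Longrightarrow> f z = g z"
  shows "partial_deriv i f x = partial_deriv i g x"
proof -
  have x: "x \<in> polydisc d x r" using assms by (intro polydisc_center) auto
  have ev: "eventually (\<lambda>h. (f (x(i := x i + h)) - f x) / h = (g (x(i := x i + h)) - g x) / h) (at 0)"
    unfolding eventually_at
  proof (intro exI[of _ r] conjI ballI impI assms(1))
    fix h :: "'a padic" assume "h \<noteq> 0 \<and> dist h 0 < r"
    then have "x(i := x i + h) \<in> polydisc d x r"
      using assms(3) x by (intro polydisc_upd) (auto simp: dist_padic_def)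
    then show "(f (x(i := x i + h)) - f x) / h = (g (x(i := x i + h)) - g x) / h"
      using assms(4) x by simp
  qed
  show ?thesis unfolding partial_deriv_def Topological_Spaces.Lim_def
    by (simp only: tendsto_cong[OF ev])
qed

lemma partial_deriv_locally_const:
  assumes "\<And>z. z \<in> polydisc d x r \<Longrightarrow> f z = c" "r > 0" "i < d" "x \<in> padic_space d"
  shows "partial_deriv i f x = 0"
proof (rule partial_deriv_eqI)
  fix e :: real assume "e > 0"
  have x: "x \<in> polydisc d x r" using assms by (intro polydisc_center) auto
  show "\<exists>\<delta>>0. \<forall>h. padic_norm h \<le> \<delta> \<longrightarrow> padic_norm (f (x(i := x i + h)) - f x - 0 * h) \<le> e * padic_norm h"
    using assms(1,2) x polydisc_upd[OF x assms(3)] \<open>e > 0\<close> by (intro exI[of _ r]) auto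
qed

lemma partial_deriv_locally_coord:
  assumes "\<And>z. z \<in> polydisc d x r \<Longrightarrow> f z = z l" "r > 0" "i < d" "x \<in> padic_space d"
  shows "partial_deriv i f x = (if l = i then 1 else 0)"
proof (rule partial_deriv_eqI)
  fix e :: real assume "e > 0"
  have x: "x \<in> polydisc d x r" using assms by (intro polydisc_center) auto
  show "\<exists>\<delta>>0. \<forall>h. padic_norm h \<le> \<delta> \<longrightarrow>
      padic_norm (f (x(i := x i + h)) - f x - (if l = i then 1 else 0) * h) \<le> e * padic_norm h"
    using assms(1,2) x polydisc_upd[OF x assms(3)] \<open>e > 0\<close> by (intro exI[of _ r]) auto
qed

lemma tate_concat_coords_right:
  assumes f: "tate (k + d) (concat_coords k y0 x0) r B f" and y: "y \<in> polydisc k y0 r" and x0: "x0 \<in> padic_space d"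
  shows "tate d x0 r B (\<lambda>x. f (concat_coords k y x))"
proof (rule tate_compose[OF f x0])
  show r: "r > 0" by (rule tate_radius[OF f])
  fix j assume j: "j < k + d"
  show "tate d x0 r r (\<lambda>x. concat_coords k y x j - concat_coords k y0 x0 j)"
  proof (cases "j < k")
    case True
    then show ?thesis
      using tate_mono[OF tate_const[OF x0 r, of "y j - y0 j"], of r] y by (simp add: concat_coords_def polydisc_def)
  next
    case False
    then show ?thesis using tate_coord[OF x0 r, of "j - k"] j by (simp add: concat_coords_def)
  qed
qed (simp add: concat_coords_in_space polydisc_in_space)

lemma tate_ex_mult: "\<exists>B. tate d a r B f \<Longrightarrow> \<exists>B. tate d a r B g \<Longrightarrow> \<exists>B. tate d a r B (\<lambda>x. f x * g x)"
  using tate_mult by blast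

lemma tate_ex_sum:
  assumes "a \<in> padic_space d" "r > 0" "\<And>i. i \<in> I \<Longrightarrow> \<exists>B. tate d a r B (f i)"
  shows "\<exists>B. tate d a r B (\<lambda>x. \<Sum>i\<in>I. f i x)"
  using assms(3)
proof (induction I rule: infinite_finite_induct)
  case (insert i I)
  obtain B where "tate d a r B (f i)" using insert(4)[of i] by auto
  moreover obtain B' where "tate d a r B' (\<lambda>x. \<Sum>i\<in>I. f i x)" using insert(3,4) by auto
  ultimately have "tate d a r (max B B') (\<lambda>x. f i x + (\<Sum>i\<in>I. f i x))"
    by (intro tate_add) (auto intro: tate_mono)
  then show ?case using insert by auto
qed (use tate_const[OF assms(1,2), of 0] in auto)

text \<open>\<open>F\<close> is the action in coordinates, with the group variables in front, and \<open>w\<close> are the coefficients of the form.\<close>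

lemma momentum_primitive_coord:
  fixes F :: "(nat \<Rightarrow> 'p::prime_card padic) \<Rightarrow> nat \<Rightarrow> 'p padic"
  assumes y0: "y0 \<in> padic_space k" and x0: "x0 \<in> padic_space d" and r: "r > 0"
    and F: "\<And>j. j < d \<Longrightarrow> \<exists>B. tate (k + d) (concat_coords k y0 x0) r B (\<lambda>z. F z j)"
    and w: "\<And>i j. i < d \<Longrightarrow> j < d \<Longrightarrow> \<exists>B. tate d x0 r B (w i j)"
    and anti: "\<And>x i j. x \<in> polydisc d x0 r \<Longrightarrow> i < d \<Longrightarrow> j < d \<Longrightarrow> w i j x = - w j i x"
    and closed: "\<And>x i j l. x \<in> polydisc d x0 r \<Longrightarrow> i < d \<Longrightarrow> j < d \<Longrightarrow> l < d \<Longrightarrow>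
      partial_deriv i (w j l) x - partial_deriv j (w i l) x + partial_deriv l (w i j) x = 0"
    and ident: "\<And>x. x \<in> polydisc d x0 r \<Longrightarrow> F (concat_coords k y0 x) = x"
    and Fps: "\<And>z. z \<in> polydisc (k + d) (concat_coords k y0 x0) r \<Longrightarrow> F z \<in> padic_space d"
    and inv: "\<And>y x i j. y \<in> polydisc k y0 r \<Longrightarrow> x \<in> polydisc d x0 r \<Longrightarrow> i < d \<Longrightarrow> j < d \<Longrightarrow>
      (\<Sum>l<d. \<Sum>m<d. w l m (F (concat_coords k y x)) * partial_deriv (k + i) (\<lambda>z. F z l) (concat_coords k y x) *
        partial_deriv (k + j) (\<lambda>z. F z m) (concat_coords k y x)) = w i j x"
    and a: "a < k"
  shows "\<exists>h B. tate d x0 (r / 2) B h \<and> (\<forall>j<d. \<forall>x\<in>polydisc d x0 (r / 2).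
      partial_deriv j h x = (\<Sum>i<d. partial_deriv a (\<lambda>z. F z i) (concat_coords k y0 x) * w i j x))"
proof (rule tate_poincare[OF x0 r])
  \<comment> \<open>The components of the field generated by the group direction \<open>a\<close>,
    at the identity \<open>y0\<close>.\<close>
  define X where "X i x = partial_deriv a (\<lambda>z. F z i) (concat_coords k y0 x)" for i x
  have y0p: "y0 \<in> polydisc k y0 r" using y0 r by (intro polydisc_center) auto
  have X: "\<exists>B. tate d x0 r B (X i)" if i: "i < d" for i
  proof -
    have "\<exists>B. tate (k + d) (concat_coords k y0 x0) r B (partial_deriv a (\<lambda>z. F z i))"
      using F[OF i] tate_partial_deriv a by (meson trans_less_add1)
    then show ?thesis using tate_concat_coords_right[OF _ y0p x0] unfolding X_def by blast
  qed
  show "\<exists>B. tate d x0 r B (\<lambda>x. \<Sum>i<d. partial_deriv a (\<lambda>z. F z i) (concat_coords k y0 x) * w i j x)" if j: "j < d" for j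
    unfolding X_def[symmetric] by (intro tate_ex_sum tate_ex_mult x0 r) (use X w j in auto)
  fix x i j assume x: "x \<in> polydisc d x0 r" and i: "i < d" and j: "j < d"
  have xs: "x \<in> padic_space d" using x by (rule polydisc_in_space)
  have xr: "polydisc d x r = polydisc d x0 r" using x by (rule polydisc_recentre)
  define z where "z = concat_coords k y0 x"
  have z: "z \<in> polydisc (k + d) (concat_coords k y0 x0) r" unfolding z_def by (rule concat_coords_in_polydisc[OF y0p x])
  have zs: "z \<in> padic_space (k + d)" using z by (rule polydisc_in_space)
  have Fz: "F z = x" unfolding z_def by (rule ident[OF x])
  have Xd: "frechet d (X l) x (\<lambda>q. partial_deriv q (X l) x)" if "l < d" for l
    using X[OF that] tate_frechet[OF _ x] by blast
  have wd: "frechet d (w l m) x (\<lambda>q. partial_deriv q (w l m) x)" if "l < d" "m < d" for l m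
    using w[OF that] tate_frechet[OF _ x] by blast
  have Fd: "frechet (k + d) (\<lambda>z. F z l) z (\<lambda>q. partial_deriv q (\<lambda>z. F z l) z)" if "l < d" for l
    using F[OF that] tate_frechet[OF _ z] by blast
  define P where "P q l = partial_deriv (k + q) (\<lambda>z. F z l)" for q l
  have Pd: "frechet (k + d) (P q l) z (\<lambda>s. partial_deriv s (P q l) z)" if "q < d" "l < d" for q l
    using F[OF that(2)] tate_partial_deriv tate_frechet[OF _ z] that(1) unfolding P_def by (meson nat_add_left_cancel_less)
  \<comment> \<open>At the identity the action is the identity map, so its Jacobian \<open>P\<close>
    is the unit matrix. This collapses the double sums in \<open>lie\<close>.\<close>
  have Pz: "P q l z = (if l = q then 1 else 0)" if "q < d" "l < d" for q l
    unfolding P_def z_def partial_deriv_concat_coords_right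
    by (rule partial_deriv_locally_coord[where r = r and d = d]) (use ident xr r xs that in auto)
  \<comment> \<open>Mixed partial derivatives commute: the Jacobian of the action, differentiated in
    the group direction, is the Jacobian of the field.\<close>
  have aP: "partial_deriv a (P q l) z = partial_deriv q (X l) x" if "q < d" "l < d" for q l
  proof -
    obtain B where "tate (k + d) (concat_coords k y0 x0) r B (\<lambda>z. F z l)" using F[OF \<open>l < d\<close>] by blast
    then have "partial_deriv a (P q l) z = partial_deriv (k + q) (partial_deriv a (\<lambda>z. F z l)) z"
      unfolding P_def by (rule tate_partial_deriv_commute) (use a that z in auto)
    then show ?thesis unfolding z_def partial_deriv_concat_coords_right X_def .
  qed
  have deriv_alpha: "partial_deriv i (\<lambda>x. \<Sum>l<d. X l x * w l j x) x =
      (\<Sum>l<d. partial_deriv i (X l) x * w l j x + X l x * partial_deriv i (w l j) x)"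
    if "i < d" "j < d" for i j
    by (rule frechet_partial_deriv[OF frechet_sum[OF xs frechet_mult[OF Xd wd]]]) (use that in auto)
  \<comment> \<open>the Lie derivative of the form along the field vanishes: differentiate the invariance in direction \<open>a\<close>\<close>
  have lie: "(\<Sum>l<d. X l x * partial_deriv l (w i j) x) + (\<Sum>l<d. w l j x * partial_deriv i (X l) x)
      + (\<Sum>l<d. w i l x * partial_deriv j (X l) x) = 0"
  proof -
    \<comment> \<open>The coefficient with indices \<open>i\<close> and \<open>j\<close> of the
      pulled-back form, as a function of group and space coordinates together.\<close>
    define \<Phi> where "\<Phi> z = (\<Sum>l<d. \<Sum>m<d. w l m (F z) * P i l z * P j m z)" for z
    have wF: "frechet (k + d) (\<lambda>z. w l m (F z)) z
        (\<lambda>q. \<Sum>n<d. partial_deriv n (w l m) x * partial_deriv q (\<lambda>z. F z n) z)" if "l < d" "m < d" for l m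
      by (rule frechet_compose[where f = "w l m" and g = F and \<rho> = r and D = "\<lambda>n. partial_deriv n (w l m) x"
          and E = "\<lambda>n q. partial_deriv q (\<lambda>z. F z n) z"])
        (use wd[OF that] Fd zs r polydisc_recentre[OF z] Fps in \<open>auto simp: Fz\<close>)
    have "partial_deriv a \<Phi> z = (\<Sum>l<d. \<Sum>m<d.
        ((\<Sum>n<d. partial_deriv n (w l m) x * partial_deriv a (\<lambda>z. F z n) z) * P i l z
          + w l m (F z) * partial_deriv a (P i l) z) * P j m z
        + w l m (F z) * P i l z * partial_deriv a (P j m) z)"
      unfolding \<Phi>_def
      by (rule frechet_partial_deriv[where d = "k + d",
            OF frechet_sum[OF zs frechet_sum[OF zs frechet_mult[OF frechet_mult[OF wF Pd] Pd]]]])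
         (use i j a in auto)
    also have "\<dots> = (\<Sum>l<d. \<Sum>m<d.
        (if l = i then if m = j then \<Sum>n<d. partial_deriv n (w l m) x * X n x else 0 else 0)
        + (if m = j then w l m x * partial_deriv i (X l) x else 0)
        + (if l = i then w l m x * partial_deriv j (X m) x else 0))"
      by (intro sum.cong refl) (use i j in \<open>auto simp: Pz aP Fz X_def z_def[symmetric]\<close>)
    also have "\<dots> = (\<Sum>n<d. partial_deriv n (w i j) x * X n x) + (\<Sum>l<d. w l j x * partial_deriv i (X l) x)
        + (\<Sum>m<d. w i m x * partial_deriv j (X m) x)"
    proof -
      have "(\<Sum>l<d. \<Sum>m<d. if l = i then if m = j then \<Sum>n<d. partial_deriv n (w l m) x * X n x else 0 else 0)
          = (\<Sum>l<d. if l = i then \<Sum>n<d. partial_deriv n (w i j) x * X n x else 0)"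
        by (intro sum.cong refl) (use j in auto)
      also have "\<dots> = (\<Sum>n<d. partial_deriv n (w i j) x * X n x)" using i by simp
      finally have 1: "(\<Sum>l<d. \<Sum>m<d. if l = i then if m = j then \<Sum>n<d. partial_deriv n (w l m) x * X n x else 0 else 0)
          = (\<Sum>n<d. partial_deriv n (w i j) x * X n x)" .
      have 2: "(\<Sum>l<d. \<Sum>m<d. if m = j then w l m x * partial_deriv i (X l) x else 0)
          = (\<Sum>l<d. w l j x * partial_deriv i (X l) x)"
        using j by simp
      have "(\<Sum>l<d. \<Sum>m<d. if l = i then w l m x * partial_deriv j (X m) x else 0)
          = (\<Sum>l<d. if l = i then \<Sum>m<d. w i m x * partial_deriv j (X m) x else 0)"
        by (intro sum.cong refl) auto
      also have "\<dots> = (\<Sum>m<d. w i m x * partial_deriv j (X m) x)" using i by simp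
      finally have 3: "(\<Sum>l<d. \<Sum>m<d. if l = i then w l m x * partial_deriv j (X m) x else 0)
          = (\<Sum>m<d. w i m x * partial_deriv j (X m) x)" .
      show ?thesis by (simp only: sum.distrib 1 2 3)
    qed
    finally have *: "partial_deriv a \<Phi> z = (\<Sum>n<d. partial_deriv n (w i j) x * X n x)
        + (\<Sum>l<d. w l j x * partial_deriv i (X l) x) + (\<Sum>m<d. w i m x * partial_deriv j (X m) x)" .
    \<comment> \<open>By the premise \<open>inv\<close>, \<open>\<Phi>\<close> does not depend on
      the group coordinates near \<open>y0\<close>.\<close>
    have "partial_deriv a \<Phi> z = 0"
      unfolding z_def partial_deriv_concat_coords_left[OF a]
      by (rule partial_deriv_locally_const[where d = k and r = r and c = "w i j x"])
        (use inv[OF _ x i j] r a y0 in \<open>auto simp: \<Phi>_def P_def\<close>)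
    then show ?thesis using * by (simp add: mult.commute)
  qed
  \<comment> \<open>Cartan's formula in coordinates. Closedness of \<open>w\<close> replaces the
    difference of the derivatives of \<open>w l j\<close> and \<open>w l i\<close> by the derivative
    of \<open>w i j\<close> in direction \<open>l\<close>, and the exterior derivative of the
    contraction becomes the Lie derivative.\<close>
  have "partial_deriv i (\<lambda>x. \<Sum>l<d. X l x * w l j x) x - partial_deriv j (\<lambda>x. \<Sum>l<d. X l x * w l i x) x
      = (\<Sum>l<d. (partial_deriv i (X l) x * w l j x + X l x * partial_deriv i (w l j) x)
          - (partial_deriv j (X l) x * w l i x + X l x * partial_deriv j (w l i) x))"
    by (simp only: deriv_alpha[OF i j] deriv_alpha[OF j i] sum_subtractf)
  also have "\<dots> = (\<Sum>l<d. X l x * partial_deriv l (w i j) x + w l j x * partial_deriv i (X l) x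
      + w i l x * partial_deriv j (X l) x)"
  proof (rule sum.cong[OF refl])
    fix l assume "l \<in> {..<d}"
    then have l: "l < d" by simp
    have "partial_deriv i (w l j) x = partial_deriv l (w i j) x + partial_deriv j (w l i) x"
      using closed[OF x l i j] by (simp add: algebra_simps)
    moreover have "w i l x = - w l i x" by (rule anti[OF x i l])
    ultimately show "(partial_deriv i (X l) x * w l j x + X l x * partial_deriv i (w l j) x)
          - (partial_deriv j (X l) x * w l i x + X l x * partial_deriv j (w l i) x) =
       X l x * partial_deriv l (w i j) x + w l j x * partial_deriv i (X l) x + w i l x * partial_deriv j (X l) x"
      by (simp add: algebra_simps)
  qed
  also have "\<dots> = 0" using lie by (simp add: sum.distrib)
  finally show "partial_deriv i (\<lambda>x. \<Sum>i<d. partial_deriv a (\<lambda>z. F z i) (concat_coords k y0 x) * w i j x) x =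
      partial_deriv j (\<lambda>x. \<Sum>l<d. partial_deriv a (\<lambda>z. F z l) (concat_coords k y0 x) * w l i x) x"
    unfolding X_def by simp
qed

section \<open>Locally constant selections on paracompact spaces\<close>

lemma compactin_meets_finitely_many:
  assumes K: "compactin X K" and \<A>: "locally_finite_in X \<A>"
  shows "finite {U \<in> \<A>. U \<inter> K \<noteq> {}}"
proof -
  have KX: "K \<subseteq> topspace X" using K by (rule compactin_subset_topspace)
  have "\<forall>x\<in>K. \<exists>V. openin X V \<and> x \<in> V \<and> finite {U \<in> \<A>. U \<inter> V \<noteq> {}}"
    using \<A> KX unfolding locally_finite_in_def by blast
  then obtain N where N: "\<And>x. x \<in> K \<Longrightarrow> openin X (N x)" "\<And>x. x \<in> K \<Longrightarrow> x \<in> N x"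
     "\<And>x. x \<in> K \<Longrightarrow> finite {U \<in> \<A>. U \<inter> N x \<noteq> {}}" by metis
  have "Ball (N ` K) (openin X) \<and> K \<subseteq> \<Union>(N ` K)" using N(1,2) by auto
  then have "\<exists>\<F>. finite \<F> \<and> \<F> \<subseteq> N ` K \<and> K \<subseteq> \<Union>\<F>"
    using K unfolding compactin_def by auto
  then obtain \<F> where \<F>: "finite \<F>" "\<F> \<subseteq> N ` K" "K \<subseteq> \<Union>\<F>" by blast
  have "{U \<in> \<A>. U \<inter> K \<noteq> {}} \<subseteq> (\<Union>V\<in>\<F>. {U \<in> \<A>. U \<inter> V \<noteq> {}})" using \<F>(3) by blast
  moreover have "finite (\<Union>V\<in>\<F>. {U \<in> \<A>. U \<inter> V \<noteq> {}})" using \<F>(1,2) N(3) by auto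
  ultimately show ?thesis by (rule finite_subset)
qed

text \<open>For a locally finite cover by sets \<open>V\<close> that contain clopen sets \<open>E V\<close> still covering the space, the set of
  all \<open>V\<close> with \<open>x \<in> E V\<close> depends on \<open>x\<close> in a locally constant way. The \<open>E V\<close> are finite unions of compact open sets.\<close>

lemma locally_constant_selection:
  assumes H: "Hausdorff_space X" and P: "paracompact_space X"
    and K: "\<And>x U. openin X U \<Longrightarrow> x \<in> U \<Longrightarrow> \<exists>K. openin X K \<and> compactin X K \<and> x \<in> K \<and> K \<subseteq> U"
    and op: "\<forall>U\<in>\<U>. openin X U" and cov: "topspace X \<subseteq> \<Union>\<U>"
  shows "\<exists>s. \<forall>x\<in>topspace X. s x \<in> \<U> \<and> x \<in> s x \<and> (\<exists>N. openin X N \<and> x \<in> N \<and> (\<forall>y\<in>N. s y = s x))"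
proof -
  \<comment> \<open>Applied twice: the members of the first cover lie in compact sets, so each can
    contain only finitely many nonempty members of the second.\<close>
  have refine: "\<exists>\<V>. (\<forall>V\<in>\<V>. openin X V) \<and> \<Union>\<V> = topspace X \<and>
      (\<forall>V\<in>\<V>. \<exists>B. openin X B \<and> compactin X B \<and> V \<subseteq> B \<and> (\<exists>S\<in>\<S>. B \<subseteq> S)) \<and> locally_finite_in X \<V>"
    if \<S>: "\<forall>S\<in>\<S>. openin X S" "topspace X \<subseteq> \<Union>\<S>" for \<S>
  proof -
    define \<K> where "\<K> = {B. openin X B \<and> compactin X B \<and> (\<exists>S\<in>\<S>. B \<subseteq> S)}"
    have "\<Union>\<K> = topspace X"
    proof
      show "\<Union>\<K> \<subseteq> topspace X" using openin_subset by (auto simp: \<K>_def)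
      show "topspace X \<subseteq> \<Union>\<K>"
      proof
        fix x assume "x \<in> topspace X"
        then obtain S where "S \<in> \<S>" "x \<in> S" using \<S>(2) by blast
        moreover from this obtain B where "openin X B" "compactin X B" "x \<in> B" "B \<subseteq> S"
          using K[of S x] \<S>(1) by blast
        ultimately show "x \<in> \<Union>\<K>" by (auto simp: \<K>_def)
      qed
    qed
    moreover have "\<forall>B\<in>\<K>. openin X B" by (simp add: \<K>_def)
    ultimately have "(\<forall>B\<in>\<K>. openin X B) \<and> \<Union>\<K> = topspace X" by simp
    from P[unfolded paracompact_space_def, THEN spec, of \<K>, THEN mp, OF this]
    obtain \<V> where \<V>: "\<forall>V\<in>\<V>. openin X V" "\<Union>\<V> = topspace X" "\<forall>V\<in>\<V>. \<exists>B\<in>\<K>. V \<subseteq> B" "locally_finite_in X \<V>"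
      by (elim exE conjE) (rule that)
    have "\<exists>B. openin X B \<and> compactin X B \<and> V \<subseteq> B \<and> (\<exists>S\<in>\<S>. B \<subseteq> S)" if V: "V \<in> \<V>" for V
    proof -
      obtain B where "B \<in> \<K>" "V \<subseteq> B" using \<V>(3)[rule_format, OF V] by (elim bexE) (rule that)
      then show ?thesis unfolding \<K>_def mem_Collect_eq by (elim conjE) (intro exI[of _ B] conjI)
    qed
    with \<V>(1,2,4) show ?thesis by (intro exI[of _ \<V>] conjI ballI) simp_all
  qed
  obtain \<V> where \<V>': "\<forall>V\<in>\<V>. openin X V" "\<Union>\<V> = topspace X"
    "\<forall>V\<in>\<V>. \<exists>B. openin X B \<and> compactin X B \<and> V \<subseteq> B \<and> (\<exists>U\<in>\<U>. B \<subseteq> U)" "locally_finite_in X \<V>"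
    using refine[OF op cov] by (elim exE conjE) (rule that)
  note \<V> = \<V>'(1)[rule_format] \<V>'(2) \<V>'(3)[rule_format] \<V>'(4)
  obtain \<W> where \<W>': "\<forall>V\<in>\<W>. openin X V" "\<Union>\<W> = topspace X"
    "\<forall>W\<in>\<W>. \<exists>B. openin X B \<and> compactin X B \<and> W \<subseteq> B \<and> (\<exists>V\<in>\<V>. B \<subseteq> V)" "locally_finite_in X \<W>"
    using refine[OF \<V>'(1) equalityD2[OF \<V>(2)]] by (elim exE conjE) (rule that)
  note \<W> = \<W>'(1)[rule_format] \<W>'(2) \<W>'(3)[rule_format] \<W>'(4)
  have "\<forall>W\<in>\<W>. \<exists>B V. openin X B \<and> compactin X B \<and> W \<subseteq> B \<and> V \<in> \<V> \<and> B \<subseteq> V"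
    using \<W>(3) by blast
  then obtain b v where bv: "\<And>W. W \<in> \<W> \<Longrightarrow> openin X (b W)" "\<And>W. W \<in> \<W> \<Longrightarrow> compactin X (b W)"
    "\<And>W. W \<in> \<W> \<Longrightarrow> W \<subseteq> b W" "\<And>W. W \<in> \<W> \<Longrightarrow> v W \<in> \<V>" "\<And>W. W \<in> \<W> \<Longrightarrow> b W \<subseteq> v W" by metis
  \<comment> \<open>Empty members are excluded because the finiteness of \<open>I V\<close> is
    obtained by counting the members that meet a compact set.\<close>
  define I where "I V = {W \<in> \<W>. W \<noteq> {} \<and> v W = V}" for V
  define E where "E V = \<Union>(b ` I V)" for V
  have EV: "E V \<subseteq> V" for V using bv(5) by (auto simp: E_def I_def)
  have Eo: "openin X (E V)" for V unfolding E_def using bv(1) by (intro openin_Union) (auto simp: I_def)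
  have Ec: "closedin X (E V)" if V: "V \<in> \<V>" for V
  proof -
    \<comment> \<open>All members counted by \<open>I V\<close> lie in \<open>V\<close>, hence meet
      the compact set \<open>B\<close>, which a locally finite family does only finitely
      often.\<close>
    obtain B where B: "compactin X B" "V \<subseteq> B" using \<V>(3)[OF V] by blast
    have "I V \<subseteq> {W \<in> \<W>. W \<inter> B \<noteq> {}}"
    proof
      fix W assume "W \<in> I V"
      then have W: "W \<in> \<W>" "W \<noteq> {}" "v W = V" by (simp_all add: I_def)
      then have "W \<subseteq> B" using bv(3)[OF W(1)] bv(5)[OF W(1)] B(2) by simp
      then show "W \<in> {W \<in> \<W>. W \<inter> B \<noteq> {}}" using W by (simp add: inf.absorb1)
    qed
    then have "finite (I V)" using compactin_meets_finitely_many[OF B(1) \<W>(4)] by (rule finite_subset)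
    then have "compactin X (E V)" unfolding E_def using bv(2) by (intro compactin_Union) (auto simp: I_def)
    with H show ?thesis by (rule compactin_imp_closedin)
  qed
  define key where "key x = {V \<in> \<V>. x \<in> E V}" for x
  \<comment> \<open>The choice depends on \<open>x\<close> only through \<open>key x\<close> and is
    therefore locally constant wherever \<open>key\<close> is.\<close>
  define s where "s x = (SOME U. U \<in> \<U> \<and> (\<exists>V\<in>key x. V \<subseteq> U))" for x
  have s: "s x \<in> \<U> \<and> (\<exists>V\<in>key x. V \<subseteq> s x)" if x: "x \<in> topspace X" for x
  proof -
    obtain W where W: "W \<in> \<W>" "x \<in> W" using x \<W>(2) by blast
    then have "W \<in> I (v W)" "x \<in> b W" using bv(3)[OF W(1)] by (auto simp: I_def)
    then have "x \<in> E (v W)" unfolding E_def by (rule UnionI[OF imageI])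
    then have "v W \<in> key x" using bv(4)[OF W(1)] by (simp add: key_def)
    moreover obtain B U where "U \<in> \<U>" "v W \<subseteq> B" "B \<subseteq> U" using \<V>(3)[OF bv(4)[OF W(1)]] by (elim exE conjE bexE) (rule that)
    then have "U \<in> \<U>" "v W \<subseteq> U" by simp_all
    ultimately have "\<exists>U. U \<in> \<U> \<and> (\<exists>V\<in>key x. V \<subseteq> U)" by blast
    then show ?thesis unfolding s_def by (rule someI_ex)
  qed
  have loc: "\<exists>N. openin X N \<and> x \<in> N \<and> (\<forall>y\<in>N. key y = key x)" if x: "x \<in> topspace X" for x
  proof -
    obtain N0 where N0: "openin X N0" "x \<in> N0" "finite {V \<in> \<V>. V \<inter> N0 \<noteq> {}}"
      using conjunct2[OF \<V>(4)[unfolded locally_finite_in_def], rule_format, OF x] by (elim exE conjE) (rule that)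
    define \<N> where "\<N> = {V \<in> \<V>. V \<inter> N0 \<noteq> {}}"
    define T where "T V = (if x \<in> E V then E V else topspace X - E V)" for V
    have T: "openin X (T V)" "x \<in> T V" if "V \<in> \<N>" for V
    proof -
      have "V \<in> \<V>" using that by (simp add: \<N>_def)
      then show "openin X (T V)" unfolding T_def using Eo[of V] openin_diff[OF openin_topspace Ec[of V]] by simp
      show "x \<in> T V" using x by (simp add: T_def)
    qed
    define N where "N = \<Inter>(insert N0 (T ` \<N>))"
    have "finite \<N>" unfolding \<N>_def by (rule N0(3))
    then have "openin X N" unfolding N_def using N0(1) T(1) by (intro openin_Inter) auto
    moreover have "x \<in> N" using N0(2) T(2) by (simp add: N_def)
    moreover have "key y = key x" if y: "y \<in> N" for y
    proof -
      have "y \<in> E V \<longleftrightarrow> x \<in> E V" if V: "V \<in> \<V>" for V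
      proof (cases "V \<in> \<N>")
        case True
        then have "y \<in> T V" using y by (auto simp: N_def)
        then show ?thesis by (auto simp: T_def split: if_splits)
      next
        case False
        then have "V \<inter> N0 = {}" using V by (simp add: \<N>_def)
        moreover have "y \<in> N0" using y by (simp add: N_def)
        ultimately show ?thesis using EV[of V] N0(2) by blast
      qed
      then show ?thesis unfolding key_def by blast
    qed
    ultimately show ?thesis by (intro exI[of _ N] conjI ballI)
  qed
  show ?thesis
  proof (intro exI[of _ s] ballI conjI)
    fix x assume x: "x \<in> topspace X"
    show "s x \<in> \<U>" using s[OF x] by simp
    obtain V where V: "V \<in> key x" "V \<subseteq> s x" using s[OF x] by blast
    then have "x \<in> E V" by (simp add: key_def)
    then show "x \<in> s x" using EV[of V] V(2) by blast
    obtain N where N: "openin X N" "x \<in> N" "\<forall>y\<in>N. key y = key x" using loc[OF x] by (elim exE conjE) (rule that)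
    have "\<forall>y\<in>N. s y = s x"
    proof
      fix y assume "y \<in> N"
      then have "key y = key x" using N(3) by blast
      then show "s y = s x" by (simp only: s_def)
    qed
    with N(1,2) show "\<exists>N. openin X N \<and> x \<in> N \<and> (\<forall>y\<in>N. s y = s x)" by (intro exI[of _ N] conjI)
  qed
qed

section \<open>Charts and analytic maps\<close>

lemma chart_dom_open: "is_chart X c \<Longrightarrow> openin X (cdom c)"
  by (simp add: is_chart_def)

lemma chart_topspace:
  assumes "is_chart X c" shows "topspace (subtopology X (cdom c)) = cdom c"
  using openin_subset[OF chart_dom_open[OF assms]] by (simp add: inf.absorb2)

lemma chart_inj:
  assumes "is_chart X c" shows "inj_on (cmap c) (cdom c)"
proof -
  have "homeomorphic_map (subtopology X (cdom c)) (top_of_set (cmap c ` cdom c)) (cmap c)"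
    using assms by (simp add: is_chart_def)
  from homeomorphic_imp_injective_map[OF this] show ?thesis by (simp only: chart_topspace[OF assms])
qed

lemma chart_inv_cmap: "is_chart X c \<Longrightarrow> m \<in> cdom c \<Longrightarrow> chart_inv c (cmap c m) = m"
  unfolding chart_inv_def by (rule inv_into_f_f[OF chart_inj])

lemma cmap_chart_inv: "x \<in> cmap c ` cdom c \<Longrightarrow> cmap c (chart_inv c x) = x"
  by (simp add: chart_inv_def f_inv_into_f)

lemma chart_inv_in_dom: "x \<in> cmap c ` cdom c \<Longrightarrow> chart_inv c x \<in> cdom c"
  by (simp add: chart_inv_def inv_into_into)

lemma chart_image_space: "is_chart X c \<Longrightarrow> cmap c ` cdom c \<subseteq> padic_space (cdim c)"
  unfolding is_chart_def by (elim conjE) (rule openin_imp_subset)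

lemma chart_in_space: "is_chart X c \<Longrightarrow> m \<in> cdom c \<Longrightarrow> cmap c m \<in> padic_space (cdim c)"
  using chart_image_space by blast

lemma chart_image_open:
  assumes c: "is_chart X c" and N: "openin X N" "N \<subseteq> cdom c"
  shows "openin (top_of_set (padic_space (cdim c))) (cmap c ` N)"
proof -
  have h: "homeomorphic_map (subtopology X (cdom c)) (top_of_set (cmap c ` cdom c)) (cmap c)"
    and i: "openin (top_of_set (padic_space (cdim c))) (cmap c ` cdom c)"
    using c by (auto simp: is_chart_def)
  have "openin (subtopology X (cdom c)) N"
    using N by (simp add: openin_open_subtopology[OF chart_dom_open[OF c]])
  then have "openin (top_of_set (cmap c ` cdom c)) (cmap c ` N)"
    using homeomorphic_imp_open_map[OF h] by (simp add: open_map_def)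
  then show ?thesis using i by (rule openin_trans)
qed

lemma chart_preimage_open:
  assumes c: "is_chart X c" and V: "openin (top_of_set (padic_space (cdim c))) V"
  shows "openin X {m \<in> cdom c. cmap c m \<in> V}"
proof -
  have "homeomorphic_map (subtopology X (cdom c)) (top_of_set (cmap c ` cdom c)) (cmap c)"
    using c by (simp add: is_chart_def)
  then have "continuous_map (subtopology X (cdom c)) (top_of_set (cmap c ` cdom c)) (cmap c)"
    by (rule homeomorphic_imp_continuous_map)
  moreover have "openin (top_of_set (cmap c ` cdom c)) (cmap c ` cdom c \<inter> V)"
  proof -
    obtain T where T: "open T" "V = padic_space (cdim c) \<inter> T" using V unfolding openin_open by blast
    then have "cmap c ` cdom c \<inter> V = cmap c ` cdom c \<inter> T" using chart_image_space[OF c] by blast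
    then show ?thesis using openin_open_Int[OF T(1)] by simp
  qed
  ultimately have "openin (subtopology X (cdom c)) {m \<in> topspace (subtopology X (cdom c)). cmap c m \<in> cmap c ` cdom c \<inter> V}"
    by (rule openin_continuous_map_preimage)
  also have "{m \<in> topspace (subtopology X (cdom c)). cmap c m \<in> cmap c ` cdom c \<inter> V} = {m \<in> cdom c. cmap c m \<in> V}"
    using chart_topspace[OF c] by auto
  finally show ?thesis by (simp add: openin_open_subtopology[OF chart_dom_open[OF c]])
qed

lemma chart_polydisc:
  assumes c: "is_chart X c" and N: "openin X N" "m \<in> N" "m \<in> cdom c"
  shows "\<exists>r>0. polydisc (cdim c) (cmap c m) r \<subseteq> cmap c ` (N \<inter> cdom c)"
proof (rule openin_padic_space_polydisc)
  show "openin (top_of_set (padic_space (cdim c))) (cmap c ` (N \<inter> cdom c))"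
    by (rule chart_image_open[OF c]) (use N chart_dom_open[OF c] in auto)
qed (use N in auto)

lemma chart_compact:
  assumes c: "is_chart X c" and r: "polydisc (cdim c) x r \<subseteq> cmap c ` cdom c"
  shows "compactin X {m \<in> cdom c. cmap c m \<in> polydisc (cdim c) x r}" (is "compactin X ?K")
proof -
  have h: "homeomorphic_map (subtopology X (cdom c)) (top_of_set (cmap c ` cdom c)) (cmap c)"
    using c by (simp add: is_chart_def)
  have "cmap c ` ?K = polydisc (cdim c) x r" using r by auto
  then have "compactin (top_of_set (cmap c ` cdom c)) (cmap c ` ?K)"
    using compact_polydisc[of "cdim c" x r] r by (simp add: compactin_subtopology)
  moreover have "?K \<subseteq> topspace (subtopology X (cdom c))" using chart_topspace[OF c] by auto
  ultimately have "compactin (subtopology X (cdom c)) ?K"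
    using homeomorphic_map_compactness[OF h] by blast
  then show ?thesis by (simp add: compactin_subtopology)
qed

lemma manifold_chart: "analytic_manifold M \<Longrightarrow> c \<in> atlas M \<Longrightarrow> is_chart (mtop M) c"
  by (simp add: analytic_manifold_def)

lemma charts_at_chart: "analytic_manifold M \<Longrightarrow> c \<in> charts_at M m \<Longrightarrow> is_chart (mtop M) c"
  by (simp add: charts_at_def manifold_chart)

lemma charts_at_dom: "c \<in> charts_at M m \<Longrightarrow> m \<in> cdom c"
  by (simp add: charts_at_def)

lemma charts_at_atlas: "c \<in> charts_at M m \<Longrightarrow> c \<in> atlas M"
  by (simp add: charts_at_def)

lemma chart_at_in: 
  assumes "analytic_manifold M" "m \<in> points M" shows "chart_at M m \<in> charts_at M m"
proof -
  have "m \<in> (\<Union>c\<in>atlas M. cdom c)" using assms by (simp add: analytic_manifold_def)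
  then have "\<exists>c. c \<in> charts_at M m" by (auto simp: charts_at_def)
  then show ?thesis unfolding chart_at_def by (rule someI_ex)
qed

text \<open>Preimages of small polydiscs under a chart are compact and open.\<close>

lemma manifold_compact_neighbourhood:
  assumes M: "analytic_manifold M" and U: "openin (mtop M) U" "x \<in> U"
  shows "\<exists>K. openin (mtop M) K \<and> compactin (mtop M) K \<and> x \<in> K \<and> K \<subseteq> U"
proof -
  have x: "x \<in> points M" using U openin_subset by blast
  define c where "c = chart_at M x"
  have c: "is_chart (mtop M) c" "x \<in> cdom c"
    unfolding c_def by (rule charts_at_chart[OF M chart_at_in[OF M x]], rule charts_at_dom[OF chart_at_in[OF M x]])
  obtain r where r: "r > 0" "polydisc (cdim c) (cmap c x) r \<subseteq> cmap c ` (U \<inter> cdom c)"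
    using chart_polydisc[OF c(1) U c(2)] by blast
  define K where "K = {m \<in> cdom c. cmap c m \<in> polydisc (cdim c) (cmap c x) r}"
  have "openin (mtop M) K" unfolding K_def by (rule chart_preimage_open[OF c(1) openin_polydisc[OF r(1)]])
  moreover have "compactin (mtop M) K" unfolding K_def by (rule chart_compact[OF c(1)]) (use r(2) in auto)
  moreover have "x \<in> K" using c(2) polydisc_center[OF chart_in_space[OF c], of r] r(1) by (simp add: K_def)
  moreover have "K \<subseteq> U"
  proof
    fix m assume "m \<in> K"
    then have m: "m \<in> cdom c" "cmap c m \<in> cmap c ` (U \<inter> cdom c)" using r(2) by (auto simp: K_def)
    then obtain m' where m': "m' \<in> U" "m' \<in> cdom c" "cmap c m = cmap c m'" by auto
    then show "m \<in> U" using inj_onD[OF chart_inj[OF c(1)] m'(3) m(1)] by simp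
  qed
  ultimately show ?thesis by blast
qed

text \<open>The polydisc condition takes the place of continuity at \<open>m\<close>.\<close>

definition analytic_map_at :: "('a, 'p::prime_card) manifold \<Rightarrow> ('b, 'p) manifold \<Rightarrow> ('a \<Rightarrow> 'b) \<Rightarrow> 'a \<Rightarrow> bool" where
  "analytic_map_at M N f m \<longleftrightarrow> (\<forall>c\<in>charts_at M m. \<forall>c'\<in>charts_at N (f m).
     (\<exists>r>0. polydisc (cdim c) (cmap c m) r \<subseteq> cmap c ` (cdom c \<inter> f -` cdom c')) \<and>
     (\<forall>j<cdim c'. analytic_at (cdim c) (\<lambda>x. local_rep c c' f x j) (cmap c m)))"

lemma local_rep_cmap:
  "is_chart X c \<Longrightarrow> m \<in> cdom c \<Longrightarrow> local_rep c c' f (cmap c m) = cmap c' (f m)"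
  by (simp add: local_rep_def chart_inv_cmap)

lemma analytic_between_analytic_map_at:
  assumes c: "is_chart (mtop M) c" "m \<in> cdom c"
    and f: "analytic_between (cdim c) (cdim c') (local_rep c c' f) (cmap c ` (cdom c \<inter> f -` cdom c'))"
    and m: "f m \<in> cdom c'"
  shows "(\<exists>r>0. polydisc (cdim c) (cmap c m) r \<subseteq> cmap c ` (cdom c \<inter> f -` cdom c')) \<and>
     (\<forall>j<cdim c'. analytic_at (cdim c) (\<lambda>x. local_rep c c' f x j) (cmap c m))"
proof -
  have m': "cmap c m \<in> cmap c ` (cdom c \<inter> f -` cdom c')" using c m by auto
  show ?thesis
  proof (intro conjI allI impI)
    show "\<exists>r>0. polydisc (cdim c) (cmap c m) r \<subseteq> cmap c ` (cdom c \<inter> f -` cdom c')"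
      by (rule openin_padic_space_polydisc[OF _ m']) (use f in \<open>simp add: analytic_between_def\<close>)
    show "analytic_at (cdim c) (\<lambda>x. local_rep c c' f x j) (cmap c m)" if "j < cdim c'" for j
      by (rule analytic_scalar_imp_analytic_at[OF _ m']) (use f that in \<open>simp add: analytic_between_def\<close>)
  qed
qed

text \<open>Changes of chart enter through this lemma: \<open>local_rep c c' id\<close> is a
  transition map, so statements about maps between manifolds cover transitions as well.\<close>

lemma analytic_map_at_id:
  assumes M: "analytic_manifold M"
  shows "analytic_map_at M M id m"
  unfolding analytic_map_at_def
proof (intro ballI)
  fix c c' assume c: "c \<in> charts_at M m" and c': "c' \<in> charts_at M (id m)"
  show "(\<exists>r>0. polydisc (cdim c) (cmap c m) r \<subseteq> cmap c ` (cdom c \<inter> id -` cdom c')) \<and>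
     (\<forall>j<cdim c'. analytic_at (cdim c) (\<lambda>x. local_rep c c' id x j) (cmap c m))"
    by (rule analytic_between_analytic_map_at[OF charts_at_chart[OF M c] charts_at_dom[OF c]])
       (use M charts_at_atlas[OF c] charts_at_atlas[OF c'] charts_at_dom[OF c'] in \<open>auto simp: analytic_manifold_def vimage_def\<close>)
qed

lemma analytic_map_at_polydisc:
  assumes "analytic_map_at M N f m" "c \<in> charts_at M m" "c' \<in> charts_at N (f m)" and M: "analytic_manifold M"
  obtains r where "r > 0" "\<And>x. x \<in> polydisc (cdim c) (cmap c m) r \<Longrightarrow> x \<in> cmap c ` cdom c \<and> f (chart_inv c x) \<in> cdom c'"
proof -
  obtain r where r: "r > 0" "polydisc (cdim c) (cmap c m) r \<subseteq> cmap c ` (cdom c \<inter> f -` cdom c')"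
    using assms unfolding analytic_map_at_def by blast
  show thesis
  proof (rule that[OF r(1)])
    fix x assume "x \<in> polydisc (cdim c) (cmap c m) r"
    then obtain m' where "m' \<in> cdom c" "f m' \<in> cdom c'" "x = cmap c m'" using r(2) by blast
    then show "x \<in> cmap c ` cdom c \<and> f (chart_inv c x) \<in> cdom c'"
      using chart_inv_cmap[OF charts_at_chart[OF M assms(2)]] by auto
  qed
qed

text \<open>Coordinates beyond the dimension are locally zero. With no bound on \<open>j\<close>,
  values of \<open>total_deriv\<close> can be compared as whole sequences.\<close>

lemma analytic_map_at_analytic:
  assumes M: "analytic_manifold M" and N: "analytic_manifold N"
    and f: "analytic_map_at M N f m" and c: "c \<in> charts_at M m" and c': "c' \<in> charts_at N (f m)"
  shows "analytic_at (cdim c) (\<lambda>x. local_rep c c' f x j) (cmap c m)"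
proof (cases "j < cdim c'")
  case True
  then show ?thesis using f c c' unfolding analytic_map_at_def by blast
next
  case False
  obtain r where r: "r > 0" "\<And>x. x \<in> polydisc (cdim c) (cmap c m) r \<Longrightarrow> x \<in> cmap c ` cdom c \<and> f (chart_inv c x) \<in> cdom c'"
    using analytic_map_at_polydisc[OF f c c' M] by blast
  have a: "cmap c m \<in> padic_space (cdim c)"
    by (rule chart_in_space[OF charts_at_chart[OF M c] charts_at_dom[OF c]])
  show ?thesis
  proof (rule analytic_at_cong[OF analytic_at_const[OF a, of 0] r(1)])
    fix x assume "x \<in> polydisc (cdim c) (cmap c m) r"
    then have "f (chart_inv c x) \<in> cdom c'" using r(2) by blast
    then have "local_rep c c' f x \<in> padic_space (cdim c')"
      using chart_in_space[OF charts_at_chart[OF N c']] by (simp add: local_rep_def)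
    then show "0 = local_rep c c' f x j" using False by (simp add: padic_space_def)
  qed
qed

lemma analytic_map_at_frechet:
  assumes "analytic_manifold M" "analytic_manifold N" "analytic_map_at M N f m" "c \<in> charts_at M m" "c' \<in> charts_at N (f m)"
  shows "frechet (cdim c) (\<lambda>x. local_rep c c' f x j) (cmap c m) (\<lambda>i. partial_deriv i (\<lambda>x. local_rep c c' f x j) (cmap c m))"
  using analytic_map_at_analytic[OF assms] by (rule analytic_at_frechet)

lemma total_deriv_analytic_map_at_in_space:
  assumes M: "analytic_manifold M" and N: "analytic_manifold N"
    and f: "analytic_map_at M N f m" and c: "c \<in> charts_at M m" and c': "c' \<in> charts_at N (f m)"
  shows "total_deriv (cdim c) (local_rep c c' f) (cmap c m) v \<in> padic_space (cdim c')"
proof -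
  have "partial_deriv i (\<lambda>x. local_rep c c' f x j) (cmap c m) = 0" if "i < cdim c" "j \<ge> cdim c'" for i j
  proof -
    obtain r where r: "r > 0" "\<And>x. x \<in> polydisc (cdim c) (cmap c m) r \<Longrightarrow> x \<in> cmap c ` cdom c \<and> f (chart_inv c x) \<in> cdom c'"
      using analytic_map_at_polydisc[OF f c c' M] by blast
    show ?thesis
    proof (rule partial_deriv_locally_const[OF _ r(1) that(1)])
      show "cmap c m \<in> padic_space (cdim c)"
        by (rule chart_in_space[OF charts_at_chart[OF M c] charts_at_dom[OF c]])
      fix x assume "x \<in> polydisc (cdim c) (cmap c m) r"
      then have "f (chart_inv c x) \<in> cdom c'" using r(2) by blast
      then have "local_rep c c' f x \<in> padic_space (cdim c')"
        using chart_in_space[OF charts_at_chart[OF N c']] by (simp add: local_rep_def)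
      then show "local_rep c c' f x j = 0" using that by (simp add: padic_space_def)
    qed
  qed
  then show ?thesis by (auto simp: padic_space_def total_deriv_def)
qed

text \<open>With \<open>id\<close> for one of the maps this is the transformation rule for a change
  of chart in the source or in the target.\<close>

lemma total_deriv_chain:
  assumes M: "analytic_manifold M" and N: "analytic_manifold N" and P: "analytic_manifold P"
    and f: "analytic_map_at M N f m" and g: "analytic_map_at N P g (f m)"
    and c: "c \<in> charts_at M m" and c': "c' \<in> charts_at N (f m)" and c'': "c'' \<in> charts_at P (g (f m))"
  shows "total_deriv (cdim c) (local_rep c c'' (g \<circ> f)) (cmap c m) v =
    total_deriv (cdim c') (local_rep c' c'' g) (cmap c' (f m)) (total_deriv (cdim c) (local_rep c c' f) (cmap c m) v)"
proof -
  have a: "cmap c m \<in> padic_space (cdim c)"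
    by (rule chart_in_space[OF charts_at_chart[OF M c] charts_at_dom[OF c]])
  have fm: "local_rep c c' f (cmap c m) = cmap c' (f m)"
    by (rule local_rep_cmap[OF charts_at_chart[OF M c] charts_at_dom[OF c]])
  obtain r where r: "r > 0" "\<And>x. x \<in> polydisc (cdim c) (cmap c m) r \<Longrightarrow> x \<in> cmap c ` cdom c \<and> f (chart_inv c x) \<in> cdom c'"
    using analytic_map_at_polydisc[OF f c c' M] by blast
  have "partial_deriv i (\<lambda>x. local_rep c c'' (g \<circ> f) x j) (cmap c m) =
      (\<Sum>l<cdim c'. partial_deriv l (\<lambda>y. local_rep c' c'' g y j) (cmap c' (f m)) *
         partial_deriv i (\<lambda>x. local_rep c c' f x l) (cmap c m))" if i: "i < cdim c" for i j
  proof (rule frechet_partial_deriv[OF _ i])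
    have "frechet (cdim c) (\<lambda>x. local_rep c' c'' g (local_rep c c' f x) j) (cmap c m)
        (\<lambda>i. \<Sum>l<cdim c'. partial_deriv l (\<lambda>y. local_rep c' c'' g y j) (cmap c' (f m)) *
         partial_deriv i (\<lambda>x. local_rep c c' f x l) (cmap c m))"
    proof (rule frechet_compose[where f = "\<lambda>y. local_rep c' c'' g y j" and g = "local_rep c c' f" and e = "cdim c'"
          and D = "\<lambda>l. partial_deriv l (\<lambda>y. local_rep c' c'' g y j) (cmap c' (f m))"
          and E = "\<lambda>l i. partial_deriv i (\<lambda>x. local_rep c c' f x l) (cmap c m)" and \<rho> = r])
      show "frechet (cdim c') (\<lambda>y. local_rep c' c'' g y j) (local_rep c c' f (cmap c m))
         (\<lambda>l. partial_deriv l (\<lambda>y. local_rep c' c'' g y j) (cmap c' (f m)))"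
        unfolding fm by (rule analytic_map_at_frechet[OF N P g c' c''])
      show "local_rep c c' f x \<in> padic_space (cdim c')" if "x \<in> polydisc (cdim c) (cmap c m) r" for x
        using r(2)[OF that] chart_in_space[OF charts_at_chart[OF N c']] by (simp add: local_rep_def)
    qed (use analytic_map_at_frechet[OF M N f c c'] r a in auto)
    \<comment> \<open>The composite of the local representatives agrees with the local
      representative of the composite only where \<open>f\<close> stays in the domain of
      \<open>c'\<close>.\<close>
    then show "frechet (cdim c) (\<lambda>x. local_rep c c'' (g \<circ> f) x j) (cmap c m)
        (\<lambda>i. \<Sum>l<cdim c'. partial_deriv l (\<lambda>y. local_rep c' c'' g y j) (cmap c' (f m)) *
         partial_deriv i (\<lambda>x. local_rep c c' f x l) (cmap c m))"
    proof (rule frechet_cong[OF _ r(1)])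
      fix x assume "x \<in> polydisc (cdim c) (cmap c m) r"
      then have "f (chart_inv c x) \<in> cdom c'" using r(2) by blast
      then show "local_rep c' c'' g (local_rep c c' f x) j = local_rep c c'' (g \<circ> f) x j"
        by (simp add: local_rep_def chart_inv_cmap[OF charts_at_chart[OF N c']])
    qed
  qed
  then show ?thesis
    unfolding total_deriv_def
    by (simp add: fun_eq_iff sum_distrib_left sum_distrib_right mult.assoc) (intro allI sum.swap)
qed

section \<open>Tangent vectors, two-forms and differentials\<close>

lemma total_deriv_linear:
  "total_deriv d f a (\<lambda>i. s * u i + t * v i) = (\<lambda>j. s * total_deriv d f a u j + t * total_deriv d f a v j)"
  by (simp add: total_deriv_def fun_eq_iff sum_distrib_left sum.distrib[symmetric] algebra_simps)

lemma total_deriv_zero [simp]: "total_deriv d f a (\<lambda>_. 0) = (\<lambda>_. 0)"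
  by (simp add: total_deriv_def)

lemma tangent_spaceI:
  assumes "\<And>c. c \<notin> charts_at M m \<Longrightarrow> t c = (\<lambda>_. 0)"
    and "\<And>c. c \<in> charts_at M m \<Longrightarrow> t c \<in> padic_space (cdim c)"
    and "\<And>c c'. c \<in> charts_at M m \<Longrightarrow> c' \<in> charts_at M m \<Longrightarrow>
      t c' = total_deriv (cdim c) (local_rep c c' id) (cmap c m) (t c)"
  shows "t \<in> tangent_space M m"
  unfolding tangent_space_def by (intro CollectI conjI allI impI ballI assms)

lemma tangent_outside: "t \<in> tangent_space M m \<Longrightarrow> c \<notin> charts_at M m \<Longrightarrow> t c = (\<lambda>_. 0)"
  unfolding tangent_space_def by (drule CollectD) (elim conjE allE[of _ c] impE)

lemma tangent_in_space: "t \<in> tangent_space M m \<Longrightarrow> c \<in> charts_at M m \<Longrightarrow> t c \<in> padic_space (cdim c)"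
  unfolding tangent_space_def by (drule CollectD) (elim conjE, rule bspec)

lemma tangent_transform:
  assumes "t \<in> tangent_space M m" "c \<in> charts_at M m" "c' \<in> charts_at M m"
  shows "t c' = total_deriv (cdim c) (local_rep c c' id) (cmap c m) (t c)"
proof -
  have "\<forall>c\<in>charts_at M m. \<forall>c'\<in>charts_at M m. t c' = total_deriv (cdim c) (local_rep c c' id) (cmap c m) (t c)"
    using assms(1)[unfolded tangent_space_def, THEN CollectD] by (elim conjE)
  from this[THEN bspec, OF assms(2), THEN bspec, OF assms(3)] show ?thesis .
qed

text \<open>Push-forward of a coordinate vector given in any chart \<open>c\<close>, whereas
  \<open>push_forward\<close> always uses \<open>chart_at\<close>. Its instance for
  \<open>id\<close> is \<open>coord_vector\<close>, so both are shown to be tangent at once.\<close>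

definition push_vec :: "('a, 'p::prime_card) manifold \<Rightarrow> ('b, 'p) manifold \<Rightarrow> ('a \<Rightarrow> 'b) \<Rightarrow> 'a \<Rightarrow>
    ('a, 'p) chart \<Rightarrow> (nat \<Rightarrow> 'p padic) \<Rightarrow> ('b, 'p) tangent" where
  "push_vec M N f m c v = (\<lambda>c'. if c' \<in> charts_at N (f m)
     then total_deriv (cdim c) (local_rep c c' f) (cmap c m) v else (\<lambda>_. 0))"

lemma push_vec_tangent:
  assumes M: "analytic_manifold M" and N: "analytic_manifold N" and f: "analytic_map_at M N f m" and c: "c \<in> charts_at M m"
  shows "push_vec M N f m c v \<in> tangent_space N (f m)"
proof -
  have "total_deriv (cdim c) (local_rep c c'' f) (cmap c m) v =
      total_deriv (cdim c') (local_rep c' c'' id) (cmap c' (f m)) (total_deriv (cdim c) (local_rep c c' f) (cmap c m) v)"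
    if "c' \<in> charts_at N (f m)" "c'' \<in> charts_at N (f m)" for c' c''
    using total_deriv_chain[OF M N N f analytic_map_at_id[OF N] c that(1)] that(2) by simp
  note chain = this
  show ?thesis
  proof (rule tangent_spaceI)
    show "push_vec M N f m c v c' = (\<lambda>_. 0)" if "c' \<notin> charts_at N (f m)" for c'
      using that by (simp only: push_vec_def if_False)
    show "push_vec M N f m c v c' \<in> padic_space (cdim c')" if "c' \<in> charts_at N (f m)" for c'
      using total_deriv_analytic_map_at_in_space[OF M N f c that] that by (simp only: push_vec_def if_True)
    show "push_vec M N f m c v c'' = total_deriv (cdim c') (local_rep c' c'' id) (cmap c' (f m)) (push_vec M N f m c v c')"
      if "c' \<in> charts_at N (f m)" "c'' \<in> charts_at N (f m)" for c' c''
      using chain[OF that] that by (simp only: push_vec_def if_True)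
  qed
qed

lemma push_forward_push_vec:
  "push_forward M N f m t = push_vec M N f m (chart_at M m) (t (chart_at M m))"
  unfolding push_forward_def push_vec_def Let_def ..

text \<open>The chart chosen in the definition may be replaced by any chart at \<open>m\<close>: the
  transition from it is absorbed by the chain rule with \<open>id\<close>.\<close>

lemma push_forward_apply:
  assumes M: "analytic_manifold M" and N: "analytic_manifold N" and f: "analytic_map_at M N f m"
    and m: "m \<in> points M" and t: "t \<in> tangent_space M m" and c: "c \<in> charts_at M m" and c': "c' \<in> charts_at N (f m)"
  shows "push_forward M N f m t c' = total_deriv (cdim c) (local_rep c c' f) (cmap c m) (t c)"
proof -
  define e where "e = chart_at M m"
  have e: "e \<in> charts_at M m" unfolding e_def by (rule chart_at_in[OF M m])
  have "t c = total_deriv (cdim e) (local_rep e c id) (cmap e m) (t e)"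
    by (rule tangent_transform[OF t e c])
  moreover have "total_deriv (cdim e) (local_rep e c' f) (cmap e m) (t e) =
      total_deriv (cdim c) (local_rep c c' f) (cmap c m) (total_deriv (cdim e) (local_rep e c id) (cmap e m) (t e))"
    using total_deriv_chain[OF M M N analytic_map_at_id[OF M], of f m e c c' "t e"] f c c' e by simp
  moreover have "push_forward M N f m t c' = total_deriv (cdim e) (local_rep e c' f) (cmap e m) (t e)"
    using c' by (simp only: push_forward_def Let_def e_def[symmetric] if_True)
  ultimately show ?thesis by (simp only:)
qed

lemma push_forward_tangent:
  assumes "analytic_manifold M" "analytic_manifold N" "analytic_map_at M N f m" "m \<in> points M"
  shows "push_forward M N f m t \<in> tangent_space N (f m)"
  unfolding push_forward_push_vec by (rule push_vec_tangent[OF assms(1-3) chart_at_in[OF assms(1,4)]])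

lemma coord_vector_push_vec: "coord_vector M c i m = push_vec M M id m c (\<lambda>j. if j = i then 1 else 0)"
  by (simp add: coord_vector_def push_vec_def)

lemma coord_vector_tangent:
  assumes "analytic_manifold M" "c \<in> charts_at M m"
  shows "coord_vector M c i m \<in> tangent_space M m"
  using push_vec_tangent[OF assms(1,1) analytic_map_at_id[OF assms(1)] assms(2)] unfolding coord_vector_push_vec by simp

lemma tangent_lincomb:
  assumes "u \<in> tangent_space M m" "v \<in> tangent_space M m"
  shows "(\<lambda>c i. s * u c i + t * v c i) \<in> tangent_space M m"
proof (rule tangent_spaceI)
  fix c assume "c \<notin> charts_at M m"
  then show "(\<lambda>i. s * u c i + t * v c i) = (\<lambda>_. 0)"
    using tangent_outside[OF assms(1)] tangent_outside[OF assms(2)] by simp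
next
  fix c assume "c \<in> charts_at M m"
  then show "(\<lambda>i. s * u c i + t * v c i) \<in> padic_space (cdim c)"
    using tangent_in_space[OF assms(1)] tangent_in_space[OF assms(2)] by (simp add: padic_space_def)
next
  fix c c' assume c: "c \<in> charts_at M m" "c' \<in> charts_at M m"
  show "(\<lambda>i. s * u c' i + t * v c' i) = total_deriv (cdim c) (local_rep c c' id) (cmap c m) (\<lambda>i. s * u c i + t * v c i)"
    unfolding total_deriv_linear tangent_transform[OF assms(1) c, symmetric] tangent_transform[OF assms(2) c, symmetric] ..
qed

lemma tangent_zero: "(\<lambda>_ _. 0) \<in> tangent_space M m"
  by (rule tangent_spaceI) (simp_all add: padic_space_def)

lemma tangent_sum:
  assumes "finite A" "\<And>k. k \<in> A \<Longrightarrow> e k \<in> tangent_space M m"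
  shows "(\<lambda>c i. \<Sum>k\<in>A. a k * e k c i) \<in> tangent_space M m"
  using assms
proof (induction A rule: finite_induct)
  case (insert k A)
  then have "(\<lambda>c i. a k * e k c i + 1 * (\<Sum>k\<in>A. a k * e k c i)) \<in> tangent_space M m"
    by (intro tangent_lincomb) auto
  then show ?case using insert by simp
qed (simp add: tangent_zero)

lemma coord_vector_self:
  assumes M: "analytic_manifold M" and c: "c \<in> charts_at M m" and i: "i < cdim c"
  shows "coord_vector M c i m c = (\<lambda>j. if j = i then 1 else 0)"
proof -
  have a: "cmap c m \<in> padic_space (cdim c)"
    by (rule chart_in_space[OF charts_at_chart[OF M c] charts_at_dom[OF c]])
  obtain r where r: "r > 0" "\<And>x. x \<in> polydisc (cdim c) (cmap c m) r \<Longrightarrow> x \<in> cmap c ` cdom c \<and> id (chart_inv c x) \<in> cdom c"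
    using analytic_map_at_polydisc[OF analytic_map_at_id[OF M] c _ M, of c] c by auto
  have "partial_deriv l (\<lambda>x. local_rep c c id x j) (cmap c m) = (if j = l then 1 else 0)" if "l < cdim c" for l j
    by (rule partial_deriv_locally_coord[OF _ r(1) that a])
       (use r(2) in \<open>simp add: local_rep_def cmap_chart_inv\<close>)
  note p = this
  show ?thesis
  proof
    fix j
    have "coord_vector M c i m c j = (\<Sum>l<cdim c. partial_deriv l (\<lambda>x. local_rep c c id x j) (cmap c m) * (if l = i then 1 else 0))"
      using c by (simp add: coord_vector_def total_deriv_def)
    also have "\<dots> = (\<Sum>l<cdim c. if l = i then (if j = i then 1 else 0) else 0)"
      by (rule sum.cong[OF refl]) (simp add: p)
    also have "\<dots> = (if j = i then 1 else 0)" using i by simp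
    finally show "coord_vector M c i m c j = (if j = i then 1 else 0)" .
  qed
qed

text \<open>The transformation law determines a tangent vector by its coordinates in the one chart
  \<open>c\<close>, and it is linear in them.\<close>

lemma tangent_expand:
  assumes M: "analytic_manifold M" and c: "c \<in> charts_at M m" and t: "t \<in> tangent_space M m"
  shows "t = (\<lambda>c' q. \<Sum>i<cdim c. t c i * coord_vector M c i m c' q)"
proof (intro ext)
  fix c' q
  show "t c' q = (\<Sum>i<cdim c. t c i * coord_vector M c i m c' q)"
  proof (cases "c' \<in> charts_at M m")
    case True
    have "t c' = total_deriv (cdim c) (local_rep c c' id) (cmap c m) (t c)"
      by (rule tangent_transform[OF t c True])
    then have "t c' q = (\<Sum>i<cdim c. partial_deriv i (\<lambda>x. local_rep c c' id x q) (cmap c m) * t c i)"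
      by (simp only: total_deriv_def)
    moreover have "coord_vector M c i m c' q = partial_deriv i (\<lambda>x. local_rep c c' id x q) (cmap c m)" if "i < cdim c" for i
      using True that by (simp add: coord_vector_def total_deriv_def if_distrib cong: if_cong)
    ultimately show ?thesis by (simp add: mult.commute)
  next
    case False
    then show ?thesis using tangent_outside[OF t False] by (simp add: coord_vector_def)
  qed
qed

section \<open>Two-forms in a chart\<close>

lemma two_form_linear_left:
  assumes "is_two_form M \<omega>" "m \<in> points M" "u \<in> tangent_space M m" "v \<in> tangent_space M m" "w \<in> tangent_space M m"
  shows "\<omega> m (\<lambda>c i. a * u c i + b * v c i) w = a * \<omega> m u w + b * \<omega> m v w"
  using assms(1)[unfolded is_two_form_def, THEN bspec, OF assms(2), THEN bspec, OF assms(3), THEN bspec, OF assms(4),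
    THEN bspec, OF assms(5), THEN spec, of a, THEN spec, of b] by (elim conjE)

lemma two_form_linear_right:
  assumes "is_two_form M \<omega>" "m \<in> points M" "u \<in> tangent_space M m" "v \<in> tangent_space M m" "w \<in> tangent_space M m"
  shows "\<omega> m w (\<lambda>c i. a * u c i + b * v c i) = a * \<omega> m w u + b * \<omega> m w v"
  using assms(1)[unfolded is_two_form_def, THEN bspec, OF assms(2), THEN bspec, OF assms(3), THEN bspec, OF assms(4),
    THEN bspec, OF assms(5), THEN spec, of a, THEN spec, of b] by (elim conjE)

lemma two_form_self:
  assumes "is_two_form M \<omega>" "m \<in> points M" "u \<in> tangent_space M m"
  shows "\<omega> m u u = 0"
  using assms(1)[unfolded is_two_form_def, THEN bspec, OF assms(2), THEN bspec, OF assms(3), THEN bspec, OF assms(3),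
    THEN bspec, OF assms(3), THEN spec, of 0, THEN spec, of 0] by (elim conjE)

lemma two_form_sum_left:
  assumes \<omega>: "is_two_form M \<omega>" and m: "m \<in> points M" and w: "w \<in> tangent_space M m"
    and "finite A" "\<And>k. k \<in> A \<Longrightarrow> e k \<in> tangent_space M m"
  shows "\<omega> m (\<lambda>c i. \<Sum>k\<in>A. a k * e k c i) w = (\<Sum>k\<in>A. a k * \<omega> m (e k) w)"
  using assms(4,5)
proof (induction A rule: finite_induct)
  case empty
  have "\<omega> m (\<lambda>c i. 0 * w c i + 0 * w c i) w = 0 * \<omega> m w w + 0 * \<omega> m w w"
    by (rule two_form_linear_left[OF \<omega> m w w w])
  then show ?case by simp
next
  case (insert k A)
  have "\<omega> m (\<lambda>c i. a k * e k c i + 1 * (\<Sum>k\<in>A. a k * e k c i)) w =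
      a k * \<omega> m (e k) w + 1 * \<omega> m (\<lambda>c i. \<Sum>k\<in>A. a k * e k c i) w"
    by (rule two_form_linear_left[OF \<omega> m _ tangent_sum[OF insert(1)] w]) (use insert(4) in auto)
  then show ?case using insert by simp
qed

lemma two_form_anti:
  assumes \<omega>: "is_two_form M \<omega>" and m: "m \<in> points M" and u: "u \<in> tangent_space M m" and v: "v \<in> tangent_space M m"
  shows "\<omega> m u v = - \<omega> m v u"
proof -
  define s where "s = (\<lambda>c i. 1 * u c i + 1 * v c i)"
  have s: "s \<in> tangent_space M m" unfolding s_def by (rule tangent_lincomb[OF u v])
  note 0 = two_form_self[OF \<omega> m]
  have "\<omega> m s s = 1 * \<omega> m u s + 1 * \<omega> m v s"
    unfolding s_def by (rule two_form_linear_left[OF \<omega> m u v s[unfolded s_def]])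
  moreover have "\<omega> m u s = 1 * \<omega> m u u + 1 * \<omega> m u v" "\<omega> m v s = 1 * \<omega> m v u + 1 * \<omega> m v v"
    unfolding s_def by (rule two_form_linear_right[OF \<omega> m u v u], rule two_form_linear_right[OF \<omega> m u v v])
  ultimately have "\<omega> m u v + \<omega> m v u = 0" using 0[OF s] 0[OF u] 0[OF v] by simp
  then show ?thesis by (rule eq_neg_iff_add_eq_0[THEN iffD2])
qed

lemma two_form_sum_right:
  assumes \<omega>: "is_two_form M \<omega>" and m: "m \<in> points M" and w: "w \<in> tangent_space M m"
    and A: "finite A" "\<And>k. k \<in> A \<Longrightarrow> e k \<in> tangent_space M m"
  shows "\<omega> m w (\<lambda>c i. \<Sum>k\<in>A. a k * e k c i) = (\<Sum>k\<in>A. a k * \<omega> m w (e k))"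
proof -
  have "\<omega> m w (\<lambda>c i. \<Sum>k\<in>A. a k * e k c i) = - (\<Sum>k\<in>A. a k * \<omega> m (e k) w)"
    using two_form_anti[OF \<omega> m w tangent_sum[OF A]] two_form_sum_left[OF assms] by simp
  also have "\<dots> = (\<Sum>k\<in>A. a k * \<omega> m w (e k))"
    unfolding sum_negf[symmetric] using two_form_anti[OF \<omega> m w A(2)] by (intro sum.cong) auto
  finally show ?thesis .
qed

lemma two_form_expand:
  assumes M: "analytic_manifold M" and \<omega>: "is_two_form M \<omega>" and m: "m \<in> points M" and c: "c \<in> charts_at M m"
    and u: "u \<in> tangent_space M m" and v: "v \<in> tangent_space M m"
  shows "\<omega> m u v = (\<Sum>i<cdim c. \<Sum>j<cdim c. u c i * v c j * form_coeff M \<omega> c i j (cmap c m))"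
proof -
  let ?e = "\<lambda>i. coord_vector M c i m"
  have e: "?e i \<in> tangent_space M m" for i by (rule coord_vector_tangent[OF M c])
  have f: "form_coeff M \<omega> c i j (cmap c m) = \<omega> m (?e i) (?e j)" for i j
    by (simp add: form_coeff_def Let_def chart_inv_cmap[OF charts_at_chart[OF M c] charts_at_dom[OF c]])
  have "\<omega> m u v = (\<Sum>i<cdim c. u c i * \<omega> m (?e i) v)"
    by (subst tangent_expand[OF M c u]) (rule two_form_sum_left[OF \<omega> m v], use e in auto)
  also have "\<dots> = (\<Sum>i<cdim c. u c i * (\<Sum>j<cdim c. v c j * \<omega> m (?e i) (?e j)))"
  proof (rule sum.cong[OF refl])
    fix i
    have "\<omega> m (?e i) v = (\<Sum>j<cdim c. v c j * \<omega> m (?e i) (?e j))"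
      by (subst tangent_expand[OF M c v]) (rule two_form_sum_right[OF \<omega> m e], use e in auto)
    then show "u c i * \<omega> m (?e i) v = u c i * (\<Sum>j<cdim c. v c j * \<omega> m (?e i) (?e j))" by simp
  qed
  finally show ?thesis by (simp add: f sum_distrib_left mult.assoc)
qed

lemma form_coeff_anti:
  assumes M: "analytic_manifold M" and \<omega>: "is_two_form M \<omega>" and c: "c \<in> atlas M" and x: "x \<in> cmap c ` cdom c"
  shows "form_coeff M \<omega> c i j x = - form_coeff M \<omega> c j i x"
proof -
  define m where "m = chart_inv c x"
  have m: "m \<in> cdom c" unfolding m_def by (rule chart_inv_in_dom[OF x])
  have c': "c \<in> charts_at M m" using c m by (simp add: charts_at_def)
  have "m \<in> points M" using openin_subset[OF chart_dom_open[OF manifold_chart[OF M c]]] m by blast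
  then show ?thesis unfolding form_coeff_def Let_def m_def[symmetric]
    by (rule two_form_anti[OF \<omega> _ coord_vector_tangent[OF M c'] coord_vector_tangent[OF M c']])
qed

section \<open>Analytic functions and their differentials\<close>

definition fun_analytic_at :: "('a, 'p::prime_card) manifold \<Rightarrow> ('a \<Rightarrow> 'p padic) \<Rightarrow> 'a \<Rightarrow> bool" where
  "fun_analytic_at M f m \<longleftrightarrow> (\<forall>c\<in>charts_at M m. analytic_at (cdim c) (f \<circ> chart_inv c) (cmap c m))"

text \<open>One chart suffices because analytic functions compose with transition maps. Local
  primitives are built in a single chart and need exactly this.\<close>

lemma fun_analytic_atI:
  assumes M: "analytic_manifold M" and c: "c \<in> charts_at M m"
    and f: "analytic_at (cdim c) (f \<circ> chart_inv c) (cmap c m)"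
  shows "fun_analytic_at M f m"
  unfolding fun_analytic_at_def
proof
  fix e assume e: "e \<in> charts_at M m"
  have a: "cmap e m \<in> padic_space (cdim e)"
    by (rule chart_in_space[OF charts_at_chart[OF M e] charts_at_dom[OF e]])
  have em: "local_rep e c id (cmap e m) = cmap c m"
    using local_rep_cmap[OF charts_at_chart[OF M e] charts_at_dom[OF e], of c id] by simp
  obtain r where r: "r > 0" "\<And>x. x \<in> polydisc (cdim e) (cmap e m) r \<Longrightarrow> x \<in> cmap e ` cdom e \<and> id (chart_inv e x) \<in> cdom c"
    using analytic_map_at_polydisc[OF analytic_map_at_id[OF M] e _ M, of c] c by auto
  have "analytic_at (cdim e) (\<lambda>x. (f \<circ> chart_inv c) (local_rep e c id x)) (cmap e m)"
  proof (rule analytic_at_compose[where e = "cdim c" and f = "f \<circ> chart_inv c" and g = "local_rep e c id" and t = r])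
    show "analytic_at (cdim c) (f \<circ> chart_inv c) (local_rep e c id (cmap e m))" using f em by simp
    show "analytic_at (cdim e) (\<lambda>x. local_rep e c id x j) (cmap e m)" for j
      by (rule analytic_map_at_analytic[OF M M analytic_map_at_id[OF M] e]) (use c in simp)
    show "local_rep e c id x \<in> padic_space (cdim c)" if "x \<in> polydisc (cdim e) (cmap e m) r" for x
      using r(2)[OF that] chart_in_space[OF charts_at_chart[OF M c]] by (simp add: local_rep_def)
  qed (use a r in auto)
  then show "analytic_at (cdim e) (f \<circ> chart_inv e) (cmap e m)"
  proof (rule analytic_at_cong[OF _ r(1)])
    fix x assume "x \<in> polydisc (cdim e) (cmap e m) r"
    then have "chart_inv e x \<in> cdom c" using r(2) by simp
    then show "(f \<circ> chart_inv c) (local_rep e c id x) = (f \<circ> chart_inv e) x"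
      by (simp add: local_rep_def chart_inv_cmap[OF charts_at_chart[OF M c]])
  qed
qed

text \<open>The Jacobian that the chain rule produces for \<open>f\<close> is the one that carries
  the coordinates of \<open>v\<close> from \<open>chart_at M m\<close> to \<open>c\<close>.\<close>

lemma differential_chart:
  assumes M: "analytic_manifold M" and m: "m \<in> points M" and c: "c \<in> charts_at M m" and f: "fun_analytic_at M f m"
    and v: "v \<in> tangent_space M m"
  shows "differential M f m v = (\<Sum>l<cdim c. partial_deriv l (f \<circ> chart_inv c) (cmap c m) * v c l)"
proof -
  define e where "e = chart_at M m"
  have e: "e \<in> charts_at M m" unfolding e_def by (rule chart_at_in[OF M m])
  have a: "cmap e m \<in> padic_space (cdim e)"
    by (rule chart_in_space[OF charts_at_chart[OF M e] charts_at_dom[OF e]])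
  have em: "local_rep e c id (cmap e m) = cmap c m"
    using local_rep_cmap[OF charts_at_chart[OF M e] charts_at_dom[OF e], of c id] by simp
  obtain r where r: "r > 0" "\<And>x. x \<in> polydisc (cdim e) (cmap e m) r \<Longrightarrow> x \<in> cmap e ` cdom e \<and> id (chart_inv e x) \<in> cdom c"
    using analytic_map_at_polydisc[OF analytic_map_at_id[OF M] e _ M, of c] c by auto
  let ?D = "\<lambda>l. partial_deriv l (f \<circ> chart_inv c) (cmap c m)"
  let ?E = "\<lambda>l i. partial_deriv i (\<lambda>x. local_rep e c id x l) (cmap e m)"
  have "frechet (cdim e) (\<lambda>x. (f \<circ> chart_inv c) (local_rep e c id x)) (cmap e m) (\<lambda>i. \<Sum>l<cdim c. ?D l * ?E l i)"
  proof (rule frechet_compose[where \<rho> = r and f = "f \<circ> chart_inv c" and D = ?D and E = ?E and g = "local_rep e c id"])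
    have "analytic_at (cdim c) (f \<circ> chart_inv c) (cmap c m)" using f c by (simp add: fun_analytic_at_def)
    then show "frechet (cdim c) (f \<circ> chart_inv c) (local_rep e c id (cmap e m)) ?D"
      unfolding em by (rule analytic_at_frechet)
    show "frechet (cdim e) (\<lambda>x. local_rep e c id x j) (cmap e m) (?E j)" for j
      by (rule analytic_map_at_frechet[OF M M analytic_map_at_id[OF M] e]) (use c in simp)
    show "local_rep e c id x \<in> padic_space (cdim c)" if "x \<in> polydisc (cdim e) (cmap e m) r" for x
      using r(2)[OF that] chart_in_space[OF charts_at_chart[OF M c]] by (simp add: local_rep_def)
  qed (use a r in auto)
  then have "frechet (cdim e) (f \<circ> chart_inv e) (cmap e m) (\<lambda>i. \<Sum>l<cdim c. ?D l * ?E l i)"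
  proof (rule frechet_cong[OF _ r(1)])
    fix x assume "x \<in> polydisc (cdim e) (cmap e m) r"
    then have "chart_inv e x \<in> cdom c" using r(2) by simp
    then show "(f \<circ> chart_inv c) (local_rep e c id x) = (f \<circ> chart_inv e) x"
      by (simp add: local_rep_def chart_inv_cmap[OF charts_at_chart[OF M c]])
  qed
  then have p: "partial_deriv i (f \<circ> chart_inv e) (cmap e m) = (\<Sum>l<cdim c. ?D l * ?E l i)" if "i < cdim e" for i
    using that by (rule frechet_partial_deriv)
  have vc: "v c l = (\<Sum>i<cdim e. ?E l i * v e i)" for l
  proof -
    have "v c = total_deriv (cdim e) (local_rep e c id) (cmap e m) (v e)"
      by (rule tangent_transform[OF v e c])
    then show ?thesis by (simp only: total_deriv_def)
  qed
  have "differential M f m v = (\<Sum>i<cdim e. (\<Sum>l<cdim c. ?D l * ?E l i) * v e i)"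
    unfolding differential_def Let_def e_def[symmetric] by (rule sum.cong[OF refl]) (simp add: p)
  also have "\<dots> = (\<Sum>l<cdim c. ?D l * v c l)"
    unfolding vc sum_distrib_left sum_distrib_right by (subst sum.swap) (simp add: mult.assoc)
  finally show ?thesis .
qed

lemma chart_local_eq:
  assumes M: "analytic_manifold M" and c: "c \<in> charts_at M m" and N: "openin (mtop M) N" "m \<in> N"
    and eq: "\<And>y. y \<in> N \<Longrightarrow> f y = g y"
  shows "\<exists>r>0. \<forall>x\<in>polydisc (cdim c) (cmap c m) r. (f \<circ> chart_inv c) x = (g \<circ> chart_inv c) x"
proof -
  obtain r where r: "r > 0" "polydisc (cdim c) (cmap c m) r \<subseteq> cmap c ` (N \<inter> cdom c)"
    using chart_polydisc[OF charts_at_chart[OF M c] N charts_at_dom[OF c]] by blast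
  have "(f \<circ> chart_inv c) x = (g \<circ> chart_inv c) x" if x: "x \<in> polydisc (cdim c) (cmap c m) r" for x
  proof -
    obtain y where "y \<in> N" "y \<in> cdom c" "x = cmap c y" using x r(2) by blast
    then show ?thesis using eq chart_inv_cmap[OF charts_at_chart[OF M c]] by simp
  qed
  then show ?thesis using r(1) by blast
qed

lemma fun_analytic_at_cong:
  assumes M: "analytic_manifold M" and N: "openin (mtop M) N" "m \<in> N" "\<And>y. y \<in> N \<Longrightarrow> f y = g y"
    and f: "fun_analytic_at M f m"
  shows "fun_analytic_at M g m"
  unfolding fun_analytic_at_def
proof
  fix c assume c: "c \<in> charts_at M m"
  obtain r where r: "r > 0" "\<And>x. x \<in> polydisc (cdim c) (cmap c m) r \<Longrightarrow> (f \<circ> chart_inv c) x = (g \<circ> chart_inv c) x"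
    using chart_local_eq[OF M c N(1,2), of f g] N(3) by blast
  have "analytic_at (cdim c) (f \<circ> chart_inv c) (cmap c m)" using f c by (simp add: fun_analytic_at_def)
  then show "analytic_at (cdim c) (g \<circ> chart_inv c) (cmap c m)" using r by (rule analytic_at_cong)
qed

text \<open>The differential sees only the germ of \<open>f\<close>. Together with
  \<open>fun_analytic_at_cong\<close> this lets a locally constant choice of primitives inherit
  their properties.\<close>

lemma differential_cong:
  assumes M: "analytic_manifold M" and N: "openin (mtop M) N" "m \<in> N" "\<And>y. y \<in> N \<Longrightarrow> f y = g y"
  shows "differential M f m v = differential M g m v"
proof -
  have m: "m \<in> points M" using openin_subset[OF N(1)] N(2) by blast
  have c: "chart_at M m \<in> charts_at M m" by (rule chart_at_in[OF M m])
  obtain r where r: "r > 0" "\<And>x. x \<in> polydisc (cdim (chart_at M m)) (cmap (chart_at M m) m) r \<Longrightarrow>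
      (f \<circ> chart_inv (chart_at M m)) x = (g \<circ> chart_inv (chart_at M m)) x"
    using chart_local_eq[OF M c N(1,2), of f g] N(3) by blast
  show ?thesis unfolding differential_def Let_def
    by (intro sum.cong refl arg_cong2[where f = "(*)"] partial_deriv_cong[OF r(1) chart_in_space[OF charts_at_chart[OF M c] charts_at_dom[OF c]]])
       (use r(2) in auto)
qed

lemma fun_analytic_at_sum:
  assumes M: "analytic_manifold M" and f: "\<And>a. a \<in> A \<Longrightarrow> fun_analytic_at M (f a) m"
  shows "fun_analytic_at M (\<lambda>m. \<Sum>a\<in>A. f a m * k a) m"
  unfolding fun_analytic_at_def
proof
  fix c assume c: "c \<in> charts_at M m"
  have a: "cmap c m \<in> padic_space (cdim c)"
    by (rule chart_in_space[OF charts_at_chart[OF M c] charts_at_dom[OF c]])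
  have "analytic_at (cdim c) (\<lambda>x. \<Sum>a\<in>A. (f a \<circ> chart_inv c) x * k a) (cmap c m)"
    by (intro analytic_at_sum[OF a] analytic_at_mult analytic_at_const[OF a])
       (rule bspec[OF f[unfolded fun_analytic_at_def] c])
  then show "analytic_at (cdim c) ((\<lambda>m. \<Sum>a\<in>A. f a m * k a) \<circ> chart_inv c) (cmap c m)"
    by (simp add: o_def)
qed

lemma differential_sum:
  assumes M: "analytic_manifold M" and m: "m \<in> points M" and f: "\<And>a. a \<in> A \<Longrightarrow> fun_analytic_at M (f a) m"
  shows "differential M (\<lambda>m. \<Sum>a\<in>A. f a m * k a) m v = (\<Sum>a\<in>A. k a * differential M (f a) m v)"
proof -
  define c where "c = chart_at M m"
  have c: "c \<in> charts_at M m" unfolding c_def by (rule chart_at_in[OF M m])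
  have a: "cmap c m \<in> padic_space (cdim c)"
    by (rule chart_in_space[OF charts_at_chart[OF M c] charts_at_dom[OF c]])
  have "partial_deriv i ((\<lambda>m. \<Sum>a\<in>A. f a m * k a) \<circ> chart_inv c) (cmap c m) =
      (\<Sum>a\<in>A. partial_deriv i (f a \<circ> chart_inv c) (cmap c m) * k a)" if i: "i < cdim c" for i
  proof -
    have "frechet (cdim c) (\<lambda>x. \<Sum>a\<in>A. (f a \<circ> chart_inv c) x * k a) (cmap c m)
      (\<lambda>i. \<Sum>a\<in>A. partial_deriv i (f a \<circ> chart_inv c) (cmap c m) * k a + (f a \<circ> chart_inv c) (cmap c m) * 0)"
      by (intro frechet_sum[OF a] frechet_mult frechet_const[OF a] analytic_at_frechet)
         (rule bspec[OF f[unfolded fun_analytic_at_def] c])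
    from frechet_partial_deriv[OF this i] show ?thesis by (simp add: o_def)
  qed
  then have "differential M (\<lambda>m. \<Sum>a\<in>A. f a m * k a) m v =
      (\<Sum>i<cdim c. (\<Sum>a\<in>A. partial_deriv i (f a \<circ> chart_inv c) (cmap c m) * k a) * v c i)"
    unfolding differential_def Let_def c_def[symmetric] by simp
  also have "\<dots> = (\<Sum>a\<in>A. k a * differential M (f a) m v)"
    unfolding differential_def Let_def c_def[symmetric] sum_distrib_left sum_distrib_right
    by (subst sum.swap) (simp add: mult_ac)
  finally show ?thesis .
qed

section \<open>Lie group actions and local momentum functions\<close>

lemma cdim_prod_chart [simp]: "cdim (prod_chart c c') = cdim c + cdim c'"
  by (simp add: prod_chart_def)

lemma cdom_prod_chart [simp]: "cdom (prod_chart c c') = cdom c \<times> cdom c'"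
  by (simp add: prod_chart_def)

lemma cmap_prod_chart: "cmap (prod_chart c c') (g, m) = concat_coords (cdim c) (cmap c g) (cmap c' m)"
  by (simp add: prod_chart_def concat_coords_def fun_eq_iff)

lemma chart_inv_prod_chart:
  assumes c: "is_chart X c" "is_chart Y c'" and y: "y \<in> cmap c ` cdom c" and x: "x \<in> cmap c' ` cdom c'"
  shows "chart_inv (prod_chart c c') (concat_coords (cdim c) y x) = (chart_inv c y, chart_inv c' x)"
proof -
  have inj: "inj_on (cmap (prod_chart c c')) (cdom c \<times> cdom c')"
  proof (rule inj_onI, clarify)
    fix g m g' m' assume "g \<in> cdom c" "g' \<in> cdom c" "m \<in> cdom c'" "m' \<in> cdom c'"
      and "cmap (prod_chart c c') (g, m) = cmap (prod_chart c c') (g', m')"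
    then show "g = g' \<and> m = m'"
      using concat_coords_eq_iff[OF chart_in_space[OF c(1)] chart_in_space[OF c(1)]]
        inj_onD[OF chart_inj[OF c(1)]] inj_onD[OF chart_inj[OF c(2)]] by (simp add: cmap_prod_chart)
  qed
  have "cmap (prod_chart c c') (chart_inv c y, chart_inv c' x) = concat_coords (cdim c) y x"
    by (simp add: cmap_prod_chart cmap_chart_inv[OF y] cmap_chart_inv[OF x])
  moreover have "(chart_inv c y, chart_inv c' x) \<in> cdom c \<times> cdom c'"
    using chart_inv_in_dom[OF y] chart_inv_in_dom[OF x] by simp
  ultimately show ?thesis
    using inv_into_f_f[OF inj] unfolding chart_inv_def[of "prod_chart c c'"] cdom_prod_chart by metis
qed

lemma tate_concat_coords_left:
  assumes f: "tate (k + d) (concat_coords k y0 x0) r B f" and x: "x \<in> polydisc d x0 r" and y0: "y0 \<in> padic_space k"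
  shows "tate k y0 r B (\<lambda>y. f (concat_coords k y x))"
proof (rule tate_compose[OF f y0])
  show r: "r > 0" by (rule tate_radius[OF f])
  fix j assume j: "j < k + d"
  show "tate k y0 r r (\<lambda>y. concat_coords k y x j - concat_coords k y0 x0 j)"
  proof (cases "j < k")
    case True
    then show ?thesis using tate_coord[OF y0 r True] by (simp add: concat_coords_def)
  next
    case False
    then show ?thesis
      using tate_mono[OF tate_const[OF y0 r, of "x (j - k) - x0 (j - k)"], of r] x j by (simp add: concat_coords_def polydisc_def)
  qed
qed (use x in \<open>simp add: concat_coords_in_space polydisc_in_space\<close>)

section \<open>The action in coordinates\<close>

lemma lie_group_manifold: "lie_group G \<G> \<Longrightarrow> analytic_manifold \<G>"
  and lie_group_points: "lie_group G \<G> \<Longrightarrow> points \<G> = carrier G"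
  and lie_group_one: "lie_group G \<G> \<Longrightarrow> \<one>\<^bsub>G\<^esub> \<in> points \<G>"
  by (auto simp: lie_group_def group.is_monoid monoid.one_closed)

lemma action_one:
  assumes "lie_group_action G \<G> M \<psi>" "m \<in> points M"
  shows "\<psi> \<one>\<^bsub>G\<^esub> m = m"
proof -
  have "group_action G (points M) \<psi>" using assms(1) unfolding lie_group_action_def by (elim conjE)
  from group_action.id_eq_one[OF this] show ?thesis using assms(2) by (metis restrict_apply')
qed

text \<open>Polydiscs of one radius in the two factors join to a polydisc in the product chart, so
  group element and point vary independently. Freezing one of them yields the translations and the
  orbit maps.\<close>

lemma action_local:
  assumes \<G>: "analytic_manifold \<G>" and M: "analytic_manifold M" and act: "lie_group_action G \<G> M \<psi>"
    and c: "c \<in> charts_at \<G> g" and c': "c' \<in> charts_at M m" and c'': "c'' \<in> charts_at M (\<psi> g m)"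
  defines "F \<equiv> local_rep (prod_chart c c') c'' (\<lambda>(g, m). \<psi> g m)"
    and "k \<equiv> cdim c" and "d \<equiv> cdim c'" and "y0 \<equiv> cmap c g" and "x0 \<equiv> cmap c' m"
  shows "\<exists>r>0. (\<forall>j<cdim c''. \<exists>B. tate (k + d) (concat_coords k y0 x0) r B (\<lambda>z. F z j)) \<and>
    polydisc k y0 r \<subseteq> cmap c ` cdom c \<and> polydisc d x0 r \<subseteq> cmap c' ` cdom c' \<and>
    (\<forall>y\<in>polydisc k y0 r. \<forall>x\<in>polydisc d x0 r. \<psi> (chart_inv c y) (chart_inv c' x) \<in> cdom c'' \<and>
       F (concat_coords k y x) = cmap c'' (\<psi> (chart_inv c y) (chart_inv c' x)))"
proof -
  let ?\<Psi> = "\<lambda>(g, m). \<psi> g m" and ?P = "prod_chart c c'"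
  have ch: "is_chart (mtop \<G>) c" "is_chart (mtop M) c'" "is_chart (mtop M) c''"
    using charts_at_chart[OF \<G> c] charts_at_chart[OF M c'] charts_at_chart[OF M c''] .
  have gm: "g \<in> cdom c" "m \<in> cdom c'" "\<psi> g m \<in> cdom c''"
    using charts_at_dom[OF c] charts_at_dom[OF c'] charts_at_dom[OF c''] .
  have y0: "y0 \<in> padic_space k" and x0: "x0 \<in> padic_space d"
    unfolding y0_def k_def x0_def d_def by (rule chart_in_space[OF ch(1) gm(1)], rule chart_in_space[OF ch(2) gm(2)])
  define U where "U = cmap ?P ` (cdom ?P \<inter> ?\<Psi> -` cdom c'')"
  have P: "?P \<in> atlas (prod_manifold \<G> M)"
    using charts_at_atlas[OF c] charts_at_atlas[OF c'] by (auto simp: prod_manifold_def)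
  have an: "analytic_between (k + d) (cdim c'') F U"
  proof -
    have "\<forall>c\<in>atlas (prod_manifold \<G> M). \<forall>c'\<in>atlas M.
        analytic_between (cdim c) (cdim c') (local_rep c c' ?\<Psi>) (cmap c ` (cdom c \<inter> ?\<Psi> -` cdom c'))"
      using act unfolding lie_group_action_def analytic_map_def by (elim conjE)
    from this[THEN bspec, OF P, THEN bspec, OF charts_at_atlas[OF c'']]
    show ?thesis unfolding F_def U_def k_def d_def by (simp only: cdim_prod_chart)
  qed
  have z0: "concat_coords k y0 x0 \<in> U"
    unfolding U_def k_def y0_def x0_def cmap_prod_chart[symmetric] using gm by (intro imageI) simp
  obtain r1 where r1: "r1 > 0" "polydisc (k + d) (concat_coords k y0 x0) r1 \<subseteq> U"
    using openin_padic_space_polydisc[OF conjunct1[OF an[unfolded analytic_between_def]] z0] by (elim exE conjE) (rule that)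
  have "analytic_at (k + d) (\<lambda>z. F z j) (concat_coords k y0 x0)" if "j < cdim c''" for j
    by (rule analytic_scalar_imp_analytic_at[OF _ z0]) (use an that in \<open>simp add: analytic_between_def\<close>)
  then obtain r2 where r2: "r2 > 0" "\<And>j. j < cdim c'' \<Longrightarrow> \<exists>B. tate (k + d) (concat_coords k y0 x0) r2 B (\<lambda>z. F z j)"
    using analytic_at_common_radius[of "cdim c''" "k + d" "\<lambda>j z. F z j" "concat_coords k y0 x0"] by blast
  define r where "r = min r1 r2"
  have r: "r > 0" "r \<le> r1" "r \<le> r2" using r1 r2 by (auto simp: r_def)
  have yx: "y \<in> cmap c ` cdom c \<and> x \<in> cmap c' ` cdom c' \<and> \<psi> (chart_inv c y) (chart_inv c' x) \<in> cdom c''"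
    if y: "y \<in> polydisc k y0 r" and x: "x \<in> polydisc d x0 r" for y x
  proof -
    have "concat_coords k y x \<in> U"
      using concat_coords_in_polydisc[OF y x] polydisc_mono[OF r(2), of "k + d" "concat_coords k y0 x0"] r1(2) by blast
    then obtain g' m' where g': "g' \<in> cdom c" "m' \<in> cdom c'" "\<psi> g' m' \<in> cdom c''"
        "concat_coords k y x = concat_coords k (cmap c g') (cmap c' m')"
      by (auto simp: U_def cmap_prod_chart k_def)
    \<comment> \<open>The joined sequence determines both parts, as \<open>y\<close> and
      \<open>cmap c g'\<close> vanish from index \<open>k\<close> on.\<close>
    have "y = cmap c g' \<and> x = cmap c' m'"
      using g'(4) concat_coords_eq_iff[OF polydisc_in_space[OF y] chart_in_space[OF ch(1) g'(1), folded k_def]] by simp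
    then show ?thesis
      using g' chart_inv_cmap[OF ch(1) g'(1)] chart_inv_cmap[OF ch(2) g'(2)] by simp
  qed
  have y0p: "y0 \<in> polydisc k y0 r" and x0p: "x0 \<in> polydisc d x0 r"
    using y0 x0 r by (auto intro: polydisc_center)
  show ?thesis
  proof (rule exI[of _ r], intro conjI ballI allI impI r(1))
    show "\<exists>B. tate (k + d) (concat_coords k y0 x0) r B (\<lambda>z. F z j)" if "j < cdim c''" for j
      using r2(2)[OF that] tate_shrink[OF _ r(1,3)] by blast
    show "polydisc k y0 r \<subseteq> cmap c ` cdom c" using yx x0p by blast
    show "polydisc d x0 r \<subseteq> cmap c' ` cdom c'" using yx y0p by blast
    fix y x assume y: "y \<in> polydisc k y0 r" and x: "x \<in> polydisc d x0 r"
    show "\<psi> (chart_inv c y) (chart_inv c' x) \<in> cdom c''" using yx[OF y x] by blast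
    show "F (concat_coords k y x) = cmap c'' (\<psi> (chart_inv c y) (chart_inv c' x))"
      using chart_inv_prod_chart[OF ch(1,2)] yx[OF y x] by (simp add: F_def k_def local_rep_def)
  qed
qed

text \<open>The group coordinates of the action map are frozen at those of \<open>g\<close>; the
  chart at \<open>g\<close> is only auxiliary.\<close>

lemma analytic_map_at_action:
  assumes G: "lie_group G \<G>" and M: "analytic_manifold M" and act: "lie_group_action G \<G> M \<psi>"
    and g: "g \<in> carrier G"
  shows "analytic_map_at M M (\<psi> g) m"
  unfolding analytic_map_at_def
proof (intro ballI)
  have \<G>: "analytic_manifold \<G>" by (rule lie_group_manifold[OF G])
  define c where "c = chart_at \<G> g"
  have c: "c \<in> charts_at \<G> g" unfolding c_def by (rule chart_at_in[OF \<G>]) (simp add: lie_group_points[OF G] g)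
  fix c' c'' assume c': "c' \<in> charts_at M m" and c'': "c'' \<in> charts_at M (\<psi> g m)"
  let ?F = "local_rep (prod_chart c c') c'' (\<lambda>(g, m). \<psi> g m)"
  obtain r where r: "r > 0" "\<And>j. j < cdim c'' \<Longrightarrow> \<exists>B. tate (cdim c + cdim c') (concat_coords (cdim c) (cmap c g) (cmap c' m)) r B (\<lambda>z. ?F z j)"
    "polydisc (cdim c') (cmap c' m) r \<subseteq> cmap c' ` cdom c'"
    "\<And>y x. y \<in> polydisc (cdim c) (cmap c g) r \<Longrightarrow> x \<in> polydisc (cdim c') (cmap c' m) r \<Longrightarrow>
      \<psi> (chart_inv c y) (chart_inv c' x) \<in> cdom c'' \<and> ?F (concat_coords (cdim c) y x) = cmap c'' (\<psi> (chart_inv c y) (chart_inv c' x))"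
    using action_local[OF \<G> M act c c' c''] by blast
  have chc: "is_chart (mtop \<G>) c" and chc': "is_chart (mtop M) c'"
    using charts_at_chart[OF \<G> c] charts_at_chart[OF M c'] .
  have y0: "cmap c g \<in> padic_space (cdim c)" by (rule chart_in_space[OF chc charts_at_dom[OF c]])
  have x0: "cmap c' m \<in> padic_space (cdim c')" by (rule chart_in_space[OF chc' charts_at_dom[OF c']])
  have y0p: "cmap c g \<in> polydisc (cdim c) (cmap c g) r" using y0 r(1) by (intro polydisc_center) auto
  have cg: "chart_inv c (cmap c g) = g" by (rule chart_inv_cmap[OF chc charts_at_dom[OF c]])
  show "(\<exists>r>0. polydisc (cdim c') (cmap c' m) r \<subseteq> cmap c' ` (cdom c' \<inter> \<psi> g -` cdom c'')) \<and>
       (\<forall>j<cdim c''. analytic_at (cdim c') (\<lambda>x. local_rep c' c'' (\<psi> g) x j) (cmap c' m))"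
  proof (intro conjI allI impI)
    have "x \<in> cmap c' ` (cdom c' \<inter> \<psi> g -` cdom c'')" if x: "x \<in> polydisc (cdim c') (cmap c' m) r" for x
    proof -
      have "x \<in> cmap c' ` cdom c'" using x r(3) by blast
      moreover have "\<psi> g (chart_inv c' x) \<in> cdom c''" using r(4)[OF y0p x] cg by simp
      ultimately show ?thesis
        by (intro image_eqI[of _ _ "chart_inv c' x"]) (auto simp: cmap_chart_inv chart_inv_in_dom)
    qed
    then show "\<exists>r>0. polydisc (cdim c') (cmap c' m) r \<subseteq> cmap c' ` (cdom c' \<inter> \<psi> g -` cdom c'')"
      using r(1) by blast
    fix j assume "j < cdim c''"
    then obtain B where "tate (cdim c + cdim c') (concat_coords (cdim c) (cmap c g) (cmap c' m)) r B (\<lambda>z. ?F z j)"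
      using r(2) by blast
    from tate_concat_coords_right[OF this y0p x0]
    have "analytic_at (cdim c') (\<lambda>x. ?F (concat_coords (cdim c) (cmap c g) x) j) (cmap c' m)"
      unfolding analytic_at_def by blast
    then show "analytic_at (cdim c') (\<lambda>x. local_rep c' c'' (\<psi> g) x j) (cmap c' m)"
      by (rule analytic_at_cong[OF _ r(1)]) (use r(4)[OF y0p] cg in \<open>simp add: local_rep_def\<close>)
  qed
qed

lemma analytic_map_at_orbit:
  assumes G: "lie_group G \<G>" and M: "analytic_manifold M" and act: "lie_group_action G \<G> M \<psi>"
    and m: "m \<in> points M"
  shows "analytic_map_at \<G> M (\<lambda>g. \<psi> g m) g"
  unfolding analytic_map_at_def
proof (intro ballI)
  have \<G>: "analytic_manifold \<G>" by (rule lie_group_manifold[OF G])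
  define c' where "c' = chart_at M m"
  have c': "c' \<in> charts_at M m" unfolding c'_def by (rule chart_at_in[OF M m])
  fix c c'' assume c: "c \<in> charts_at \<G> g" and c'': "c'' \<in> charts_at M (\<psi> g m)"
  let ?F = "local_rep (prod_chart c c') c'' (\<lambda>(g, m). \<psi> g m)"
  obtain r where r: "r > 0" "\<And>j. j < cdim c'' \<Longrightarrow> \<exists>B. tate (cdim c + cdim c') (concat_coords (cdim c) (cmap c g) (cmap c' m)) r B (\<lambda>z. ?F z j)"
    "polydisc (cdim c) (cmap c g) r \<subseteq> cmap c ` cdom c"
    "\<And>y x. y \<in> polydisc (cdim c) (cmap c g) r \<Longrightarrow> x \<in> polydisc (cdim c') (cmap c' m) r \<Longrightarrow>
      \<psi> (chart_inv c y) (chart_inv c' x) \<in> cdom c'' \<and> ?F (concat_coords (cdim c) y x) = cmap c'' (\<psi> (chart_inv c y) (chart_inv c' x))"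
    using action_local[OF \<G> M act c c' c''] by blast
  have chc: "is_chart (mtop \<G>) c" and chc': "is_chart (mtop M) c'"
    using charts_at_chart[OF \<G> c] charts_at_chart[OF M c'] .
  have y0: "cmap c g \<in> padic_space (cdim c)" by (rule chart_in_space[OF chc charts_at_dom[OF c]])
  have x0: "cmap c' m \<in> padic_space (cdim c')" by (rule chart_in_space[OF chc' charts_at_dom[OF c']])
  have x0p: "cmap c' m \<in> polydisc (cdim c') (cmap c' m) r" using x0 r(1) by (intro polydisc_center) auto
  have cm: "chart_inv c' (cmap c' m) = m" by (rule chart_inv_cmap[OF chc' charts_at_dom[OF c']])
  show "(\<exists>r>0. polydisc (cdim c) (cmap c g) r \<subseteq> cmap c ` (cdom c \<inter> (\<lambda>g. \<psi> g m) -` cdom c'')) \<and>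
       (\<forall>j<cdim c''. analytic_at (cdim c) (\<lambda>y. local_rep c c'' (\<lambda>g. \<psi> g m) y j) (cmap c g))"
  proof (intro conjI allI impI)
    have "y \<in> cmap c ` (cdom c \<inter> (\<lambda>g. \<psi> g m) -` cdom c'')" if y: "y \<in> polydisc (cdim c) (cmap c g) r" for y
    proof -
      have "y \<in> cmap c ` cdom c" using y r(3) by blast
      moreover have "\<psi> (chart_inv c y) m \<in> cdom c''" using r(4)[OF y x0p] cm by simp
      ultimately show ?thesis
        by (intro image_eqI[of _ _ "chart_inv c y"]) (auto simp: cmap_chart_inv chart_inv_in_dom)
    qed
    then show "\<exists>r>0. polydisc (cdim c) (cmap c g) r \<subseteq> cmap c ` (cdom c \<inter> (\<lambda>g. \<psi> g m) -` cdom c'')"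
      using r(1) by blast
    fix j assume "j < cdim c''"
    then obtain B where "tate (cdim c + cdim c') (concat_coords (cdim c) (cmap c g) (cmap c' m)) r B (\<lambda>z. ?F z j)"
      using r(2) by blast
    from tate_concat_coords_left[OF this x0p y0]
    have "analytic_at (cdim c) (\<lambda>y. ?F (concat_coords (cdim c) y (cmap c' m)) j) (cmap c g)"
      unfolding analytic_at_def by blast
    then show "analytic_at (cdim c) (\<lambda>y. local_rep c c'' (\<lambda>g. \<psi> g m) y j) (cmap c g)"
      by (rule analytic_at_cong[OF _ r(1)]) (use r(4)[OF _ x0p] cm in \<open>simp add: local_rep_def\<close>)
  qed
qed

lemma generated_field_tangent:
  assumes G: "lie_group G \<G>" and M: "analytic_manifold M" and act: "lie_group_action G \<G> M \<psi>"
    and m: "m \<in> points M"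
  shows "generated_field G \<G> M \<psi> \<xi> m \<in> tangent_space M m"
  using push_forward_tangent[OF lie_group_manifold[OF G] M analytic_map_at_orbit[OF G M act m] lie_group_one[OF G]]
  unfolding generated_field_def action_one[OF act m] .

section \<open>Local momentum functions\<close>

text \<open>One neighbourhood serves all directions \<open>a\<close>, so that a single later
  selection picks a whole tuple of primitives. The chart of the group is the one that
  \<open>push_forward\<close> uses at the identity, so generated fields unfold directly.\<close>

lemma local_momentum:
  assumes G: "lie_group G \<G>" and M: "analytic_manifold M" and \<omega>: "analytic_two_form M \<omega>"
    and closed: "closed_two_form M \<omega>" and symp: "symplectic_action G \<G> M \<omega> \<psi>" and m0: "m0 \<in> points M"
  shows "\<exists>N. openin (mtop M) N \<and> m0 \<in> N \<and> (\<exists>f. \<forall>m\<in>N. \<forall>a<cdim (chart_at \<G> \<one>\<^bsub>G\<^esub>).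
    fun_analytic_at M (f a) m \<and> (\<forall>v\<in>tangent_space M m. differential M (f a) m v =
      \<omega> m (generated_field G \<G> M \<psi> (coord_vector \<G> (chart_at \<G> \<one>\<^bsub>G\<^esub>) a \<one>\<^bsub>G\<^esub>) m) v))"
proof -
  have \<G>: "analytic_manifold \<G>" by (rule lie_group_manifold[OF G])
  have act: "lie_group_action G \<G> M \<psi>" using symp by (simp add: symplectic_action_def)
  have tf: "is_two_form M \<omega>" using \<omega> by (simp add: analytic_two_form_def)
  define b where "b = chart_at \<G> \<one>\<^bsub>G\<^esub>"
  have b: "b \<in> charts_at \<G> \<one>\<^bsub>G\<^esub>" unfolding b_def by (rule chart_at_in[OF \<G> lie_group_one[OF G]])
  define c where "c = chart_at M m0"
  have c: "c \<in> charts_at M m0" unfolding c_def by (rule chart_at_in[OF M m0])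
  have c1: "c \<in> charts_at M (\<psi> \<one>\<^bsub>G\<^esub> m0)" using c action_one[OF act m0] by simp
  have ca: "c \<in> atlas M" by (rule charts_at_atlas[OF c])
  have chb: "is_chart (mtop \<G>) b" and chc: "is_chart (mtop M) c"
    using charts_at_chart[OF \<G> b] charts_at_chart[OF M c] .
  define k where "k = cdim b"
  define d where "d = cdim c"
  define y0 where "y0 = cmap b \<one>\<^bsub>G\<^esub>"
  define x0 where "x0 = cmap c m0"
  define F where "F = local_rep (prod_chart b c) c (\<lambda>(g, m). \<psi> g m)"
  define w where "w = form_coeff M \<omega> c"
  have y0: "y0 \<in> padic_space k" unfolding y0_def k_def by (rule chart_in_space[OF chb charts_at_dom[OF b]])
  have x0: "x0 \<in> padic_space d" unfolding x0_def d_def by (rule chart_in_space[OF chc charts_at_dom[OF c]])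
  have by0: "chart_inv b y0 = \<one>\<^bsub>G\<^esub>" unfolding y0_def by (rule chart_inv_cmap[OF chb charts_at_dom[OF b]])
  obtain r1 where r1': "r1 > 0" "\<forall>j<d. \<exists>B. tate (k + d) (concat_coords k y0 x0) r1 B (\<lambda>z. F z j)"
    "polydisc k y0 r1 \<subseteq> cmap b ` cdom b" "polydisc d x0 r1 \<subseteq> cmap c ` cdom c"
    "\<forall>y\<in>polydisc k y0 r1. \<forall>x\<in>polydisc d x0 r1.
      \<psi> (chart_inv b y) (chart_inv c x) \<in> cdom c \<and> F (concat_coords k y x) = cmap c (\<psi> (chart_inv b y) (chart_inv c x))"
    using action_local[OF \<G> M act b c c1, folded k_def d_def y0_def x0_def F_def]
    by (elim exE conjE) (rule that)
  note r1 = r1'(1) r1'(2)[rule_format] r1'(3,4) r1'(5)[rule_format]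
  have w_an: "analytic_at d (w i j) x0" if "i < d" "j < d" for i j
  proof (rule analytic_scalar_imp_analytic_at)
    show "analytic_scalar d (w i j) (cmap c ` cdom c)"
      using conjunct2[OF \<omega>[unfolded analytic_two_form_def], THEN bspec, OF ca] that unfolding w_def d_def by simp
    show "x0 \<in> cmap c ` cdom c" unfolding x0_def using charts_at_dom[OF c] by blast
  qed
  have "\<exists>r>0. \<forall>i<d. \<forall>j<d. \<exists>B. tate d x0 r B (w i j)"
  proof (rule common_radius)
    show "\<exists>r>0. \<forall>j<d. \<exists>B. tate d x0 r B (w i j)" if "i < d" for i
      by (rule analytic_at_common_radius) (rule w_an[OF that])
    show "\<forall>j<d. \<exists>B. tate d x0 s B (w i j)" if "\<forall>j<d. \<exists>B. tate d x0 r B (w i j)" "0 < s" "s \<le> r" for i r s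
      using that tate_shrink[OF _ that(2,3)] by blast
  qed
  then obtain r2 where r2: "r2 > 0" "\<And>i j. i < d \<Longrightarrow> j < d \<Longrightarrow> \<exists>B. tate d x0 r2 B (w i j)" by blast
  define r where "r = min r1 r2"
  have r: "r > 0" "r \<le> r1" "r \<le> r2" using r1(1) r2(1) by (auto simp: r_def)
  have y_img: "y \<in> cmap b ` cdom b" if "y \<in> polydisc k y0 r" for y
    using that r1(3) polydisc_mono[OF r(2), of k y0] by blast
  have x_img: "x \<in> cmap c ` cdom c" if "x \<in> polydisc d x0 r" for x
    using that r1(4) polydisc_mono[OF r(2), of d x0] by blast
  have F_eq: "\<psi> (chart_inv b y) (chart_inv c x) \<in> cdom c" "F (concat_coords k y x) = cmap c (\<psi> (chart_inv b y) (chart_inv c x))"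
    if "y \<in> polydisc k y0 r" "x \<in> polydisc d x0 r" for y x
    using r1(5)[of y x] that polydisc_mono[OF r(2), of k y0] polydisc_mono[OF r(2), of d x0] by blast+
  have y0p: "y0 \<in> polydisc k y0 r" using y0 r by (intro polydisc_center) auto
  have cdom_points: "m \<in> points M" if "m \<in> cdom c" for m
    using that openin_subset[OF chart_dom_open[OF chc]] by blast
  have c_at: "c \<in> charts_at M m" if "m \<in> cdom c" for m using that ca by (simp add: charts_at_def)
  have prim: "\<exists>h B. tate d x0 (r / 2) B h \<and> (\<forall>j<d. \<forall>x\<in>polydisc d x0 (r / 2).
      partial_deriv j h x = (\<Sum>i<d. partial_deriv a (\<lambda>z. F z i) (concat_coords k y0 x) * w i j x))" if a: "a < k" for a
  proof (rule momentum_primitive_coord[OF y0 x0 r(1) _ _ _ _ _ _ _ a])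
    show "\<exists>B. tate (k + d) (concat_coords k y0 x0) r B (\<lambda>z. F z j)" if "j < d" for j
      using r1(2)[OF that] tate_shrink[OF _ r(1,2)] by blast
    show "\<exists>B. tate d x0 r B (w i j)" if "i < d" "j < d" for i j
      using r2(2)[OF that] tate_shrink[OF _ r(1,3)] by blast
    show "w i j x = - w j i x" if "x \<in> polydisc d x0 r" for x i j
      unfolding w_def by (rule form_coeff_anti[OF M tf ca x_img[OF that]])
    show "partial_deriv i (w j l) x - partial_deriv j (w i l) x + partial_deriv l (w i j) x = 0"
      if "x \<in> polydisc d x0 r" "i < d" "j < d" "l < d" for x i j l
      using closed[unfolded closed_two_form_def, THEN bspec, OF ca, rule_format,
          OF that(2)[unfolded d_def] that(3)[unfolded d_def] that(4)[unfolded d_def] x_img[OF that(1)]]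
      unfolding ext_deriv_coeff_def w_def .
    show "F (concat_coords k y0 x) = x" if x: "x \<in> polydisc d x0 r" for x
      using F_eq(2)[OF y0p x] by0 action_one[OF act cdom_points[OF chart_inv_in_dom[OF x_img[OF x]]]]
        cmap_chart_inv[OF x_img[OF x]] by simp
    show "F z \<in> padic_space d" if z: "z \<in> polydisc (k + d) (concat_coords k y0 x0) r" for z
    proof -
      define y where "y i = (if i < k then z i else 0)" for i
      define x where "x i = z (k + i)" for i
      have "z = concat_coords k y x" by (simp add: fun_eq_iff concat_coords_def y_def x_def)
      moreover have "y \<in> polydisc k y0 r"
      proof -
        have "padic_norm (z i - y0 i) \<le> r" if "i < k" for i
          using z that by (auto simp: polydisc_def concat_coords_def dest: spec[of _ i])
        then show ?thesis by (simp add: polydisc_def y_def padic_space_def)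
      qed
      moreover have "x \<in> polydisc d x0 r"
      proof -
        have "padic_norm (z (k + i) - x0 i) \<le> r" if "i < d" for i
          using z that by (auto simp: polydisc_def concat_coords_def dest: spec[of _ "k + i"])
        then show ?thesis using polydisc_in_space[OF z] by (simp add: polydisc_def x_def padic_space_def)
      qed
      ultimately show ?thesis using F_eq[of y x] chart_in_space[OF chc] by (simp add: d_def)
    qed
    fix y x i j assume y: "y \<in> polydisc k y0 r" and x: "x \<in> polydisc d x0 r" and i: "i < d" and j: "j < d"
    define g where "g = chart_inv b y"
    define m where "m = chart_inv c x"
    have "g \<in> cdom b" unfolding g_def by (rule chart_inv_in_dom[OF y_img[OF y]])
    then have g: "g \<in> carrier G"
      using openin_subset[OF chart_dom_open[OF chb]] lie_group_points[OF G] by blast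
    have m: "m \<in> cdom c" unfolding m_def by (rule chart_inv_in_dom[OF x_img[OF x]])
    have mp: "m \<in> points M" by (rule cdom_points[OF m])
    have cm: "cmap c m = x" unfolding m_def by (rule cmap_chart_inv[OF x_img[OF x]])
    have m': "\<psi> g m \<in> cdom c" "F (concat_coords k y x) = cmap c (\<psi> g m)" unfolding g_def m_def by (rule F_eq[OF y x])+
    have md: "analytic_map_at M M (\<psi> g) m" by (rule analytic_map_at_action[OF G M act g])
    let ?e = "\<lambda>i. coord_vector M c i m"
    have e: "?e i \<in> tangent_space M m" for i by (rule coord_vector_tangent[OF M c_at[OF m]])
    \<comment> \<open>The pushed coordinate vectors are columns of the Jacobian of \<open>F\<close>
      in the space variables.\<close>
    have pf: "push_forward M M (\<psi> g) m (?e i) c l = partial_deriv (k + i) (\<lambda>z. F z l) (concat_coords k y x)" if i: "i < d" for i l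
    proof -
      have "push_forward M M (\<psi> g) m (?e i) c l = total_deriv d (local_rep c c (\<psi> g)) x (?e i c) l"
        by (simp only: push_forward_apply[OF M M md mp e c_at[OF m] c_at[OF m'(1)]] cm d_def)
      also have "\<dots> = (\<Sum>q<d. if q = i then partial_deriv i (\<lambda>x. local_rep c c (\<psi> g) x l) x else 0)"
        unfolding total_deriv_def coord_vector_self[OF M c_at[OF m] i[unfolded d_def]] by (rule sum.cong) auto
      also have "\<dots> = partial_deriv i (\<lambda>x. local_rep c c (\<psi> g) x l) x" using i by simp
      also have "\<dots> = partial_deriv i (\<lambda>x. F (concat_coords k y x) l) x"
        by (rule partial_deriv_cong[OF r(1) polydisc_in_space[OF x] i])
           (use F_eq(2)[OF y] polydisc_recentre[OF x] in \<open>simp add: local_rep_def g_def\<close>)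
      finally show ?thesis by (simp only: partial_deriv_concat_coords_right)
    qed
    \<comment> \<open>Invariance under the one element \<open>g\<close> with coordinates
      \<open>y\<close> becomes the coordinate identity demanded of \<open>F\<close> and
      \<open>w\<close>.\<close>
    have "w i j x = \<omega> m (?e i) (?e j)" unfolding w_def form_coeff_def Let_def m_def ..
    also have "\<dots> = pull_back M M (\<psi> g) \<omega> m (?e i) (?e j)"
      by (rule conjunct2[OF symp[unfolded symplectic_action_def], THEN bspec, OF g, THEN bspec, OF mp,
            THEN bspec, OF e, THEN bspec, OF e, symmetric])
    also have "\<dots> = \<omega> (\<psi> g m) (push_forward M M (\<psi> g) m (?e i)) (push_forward M M (\<psi> g) m (?e j))"
      by (simp only: pull_back_def)
    also have "\<dots> = (\<Sum>l<d. \<Sum>q<d. push_forward M M (\<psi> g) m (?e i) c l * push_forward M M (\<psi> g) m (?e j) c q *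
        form_coeff M \<omega> c l q (cmap c (\<psi> g m)))"
      unfolding d_def by (rule two_form_expand[OF M tf cdom_points[OF m'(1)] c_at[OF m'(1)]
            push_forward_tangent[OF M M md mp] push_forward_tangent[OF M M md mp]])
    also have "\<dots> = (\<Sum>l<d. \<Sum>q<d. w l q (F (concat_coords k y x)) * partial_deriv (k + i) (\<lambda>z. F z l) (concat_coords k y x) *
        partial_deriv (k + j) (\<lambda>z. F z q) (concat_coords k y x))"
      unfolding pf[OF i] pf[OF j] m'(2)[symmetric] w_def by (simp only: mult_ac)
    finally show "(\<Sum>l<d. \<Sum>q<d. w l q (F (concat_coords k y x)) * partial_deriv (k + i) (\<lambda>z. F z l) (concat_coords k y x) *
        partial_deriv (k + j) (\<lambda>z. F z q) (concat_coords k y x)) = w i j x" by (rule sym)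
  qed
  have "\<forall>a. \<exists>h. a < k \<longrightarrow> (\<exists>B. tate d x0 (r / 2) B h) \<and> (\<forall>j<d. \<forall>x\<in>polydisc d x0 (r / 2).
      partial_deriv j h x = (\<Sum>i<d. partial_deriv a (\<lambda>z. F z i) (concat_coords k y0 x) * w i j x))"
    using prim by blast
  from choice[OF this] obtain h where h': "\<forall>a. a < k \<longrightarrow> (\<exists>B. tate d x0 (r / 2) B (h a)) \<and> (\<forall>j<d. \<forall>x\<in>polydisc d x0 (r / 2).
      partial_deriv j (h a) x = (\<Sum>i<d. partial_deriv a (\<lambda>z. F z i) (concat_coords k y0 x) * w i j x))"
    by (elim exE) (rule that)
  then have h: "\<And>a. a < k \<Longrightarrow> \<exists>B. tate d x0 (r / 2) B (h a)"
    "\<And>a j x. a < k \<Longrightarrow> j < d \<Longrightarrow> x \<in> polydisc d x0 (r / 2) \<Longrightarrow>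
      partial_deriv j (h a) x = (\<Sum>i<d. partial_deriv a (\<lambda>z. F z i) (concat_coords k y0 x) * w i j x)"
    by simp_all
  \<comment> \<open>The half radius is where the primitives converge.\<close>
  define N where "N = {m \<in> cdom c. cmap c m \<in> polydisc d x0 (r / 2)}"
  have N: "openin (mtop M) N"
    unfolding N_def d_def by (rule chart_preimage_open[OF chc openin_polydisc]) (use r in simp)
  have m0N: "m0 \<in> N" using charts_at_dom[OF c] x0 r polydisc_center[of x0 d "r / 2"] by (simp add: N_def x0_def[symmetric])
  have "fun_analytic_at M (h a \<circ> cmap c) m \<and> (\<forall>v\<in>tangent_space M m. differential M (h a \<circ> cmap c) m v =
      \<omega> m (generated_field G \<G> M \<psi> (coord_vector \<G> b a \<one>\<^bsub>G\<^esub>) m) v)" if m: "m \<in> N" and a: "a < k" for m a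
  proof -
    define x where "x = cmap c m"
    have mc: "m \<in> cdom c" and x: "x \<in> polydisc d x0 (r / 2)" using m by (auto simp: N_def x_def)
    have mp: "m \<in> points M" by (rule cdom_points[OF mc])
    have xr: "x \<in> polydisc d x0 r" using x polydisc_mono[of "r / 2" r d x0] r by auto
    have cx: "chart_inv c x = m" unfolding x_def by (rule chart_inv_cmap[OF chc mc])
    have eq: "h a z = (h a \<circ> cmap c \<circ> chart_inv c) z" if "z \<in> polydisc d x (r / 2)" for z
    proof -
      have "z \<in> polydisc d x0 (r / 2)" using that polydisc_recentre[OF x] by simp
      then have "z \<in> polydisc d x0 r" using polydisc_mono[of "r / 2" r d x0] r by auto
      then show ?thesis using cmap_chart_inv[OF x_img] by simp
    qed
    obtain B where "tate d x0 (r / 2) B (h a)" using h(1)[OF a] by blast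
    from analytic_at_nearby[OF this x] have "analytic_at d (h a \<circ> cmap c \<circ> chart_inv c) x"
      by (rule analytic_at_cong[where s = "r / 2"]) (use r eq in auto)
    then have an: "fun_analytic_at M (h a \<circ> cmap c) m"
      unfolding d_def x_def by (rule fun_analytic_atI[OF M c_at[OF mc]])
    define X where "X = generated_field G \<G> M \<psi> (coord_vector \<G> b a \<one>\<^bsub>G\<^esub>) m"
    have X: "X \<in> tangent_space M m" unfolding X_def by (rule generated_field_tangent[OF G M act mp])
    have c1': "c \<in> charts_at M (\<psi> \<one>\<^bsub>G\<^esub> m)" using c_at[OF mc] action_one[OF act mp] by simp
    \<comment> \<open>The orbit map in coordinates is \<open>F\<close> with its space variables
      frozen at \<open>x\<close>. This identifies the coefficients in the differential of the
      primitive with the generated field.\<close>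
    have Xc: "X c i = partial_deriv a (\<lambda>z. F z i) (concat_coords k y0 x)" for i
    proof -
      have "X c i = total_deriv k (local_rep b c (\<lambda>g. \<psi> g m)) y0 (coord_vector \<G> b a \<one>\<^bsub>G\<^esub> b) i"
        using c1' by (simp only: X_def generated_field_def push_forward_def Let_def b_def[symmetric] if_True k_def y0_def)
      also have "\<dots> = (\<Sum>q<k. if q = a then partial_deriv a (\<lambda>y. local_rep b c (\<lambda>g. \<psi> g m) y i) y0 else 0)"
        unfolding total_deriv_def coord_vector_self[OF \<G> b a[unfolded k_def]] by (rule sum.cong) auto
      also have "\<dots> = partial_deriv a (\<lambda>y. local_rep b c (\<lambda>g. \<psi> g m) y i) y0" using a by simp
      also have "\<dots> = partial_deriv a (\<lambda>y. F (concat_coords k y x) i) y0"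
        by (rule partial_deriv_cong[OF r(1) y0 a]) (use F_eq(2)[OF _ xr] cx in \<open>simp add: local_rep_def\<close>)
      finally show ?thesis by (simp only: partial_deriv_concat_coords_left[OF a])
    qed
    have "differential M (h a \<circ> cmap c) m v = \<omega> m X v" if v: "v \<in> tangent_space M m" for v
    proof -
      have "differential M (h a \<circ> cmap c) m v = (\<Sum>l<d. partial_deriv l (h a \<circ> cmap c \<circ> chart_inv c) x * v c l)"
        unfolding d_def x_def by (rule differential_chart[OF M mp c_at[OF mc] an v])
      also have "\<dots> = (\<Sum>l<d. (\<Sum>i<d. X c i * w i l x) * v c l)"
      proof (rule sum.cong[OF refl])
        fix l assume "l \<in> {..<d}"
        then have l: "l < d" by simp
        have "partial_deriv l (h a) x = partial_deriv l (h a \<circ> cmap c \<circ> chart_inv c) x"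
          by (rule partial_deriv_cong[OF _ polydisc_in_space[OF x] l eq]) (use r in simp_all)
        then show "partial_deriv l (h a \<circ> cmap c \<circ> chart_inv c) x * v c l = (\<Sum>i<d. X c i * w i l x) * v c l"
          using h(2)[OF a l x] by (simp only: Xc)
      qed
      also have "\<dots> = (\<Sum>i<d. \<Sum>l<d. X c i * v c l * w i l x)"
        unfolding sum_distrib_right by (subst sum.swap) (simp only: mult_ac)
      also have "\<dots> = \<omega> m X v"
        unfolding w_def d_def x_def by (rule two_form_expand[OF M tf mp c_at[OF mc] X v, symmetric])
      finally show ?thesis .
    qed
    then show ?thesis using an unfolding X_def by blast
  qed
  then show ?thesis using N m0N unfolding b_def[symmetric] k_def[symmetric]
    by (intro exI[of _ N] conjI exI[of _ "\<lambda>a. h a \<circ> cmap c"]) auto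
qed

section \<open>The dual of the Lie algebra and the theorem\<close>

lemma dual_space_outside: "l \<in> dual_space V \<Longrightarrow> v \<notin> V \<Longrightarrow> l v = 0"
  unfolding dual_space_def by (drule CollectD) (elim conjE allE[of _ v] impE)

lemma dual_space_linear:
  assumes "l \<in> dual_space V" "u \<in> V" "v \<in> V"
  shows "l (\<lambda>c i. a * u c i + b * v c i) = a * l u + b * l v"
  using conjunct2[OF assms(1)[unfolded dual_space_def, THEN CollectD], THEN bspec, OF assms(2), THEN bspec, OF assms(3),
      THEN spec, of a, THEN spec, of b] .

lemma dual_space_lincomb:
  assumes "k \<in> dual_space V" "l \<in> dual_space V"
  shows "(\<lambda>x. a * k x + b * l x) \<in> dual_space V"
  unfolding dual_space_def
proof (intro CollectI conjI allI impI ballI)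
  show "a * k v + b * l v = 0" if "v \<notin> V" for v
    using dual_space_outside[OF assms(1) that] dual_space_outside[OF assms(2) that] by simp
  show "a * k (\<lambda>c i. s * u c i + t * v c i) + b * l (\<lambda>c i. s * u c i + t * v c i) =
      s * (a * k u + b * l u) + t * (a * k v + b * l v)" if "u \<in> V" "v \<in> V" for u v s t
    unfolding dual_space_linear[OF assms(1) that] dual_space_linear[OF assms(2) that] by (simp add: algebra_simps)
qed

lemma dual_space_zero: "(\<lambda>_. 0) \<in> dual_space V"
  by (simp add: dual_space_def)

lemma linear_chart_lincomb:
  assumes "c \<in> linear_charts W" "k \<in> W" "l \<in> W"
  shows "cmap c (\<lambda>x. a * k x + b * l x) = (\<lambda>i. a * cmap c k i + b * cmap c l i)"
  using assms(1)[unfolded linear_charts_def, THEN CollectD, THEN conjunct2, THEN conjunct2, THEN bspec, OF assms(2),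
      THEN bspec, OF assms(3), THEN spec, of a, THEN spec, of b] .

lemma linear_chart_sum:
  assumes c: "c \<in> linear_charts (dual_space V)" and "finite A" "\<And>a. a \<in> A \<Longrightarrow> l a \<in> dual_space V"
  shows "(\<lambda>x. \<Sum>a\<in>A. t a * l a x) \<in> dual_space V \<and>
    cmap c (\<lambda>x. \<Sum>a\<in>A. t a * l a x) = (\<lambda>i. \<Sum>a\<in>A. t a * cmap c (l a) i)"
  using assms(2,3)
proof (induction A rule: finite_induct)
  case empty
  show ?case using linear_chart_lincomb[OF c dual_space_zero dual_space_zero, of 0 0] by (simp add: dual_space_zero)
next
  case (insert a A)
  then have IH: "(\<lambda>x. \<Sum>a\<in>A. t a * l a x) \<in> dual_space V"
      "cmap c (\<lambda>x. \<Sum>a\<in>A. t a * l a x) = (\<lambda>i. \<Sum>a\<in>A. t a * cmap c (l a) i)" and a: "l a \<in> dual_space V" by auto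
  show ?case
    using dual_space_lincomb[OF a IH(1), of "t a" 1] linear_chart_lincomb[OF c a IH(1), of "t a" 1] insert(1,2) IH(2)
    by simp
qed

lemma dual_space_sum:
  assumes l: "l \<in> dual_space (tangent_space M m)" and "finite A" "\<And>k. k \<in> A \<Longrightarrow> e k \<in> tangent_space M m"
  shows "l (\<lambda>c i. \<Sum>k\<in>A. a k * e k c i) = (\<Sum>k\<in>A. a k * l (e k))"
  using assms(2,3)
proof (induction A rule: finite_induct)
  case empty
  show ?case using dual_space_linear[OF l tangent_zero tangent_zero, of 0 0] by simp
next
  case (insert k A)
  have "l (\<lambda>c i. a k * e k c i + 1 * (\<Sum>k\<in>A. a k * e k c i)) = a k * l (e k) + 1 * l (\<lambda>c i. \<Sum>k\<in>A. a k * e k c i)"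
    by (rule dual_space_linear[OF l _ tangent_sum[OF insert(1)]]) (use insert(4) in auto)
  then show ?case using insert by simp
qed

text \<open>Dual to the coordinate vectors of \<open>c\<close>, by \<open>coord_vector_self\<close>.
  The value 0 off the tangent space is what \<open>dual_space\<close> prescribes.\<close>

definition dual_basis :: "('a, 'p::prime_card) manifold \<Rightarrow> 'a \<Rightarrow> ('a, 'p) chart \<Rightarrow> nat \<Rightarrow> ('a, 'p) tangent \<Rightarrow> 'p padic" where
  "dual_basis M m c a \<xi> = (if \<xi> \<in> tangent_space M m then \<xi> c a else 0)"

lemma dual_basis_in_dual_space: "dual_basis M m c a \<in> dual_space (tangent_space M m)"
  by (auto simp: dual_space_def dual_basis_def tangent_lincomb)

text \<open>The topology of the dual is generated by its linear charts, so without one its carrier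
  would be empty. Evaluation on the coordinate vectors provides one.\<close>

lemma linear_charts_tangent_nonempty:
  assumes M: "analytic_manifold M" and c: "c \<in> charts_at M m"
  shows "linear_charts (dual_space (tangent_space M m)) \<noteq> {}"
proof -
  let ?W = "dual_space (tangent_space M m)" and ?e = "\<lambda>i. coord_vector M c i m"
  have e: "?e i \<in> tangent_space M m" for i by (rule coord_vector_tangent[OF M c])
  define \<phi> where "\<phi> l i = (if i < cdim c then l (?e i) else 0)" for l :: "('a, 'b) tangent \<Rightarrow> 'b padic" and i
  have expand: "l \<xi> = (\<Sum>i<cdim c. \<xi> c i * \<phi> l i)" if l: "l \<in> ?W" and \<xi>: "\<xi> \<in> tangent_space M m" for l \<xi>
  proof -
    have "l \<xi> = (\<Sum>i<cdim c. \<xi> c i * l (?e i))"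
      by (subst tangent_expand[OF M c \<xi>]) (rule dual_space_sum[OF l], use e in auto)
    also have "\<dots> = (\<Sum>i<cdim c. \<xi> c i * \<phi> l i)" by (rule sum.cong) (auto simp: \<phi>_def)
    finally show ?thesis .
  qed
  have inj: "inj_on \<phi> ?W"
  proof (rule inj_onI, rule ext)
    fix k l \<xi> assume k: "k \<in> ?W" and l: "l \<in> ?W" and eq: "\<phi> k = \<phi> l"
    show "k \<xi> = l \<xi>"
    proof (cases "\<xi> \<in> tangent_space M m")
      case True
      then show ?thesis using expand[OF k] expand[OF l] eq by simp
    next
      case False
      then show ?thesis using dual_space_outside[OF k] dual_space_outside[OF l] by simp
    qed
  qed
  have "\<phi> ` ?W = padic_space (cdim c)"
  proof
    show "\<phi> ` ?W \<subseteq> padic_space (cdim c)" by (auto simp: \<phi>_def padic_space_def)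
    show "padic_space (cdim c) \<subseteq> \<phi> ` ?W"
    proof
      fix t :: "nat \<Rightarrow> 'b padic" assume t: "t \<in> padic_space (cdim c)"
      define l where "l \<xi> = (if \<xi> \<in> tangent_space M m then \<Sum>a<cdim c. t a * \<xi> c a else 0)" for \<xi>
      have "l \<in> ?W"
        by (auto simp: dual_space_def l_def tangent_lincomb sum_distrib_left sum.distrib[symmetric] algebra_simps)
      moreover have "\<phi> l = t"
      proof
        fix i
        show "\<phi> l i = t i"
        proof (cases "i < cdim c")
          case True
          have "l (?e i) = (\<Sum>a<cdim c. t a * ?e i c a)" using e by (simp add: l_def)
          also have "\<dots> = (\<Sum>a<cdim c. if a = i then t i else 0)"
            unfolding coord_vector_self[OF M c True] by (rule sum.cong) auto
          finally show ?thesis using True by (simp add: \<phi>_def)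
        qed (use t in \<open>simp add: \<phi>_def padic_space_def\<close>)
      qed
      ultimately show "t \<in> \<phi> ` ?W" by blast
    qed
  qed
  then have "\<lparr>cdim = cdim c, cdom = ?W, cmap = \<phi>\<rparr> \<in> linear_charts ?W"
    using inj by (simp add: linear_charts_def bij_betw_def) (auto simp: \<phi>_def fun_eq_iff)
  then show ?thesis by blast
qed

lemma topspace_vector_space_manifold:
  assumes "linear_charts W \<noteq> {}"
  shows "topspace (mtop (vector_space_manifold W)) = W"
proof -
  obtain c where c: "c \<in> linear_charts W" using assms by blast
  have "cmap c ` W = padic_space (cdim c)"
    using c by (simp add: linear_charts_def bij_betw_def)
  then have "W = W \<inter> cmap c -` padic_space (cdim c)" by blast
  moreover have "openin (top_of_set (padic_space (cdim c))) (padic_space (cdim c))" by simp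
  ultimately have "W \<in> {W \<inter> cmap c -` U | c U. c \<in> linear_charts W \<and> openin (top_of_set (padic_space (cdim c))) U}"
    using c by blast
  then show ?thesis unfolding vector_space_manifold_def by (auto simp: topology_generated_by_topspace)
qed

text \<open>The topology is generated by preimages under linear charts, so continuity reduces to the
  coordinate functions, for which \<open>tate_small\<close> gives explicit neighbourhoods. As all
  values lie in \<open>W\<close>, which is the domain of every chart there, chart domains impose no
  restriction.\<close>

lemma analytic_map_vector_space:
  assumes M: "analytic_manifold M" and W: "linear_charts W \<noteq> {}" and \<mu>W: "\<And>m. \<mu> m \<in> W"
    and an: "\<And>c i m. c \<in> linear_charts W \<Longrightarrow> m \<in> points M \<Longrightarrow> fun_analytic_at M (\<lambda>m. cmap c (\<mu> m) i) m"
  shows "analytic_map M (vector_space_manifold W) \<mu>"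
  unfolding analytic_map_def
proof (intro conjI ballI)
  have lc: "cdom c = W" "cmap c (\<mu> m) \<in> padic_space (cdim c)" if "c \<in> linear_charts W" for c m
    using that \<mu>W[of m] by (auto simp: linear_charts_def bij_betw_def)
  show "continuous_map (mtop M) (mtop (vector_space_manifold W)) \<mu>"
    unfolding vector_space_manifold_def manifold.simps
  proof (rule continuous_on_generated_topo)
    fix S assume "S \<in> {W \<inter> cmap c -` U | c U. c \<in> linear_charts W \<and> openin (top_of_set (padic_space (cdim c))) U}"
    then obtain c U where c: "c \<in> linear_charts W" and U: "openin (top_of_set (padic_space (cdim c))) U"
      and S: "S = W \<inter> cmap c -` U" by blast
    show "openin (mtop M) (\<mu> -` S \<inter> points M)"
    proof (rule openin_subopen[THEN iffD2], intro ballI)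
      fix m assume "m \<in> \<mu> -` S \<inter> points M"
      then have m: "m \<in> points M" "cmap c (\<mu> m) \<in> U" by (auto simp: S)
      define e where "e = chart_at M m"
      have e: "e \<in> charts_at M m" unfolding e_def by (rule chart_at_in[OF M m(1)])
      have ch: "is_chart (mtop M) e" and me: "m \<in> cdom e"
        using charts_at_chart[OF M e] charts_at_dom[OF e] .
      have em: "chart_inv e (cmap e m) = m" by (rule chart_inv_cmap[OF ch me])
      obtain \<delta> where \<delta>: "\<delta> > 0" "polydisc (cdim c) (cmap c (\<mu> m)) \<delta> \<subseteq> U"
        using openin_padic_space_polydisc[OF U m(2)] by blast
      let ?g = "\<lambda>i x. cmap c (\<mu> (chart_inv e x)) i"
      have "\<exists>\<rho>>0. \<forall>i<cdim c. tate (cdim e) (cmap e m) \<rho> \<delta> (\<lambda>x. ?g i x - ?g i (cmap e m))"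
      proof (rule common_radius)
        fix i
        have "analytic_at (cdim e) (?g i) (cmap e m)"
          using an[OF c m(1), of i] e unfolding fun_analytic_at_def o_def by blast
        then obtain r B where "tate (cdim e) (cmap e m) r B (?g i)" unfolding analytic_at_def by blast
        from tate_small[OF this \<delta>(1)] show "\<exists>\<rho>>0. tate (cdim e) (cmap e m) \<rho> \<delta> (\<lambda>x. ?g i x - ?g i (cmap e m))" by blast
      qed (rule tate_shrink)
      then obtain \<rho> where \<rho>: "\<rho> > 0" "\<And>i. i < cdim c \<Longrightarrow> tate (cdim e) (cmap e m) \<rho> \<delta> (\<lambda>x. ?g i x - ?g i (cmap e m))"
        by blast
      define N where "N = {y \<in> cdom e. cmap e y \<in> polydisc (cdim e) (cmap e m) \<rho>}"
      have "openin (mtop M) N"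
        unfolding N_def by (rule chart_preimage_open[OF ch openin_polydisc[OF \<rho>(1)]])
      moreover have "m \<in> N"
        using me polydisc_center[OF chart_in_space[OF ch me], of \<rho>] \<rho>(1) by (simp add: N_def)
      moreover have "y \<in> \<mu> -` S \<inter> points M" if y: "y \<in> N" for y
      proof -
        have ye: "y \<in> cdom e" and yp: "cmap e y \<in> polydisc (cdim e) (cmap e m) \<rho>" using y by (auto simp: N_def)
        have ey: "chart_inv e (cmap e y) = y" by (rule chart_inv_cmap[OF ch ye])
        have "padic_norm (cmap c (\<mu> y) i - cmap c (\<mu> m) i) \<le> \<delta>" if "i < cdim c" for i
          using tate_norm_le[OF \<rho>(2)[OF that] yp] by (simp add: ey em)
        then have "cmap c (\<mu> y) \<in> polydisc (cdim c) (cmap c (\<mu> m)) \<delta>"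
          using lc(2)[OF c] by (simp add: polydisc_def)
        then have "\<mu> y \<in> S" using \<delta>(2) \<mu>W by (auto simp: S)
        moreover have "y \<in> points M" using openin_subset[OF chart_dom_open[OF ch]] ye by blast
        ultimately show ?thesis by simp
      qed
      ultimately show "\<exists>N. openin (mtop M) N \<and> m \<in> N \<and> N \<subseteq> \<mu> -` S \<inter> points M" by blast
    qed
  next
    show "\<mu> ` points M \<subseteq> \<Union>{W \<inter> cmap c -` U | c U. c \<in> linear_charts W \<and> openin (top_of_set (padic_space (cdim c))) U}"
      using topspace_vector_space_manifold[OF W] \<mu>W
      unfolding vector_space_manifold_def by (auto simp: topology_generated_by_topspace)
  qed
  fix c c' assume c: "c \<in> atlas M" and "c' \<in> atlas (vector_space_manifold W)"
  then have c': "c' \<in> linear_charts W" by (simp add: vector_space_manifold_def)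
  have ch: "is_chart (mtop M) c" by (rule manifold_chart[OF M c])
  have "\<mu> -` cdom c' = UNIV" using \<mu>W lc(1)[OF c'] by auto
  then have U: "cmap c ` (cdom c \<inter> \<mu> -` cdom c') = cmap c ` cdom c" by simp
  have op: "openin (top_of_set (padic_space (cdim c))) (cmap c ` cdom c)" using ch by (simp add: is_chart_def)
  show "analytic_between (cdim c) (cdim c') (local_rep c c' \<mu>) (cmap c ` (cdom c \<inter> \<mu> -` cdom c'))"
    unfolding analytic_between_def U
  proof (intro conjI op allI impI)
    show "local_rep c c' \<mu> ` cmap c ` cdom c \<subseteq> padic_space (cdim c')"
      using lc(2)[OF c'] by (auto simp: local_rep_def)
    fix j
    show "analytic_scalar (cdim c) (\<lambda>x. local_rep c c' \<mu> x j) (cmap c ` cdom c)"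
    proof (rule analytic_scalarI[OF op])
      fix x assume "x \<in> cmap c ` cdom c"
      then obtain m where m: "m \<in> cdom c" "x = cmap c m" by blast
      then have "m \<in> points M" using openin_subset[OF chart_dom_open[OF ch]] by blast
      from an[OF c' this, of j] m c
      have "analytic_at (cdim c) ((\<lambda>m. cmap c' (\<mu> m) j) \<circ> chart_inv c) (cmap c m)"
        unfolding fun_analytic_at_def charts_at_def by blast
      then show "analytic_at (cdim c) (\<lambda>x. local_rep c c' \<mu> x j) x"
        unfolding m(2) local_rep_def o_def .
    qed
  qed
qed

section \<open>The momentum map\<close>

text \<open>\<open>push_forward\<close> reads \<open>\<xi>\<close> only in the chart
  \<open>b\<close>, and linearly; so the expansion holds for any family \<open>\<xi>\<close>,
  tangent or not.\<close>

lemma generated_field_expand: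
  assumes G: "lie_group G \<G>"
  defines "b \<equiv> chart_at \<G> \<one>\<^bsub>G\<^esub>"
  shows "generated_field G \<G> M \<psi> \<xi> m =
    (\<lambda>c i. \<Sum>a<cdim b. \<xi> b a * generated_field G \<G> M \<psi> (coord_vector \<G> b a \<one>\<^bsub>G\<^esub>) m c i)"
proof (intro ext)
  have \<G>: "analytic_manifold \<G>" by (rule lie_group_manifold[OF G])
  have b: "b \<in> charts_at \<G> \<one>\<^bsub>G\<^esub>" unfolding b_def by (rule chart_at_in[OF \<G> lie_group_one[OF G]])
  fix c i
  let ?D = "\<lambda>q. partial_deriv q (\<lambda>x. local_rep b c (\<lambda>g. \<psi> g m) x i) (cmap b \<one>\<^bsub>G\<^esub>)"
  have gf: "generated_field G \<G> M \<psi> \<eta> m c i = (if c \<in> charts_at M (\<psi> \<one>\<^bsub>G\<^esub> m) then \<Sum>q<cdim b. ?D q * \<eta> b q else 0)" for \<eta>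
    by (simp add: generated_field_def push_forward_def Let_def b_def[symmetric] total_deriv_def)
  have "(\<Sum>q<cdim b. ?D q * coord_vector \<G> b a \<one>\<^bsub>G\<^esub> b q) = ?D a" if "a < cdim b" for a
  proof -
    have "(\<Sum>q<cdim b. ?D q * coord_vector \<G> b a \<one>\<^bsub>G\<^esub> b q) = (\<Sum>q<cdim b. if q = a then ?D a else 0)"
      unfolding coord_vector_self[OF \<G> b that] by (rule sum.cong) auto
    then show ?thesis using that by simp
  qed
  then have e: "generated_field G \<G> M \<psi> (coord_vector \<G> b a \<one>\<^bsub>G\<^esub>) m c i =
      (if c \<in> charts_at M (\<psi> \<one>\<^bsub>G\<^esub> m) then ?D a else 0)" if "a < cdim b" for a
    using that by (simp add: gf)
  show "generated_field G \<G> M \<psi> \<xi> m c i =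
      (\<Sum>a<cdim b. \<xi> b a * generated_field G \<G> M \<psi> (coord_vector \<G> b a \<one>\<^bsub>G\<^esub>) m c i)"
  proof -
    have "(\<Sum>a<cdim b. \<xi> b a * generated_field G \<G> M \<psi> (coord_vector \<G> b a \<one>\<^bsub>G\<^esub>) m c i) =
        (\<Sum>a<cdim b. \<xi> b a * (if c \<in> charts_at M (\<psi> \<one>\<^bsub>G\<^esub> m) then ?D a else 0))"
      by (rule sum.cong[OF refl]) (simp add: e)
    then show ?thesis by (simp add: gf mult.commute)
  qed
qed

theorem theorem1:
  fixes G :: "('g, 'r) monoid_scheme"
    and \<G> :: "('g, 'p::prime_card) manifold"
    and M :: "('a, 'p) manifold"
    and \<omega> :: "('a, 'p) two_form"
    and \<psi> :: "'g \<Rightarrow> 'a \<Rightarrow> 'a"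
    and n :: nat
  assumes "lie_group G \<G>"
    and "symplectic_manifold n M \<omega>"
    and "paracompact_space (mtop M)"
    and "symplectic_action G \<G> M \<omega> \<psi>"
  shows "weakly_hamiltonian G \<G> M \<omega> \<psi>"
proof -
  note G = assms(1) and symp = assms(4)
  have M: "analytic_manifold M" and \<omega>: "analytic_two_form M \<omega>" and closed: "closed_two_form M \<omega>"
    using assms(2) by (simp_all add: symplectic_manifold_def)
  have tf: "is_two_form M \<omega>" using \<omega> by (simp add: analytic_two_form_def)
  have act: "lie_group_action G \<G> M \<psi>" using symp by (simp add: symplectic_action_def)
  have \<G>: "analytic_manifold \<G>" by (rule lie_group_manifold[OF G])
  define b where "b = chart_at \<G> \<one>\<^bsub>G\<^esub>"
  have b: "b \<in> charts_at \<G> \<one>\<^bsub>G\<^esub>" unfolding b_def by (rule chart_at_in[OF \<G> lie_group_one[OF G]])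
  define X where "X a m = generated_field G \<G> M \<psi> (coord_vector \<G> b a \<one>\<^bsub>G\<^esub>) m" for a m
  \<comment> \<open>A condition on the germ of the tuple \<open>f\<close> at the single point
    \<open>m\<close>, for all basis directions together.\<close>
  define good where "good f m \<longleftrightarrow> (\<forall>a<cdim b. fun_analytic_at M (f a) m \<and>
      (\<forall>v\<in>tangent_space M m. differential M (f a) m v = \<omega> m (X a m) v))" for f :: "nat \<Rightarrow> 'a \<Rightarrow> 'p padic" and m
  define \<U> where "\<U> = {N. openin (mtop M) N \<and> (\<exists>f. \<forall>m\<in>N. good f m)}"
  have "points M \<subseteq> \<Union>\<U>"
  proof
    fix m assume m: "m \<in> points M"
    have "\<exists>N. openin (mtop M) N \<and> m \<in> N \<and> (\<exists>f. \<forall>m\<in>N. good f m)"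
      unfolding good_def X_def b_def by (rule local_momentum[OF G M \<omega> closed symp m])
    then obtain N where N: "openin (mtop M) N" "m \<in> N" "\<exists>f. \<forall>m\<in>N. good f m"
      by blast
    then have "N \<in> \<U>" unfolding \<U>_def mem_Collect_eq by (intro conjI)
    with N(2) show "m \<in> \<Union>\<U>" by (rule UnionI[rotated])
  qed
  moreover have "Hausdorff_space (mtop M)" using M by (simp add: analytic_manifold_def)
  moreover have "\<forall>U\<in>\<U>. openin (mtop M) U" by (simp add: \<U>_def)
  ultimately have "\<exists>s. \<forall>m\<in>points M. s m \<in> \<U> \<and> m \<in> s m \<and>
      (\<exists>N. openin (mtop M) N \<and> m \<in> N \<and> (\<forall>y\<in>N. s y = s m))"
    by (intro locally_constant_selection assms(3) manifold_compact_neighbourhood[OF M])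
  then obtain s where s': "\<forall>m\<in>points M. s m \<in> \<U> \<and> m \<in> s m \<and>
      (\<exists>N. openin (mtop M) N \<and> m \<in> N \<and> (\<forall>y\<in>N. s y = s m))"
    by (elim exE) (rule that)
  define F where "F U = (SOME f. \<forall>m\<in>U. good f m)" for U
  have F: "good (F U) m" if "U \<in> \<U>" "m \<in> U" for U m
  proof -
    have "\<exists>f. \<forall>m\<in>U. good f m" using that by (simp add: \<U>_def)
    then have "\<forall>m\<in>U. good (F U) m" unfolding F_def by (rule someI_ex)
    then show ?thesis using that by blast
  qed
  \<comment> \<open>Near \<open>m\<close> the selected set is constantly \<open>s m\<close>, so
    \<open>f\<close> coincides there with the one tuple \<open>F (s m)\<close>; different tuples
    need not agree where their sets overlap.\<close>
  define f where "f a m = F (s m) a m" for a m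
  have f: "fun_analytic_at M (f a) m" "\<And>v. v \<in> tangent_space M m \<Longrightarrow> differential M (f a) m v = \<omega> m (X a m) v"
    if m: "m \<in> points M" and a: "a < cdim b" for a m
  proof -
    obtain N where N: "openin (mtop M) N" "m \<in> N" "\<forall>y\<in>N. s y = s m"
      using s'[THEN bspec, OF m] by (elim exE conjE) (rule that)
    have sm: "good (F (s m)) m" using s'[THEN bspec, OF m] by (intro F) simp_all
    have eq: "F (s m) a y = f a y" if "y \<in> N" for y
      unfolding f_def N(3)[THEN bspec, OF that] ..
    show "fun_analytic_at M (f a) m"
      by (rule fun_analytic_at_cong[OF M N(1,2) eq]) (use sm a in \<open>simp_all add: good_def\<close>)
    show "differential M (f a) m v = \<omega> m (X a m) v" if "v \<in> tangent_space M m" for v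
    proof -
      have "differential M (f a) m v = differential M (F (s m) a) m v"
        by (rule differential_cong[OF M N(1,2) eq[symmetric]])
      then show ?thesis using sm a that unfolding good_def by simp
    qed
  qed
  define V where "V = tangent_space \<G> \<one>\<^bsub>G\<^esub>"
  define \<mu> where "\<mu> m = (\<lambda>\<xi>. \<Sum>a<cdim b. f a m * dual_basis \<G> \<one>\<^bsub>G\<^esub> b a \<xi>)" for m
  have lc: "linear_charts (dual_space V) \<noteq> {}"
    unfolding V_def by (rule linear_charts_tangent_nonempty[OF \<G> b])
  have db: "dual_basis \<G> \<one>\<^bsub>G\<^esub> b a \<in> dual_space V" for a
    unfolding V_def by (rule dual_basis_in_dual_space)
  \<comment> \<open>In every linear chart the coordinates of \<open>\<mu>\<close> are combinations
    of the functions \<open>f a\<close> with constant coefficients, the coordinates of the dual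
    basis. Analyticity in all these charts follows from that of the \<open>f a\<close>.\<close>
  have \<mu>_lin: "\<mu> m \<in> dual_space V \<and> cmap c (\<mu> m) = (\<lambda>i. \<Sum>a<cdim b. f a m * cmap c (dual_basis \<G> \<one>\<^bsub>G\<^esub> b a) i)"
    if "c \<in> linear_charts (dual_space V)" for c m
    unfolding \<mu>_def by (rule linear_chart_sum[OF that]) (use db in auto)
  have "analytic_map M (vector_space_manifold (dual_space V)) \<mu>"
  proof (rule analytic_map_vector_space[OF M lc])
    show "\<mu> m \<in> dual_space V" for m using \<mu>_lin lc by blast
    show "fun_analytic_at M (\<lambda>m. cmap c (\<mu> m) i) m" if c: "c \<in> linear_charts (dual_space V)" and m: "m \<in> points M" for c i m
      unfolding conjunct2[OF \<mu>_lin[OF c]] by (rule fun_analytic_at_sum[OF M]) (use f(1)[OF m] in simp)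
  qed
  moreover have "\<omega> m (generated_field G \<G> M \<psi> \<xi> m) v = differential M (\<lambda>m. \<mu> m \<xi>) m v"
    if \<xi>: "\<xi> \<in> lie_algebra G \<G>" and m: "m \<in> points M" and v: "v \<in> tangent_space M m" for \<xi> m v
  proof -
    have \<mu>\<xi>: "\<mu> m \<xi> = (\<Sum>a<cdim b. f a m * \<xi> b a)" for m
      using \<xi> by (simp add: \<mu>_def dual_basis_def lie_algebra_def)
    have "\<omega> m (generated_field G \<G> M \<psi> \<xi> m) v = \<omega> m (\<lambda>c i. \<Sum>a<cdim b. \<xi> b a * X a m c i) v"
      unfolding X_def b_def generated_field_expand[OF G, of M \<psi> \<xi> m] ..
    also have "\<dots> = (\<Sum>a<cdim b. \<xi> b a * \<omega> m (X a m) v)"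
      by (rule two_form_sum_left[OF tf m v]) (auto simp: X_def generated_field_tangent[OF G M act m])
    also have "\<dots> = (\<Sum>a<cdim b. \<xi> b a * differential M (f a) m v)"
      by (rule sum.cong[OF refl]) (simp add: f(2)[OF m _ v])
    also have "\<dots> = differential M (\<lambda>m. \<Sum>a<cdim b. f a m * \<xi> b a) m v"
      by (rule differential_sum[OF M m, symmetric]) (use f(1)[OF m] in simp)
    finally show ?thesis unfolding \<mu>\<xi> .
  qed
  ultimately have "momentum_map G \<G> M \<omega> \<psi> \<mu>"
    unfolding momentum_map_def lie_algebra_def[of G \<G>, folded V_def] by (intro conjI ballI)
  then show ?thesis unfolding weakly_hamiltonian_def by (intro exI[of _ \<mu>])
qed

end
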